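(* For real $\tau$ let $$f(s,\tau)=(1-\tau)\left(1+\sqrt5\,5^{-s}\right)\zeta(s)+\tau L(s,\psi),$$ where $\zeta$ is the Riemann zeta-function and $L(s,\psi)$ is the Dirichlet $L$-function of the Dirichlet character $\psi \bmod 5$ with $\psi(2)=-1$. Let $\tau_0\in[0,1]$ and let $\rho_0$ be a zero of order exactly two of $s\mapsto f(s,\tau_0)$ with $\Re\rho_0=1/2$ and $\Im\rho_0$ sufficiently large (larger than a certain absolute constant). Then the following two statements are equivalent: 1) There is $\theta>0$ and a zero trajectory $\rho(\tau)$, $\tau\in(\tau_0-\theta,\tau_0+\theta)$, of $f(s,\tau)$ such that (i) $\rho(\tau_0)=\rho_0$; (ii) $\Re\rho(\tau)=1/2$ for $\tau<\tau_0$; (iii) $\Re\rho(\tau)<1/2$ for $\tau>\tau_0$. 2) There is $\eta>0$ and a zero trajectory $\tilde\rho(\tau)$, $\tau\in(\tau_0-\eta,\tau_0+\eta)$, of $f'_s(s,\tau)=\frac{\partial f}{\partial s}(s,\tau)$ such that (i) $\tilde\rho(\tau_0)=\rho_0$; (ii) $\Re\tilde\rho(\tau)>1/2$ for $\tau<\tau_0$; (iii) $\Re\tilde\rho(\tau)<1/2$ for $\tau>\tau_0$.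
   Context: A zero trajectory of $f(s,\tau)$ on an interval $(\tau_0-\theta,\tau_0+\theta)$ is a continuous function $\rho:(\tau_0-\theta,\tau_0+\theta)\to\mathbb C$ with $f(\rho(\tau),\tau)=0$ for all $\tau$ in the interval; a zero trajectory of $f'_s(s,\tau)$ is defined analogously with $f'_s(\tilde\rho(\tau),\tau)=0$. *)

theory Defs
  imports "HOL-Complex_Analysis.Complex_Analysis"
begin

definition dirichlet_character :: "nat \<Rightarrow> (nat \<Rightarrow> complex) \<Rightarrow> bool" where
  "dirichlet_character m \<psi> \<longleftrightarrow>
     (\<forall>a b. \<psi> (a * b) = \<psi> a * \<psi> b) \<and>
     (\<forall>a. \<psi> (a + m) = \<psi> a) \<and>
     (\<forall>a. \<psi> a \<noteq> 0 \<longleftrightarrow> coprime a m)"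

(* The meromorphic continuation to the whole plane of the sum of a(n) / n^s over n \<ge> 1,
   for coefficients whose series converges in Re s > 1.  Being nicely meromorphic
   (continuous off the poles, value 0 at the poles) makes the continuation unique as a
   total function. *)
definition continued_dirichlet_series :: "(nat \<Rightarrow> complex) \<Rightarrow> complex \<Rightarrow> complex" where
  "continued_dirichlet_series a =
     (THE F. F nicely_meromorphic_on UNIV \<and>
        (\<forall>s. Re s > 1 \<longrightarrow> (\<lambda>n. a (Suc n) / of_nat (Suc n) powr s) sums F s))"

definition riemann_zeta :: "complex \<Rightarrow> complex" where
  "riemann_zeta = continued_dirichlet_series (\<lambda>_. 1)"

definition dirichlet_L :: "complex \<Rightarrow> (nat \<Rightarrow> complex) \<Rightarrow> complex" where
  "dirichlet_L s \<psi> = continued_dirichlet_series \<psi> s"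

definition f_family :: "(nat \<Rightarrow> complex) \<Rightarrow> complex \<Rightarrow> real \<Rightarrow> complex" where
  "f_family \<psi> s \<tau> =
     (1 - of_real \<tau>) * (1 + of_real (sqrt 5) * 5 powr (-s)) * riemann_zeta s
     + of_real \<tau> * dirichlet_L s \<psi>"

definition f_family_deriv :: "(nat \<Rightarrow> complex) \<Rightarrow> complex \<Rightarrow> real \<Rightarrow> complex" where
  "f_family_deriv \<psi> s \<tau> = deriv (\<lambda>z. f_family \<psi> z \<tau>) s"

(* The values that f_family and its derivative take at the pole s = 1 of zeta are
   conventional.  They do not matter where the interval may be shrunk around a centre
   at which the trajectory is not 1. *)
definition zero_trajectory ::
    "(complex \<Rightarrow> real \<Rightarrow> complex) \<Rightarrow> real \<Rightarrow> real \<Rightarrow> (real \<Rightarrow> complex) \<Rightarrow> bool" where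
  "zero_trajectory g \<tau>\<^sub>0 \<theta> \<rho> \<longleftrightarrow>
     continuous_on {\<tau>\<^sub>0 - \<theta><..<\<tau>\<^sub>0 + \<theta>} \<rho> \<and>
     (\<forall>\<tau>\<in>{\<tau>\<^sub>0 - \<theta><..<\<tau>\<^sub>0 + \<theta>}. g (\<rho> \<tau>) \<tau> = 0)"

end

theory Submission
  imports Defs "HOL-Probability.Probability" "HOL-Real_Asymp.Real_Asymp"
begin

text \<open>
  The coefficients of \<open>(1 + sqrt 5 * 5 powr -s) * zeta s\<close> and of \<open>L(s, \<psi>)\<close> are even, periodic modulo 5 and
  self-dual under the finite Fourier transform.  Hence for \<open>Im s > 0\<close> the family is \<open>f s \<tau> = \<kappa> s * F s \<tau>\<close>
  with \<open>\<kappa> s = (\<pi>/5) powr (s/2) / Gamma (s/2)\<close> and \<open>F\<close> affine in \<open>\<tau>\<close>, real on the critical line and invariant,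
  up to conjugation, under the reflection \<open>s \<mapsto> 1 - cnj s\<close>.

  Near a double zero write \<open>F s \<tau> = (s - \<rho>\<^sub>0)\<^sup>2 * a s + (\<tau> - \<tau>\<^sub>0) * D s\<close>.  If \<open>D \<rho>\<^sub>0 \<noteq> 0\<close>, the zeros of \<open>f\<close> solve
  \<open>\<tau> - \<tau>\<^sub>0 = - (s - \<rho>\<^sub>0)\<^sup>2 * a s / D s\<close>, so on one side of \<open>\<tau>\<^sub>0\<close> both lie on the line and on the other side they form a
  reflected pair off it; which side is which depends on the sign of the real number \<open>D \<rho>\<^sub>0 / a \<rho>\<^sub>0\<close>.  The zero of the
  derivative moves with a velocity whose real part is \<open>- Re (\<kappa>'/\<kappa>) / 2 * (D \<rho>\<^sub>0 / a \<rho>\<^sub>0)\<close>, and \<open>Re (\<kappa>'/\<kappa>) < 0\<close> high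
  up on the critical line since \<open>Re (Digamma (s/2))\<close> is positive there; so both statements amount to
  \<open>D \<rho>\<^sub>0 / a \<rho>\<^sub>0 < 0\<close>.  If \<open>D \<rho>\<^sub>0 = 0\<close>, then \<open>\<rho>\<^sub>0\<close> is a zero for all \<open>\<tau>\<close>, the other zero near it stays on the line, and
  both statements fail: between two zeros on the line, a zero of the derivative never has real part below \<open>1/2\<close>.
\<close>

section \<open>Theta functions\<close>

text \<open>The two members of the family share one factor \<open>\<kappa>\<close> because 1 + sqrt
  5 * 5^(-s) gives zeta a functional equation of conductor 5: multiplied by 5^(s/2) it becomes
  5^(s/2) + 5^((1-s)/2), which s -> 1-s preserves. Zeta itself enters the theta argument with period
  1, the character with period 5, and the symmetric factor is multiplied in afterwards. Since
  \<open>continued_dirichlet_series\<close> is a definite description, the completed functions are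
  built first and then identified with it by uniqueness. The zeros of \<open>f\<close> do not see
  \<open>\<kappa>\<close>, those of its derivative do: with \<open>\<kappa>\<close> constant,
  reflection would keep the zero of the derivative on the line. This is why the logarithmic
  derivative of \<open>\<kappa>\<close> decides the direction. The case
  \<open>D \<rho>\<^sub>0 = 0\<close> means that both members vanish at
  \<open>\<rho>\<^sub>0\<close>; it is treated, not excluded. There every term of the logarithmic
  derivative of \<open>f\<close> has negative real part to the left of the line, so the derivative
  cannot vanish. The height 20 is twice the height 10 at which Re (Digamma z) > 0 is proved.\<close>

definition wave :: "real \<Rightarrow> complex" where "wave x = cis (2 * pi * x)"

lemma wave_add: "wave (x + y) = wave x * wave y"
  by (simp add: wave_def cis_mult distrib_left)

lemma wave_int [simp]: "wave (of_int n) = 1"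
  by (simp add: wave_def cis_multiple_2pi)

lemma wave_0 [simp]: "wave 0 = 1" by (simp add: wave_def)

lemma norm_wave [simp]: "norm (wave x) = 1" by (simp add: wave_def)

lemma wave_exp: "wave x = exp (2 * of_real pi * \<i> * of_real x)"
  by (simp add: wave_def cis_conv_exp mult_ac)

lemma continuous_on_wave [continuous_intros]:
  "continuous_on S f \<Longrightarrow> continuous_on S (\<lambda>x. wave (f x))"
  unfolding wave_def by (intro continuous_intros)

lemma wave_has_vector_derivative:
  "((\<lambda>x. wave (c * x)) has_vector_derivative 2 * of_real pi * \<i> * of_real c * wave (c * x)) (at x within S)"
proof -
  have "((\<lambda>z. exp (2 * of_real pi * \<i> * (of_real c * z))) has_field_derivative
      2 * of_real pi * \<i> * of_real c * exp (2 * of_real pi * \<i> * (of_real c * of_real x))) (at (of_real x))"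
    by (auto intro!: derivative_eq_intros)
  from has_vector_derivative_real_field[OF this] show ?thesis
    unfolding wave_exp by simp
qed

section \<open>Fourier series of a holomorphic function at 0\<close>

definition fourier :: "(real \<Rightarrow> complex) \<Rightarrow> int \<Rightarrow> complex" where
  "fourier h m = integral {-1/2..1/2} (\<lambda>x. h x * wave (- of_int m * x))"

text \<open>One integration by parts gains a factor 1/|k|, a quantitative Riemann-Lebesgue lemma.
  The index sequence is arbitrary because both ends \<open>int M\<close> and
  \<open>- int M - 1\<close> of a telescoping sum need it.\<close>

lemma fourier_tendsto_0:
  fixes q :: "complex \<Rightarrow> complex"
  assumes "q holomorphic_on ball 0 1" "filterlim (\<lambda>M. \<bar>m M\<bar>) at_top sequentially"
  shows "(\<lambda>M. fourier (\<lambda>x. q (of_real x)) (m M)) \<longlonglongrightarrow> 0"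
proof -
  let ?q = "\<lambda>x. q (complex_of_real x)"
  have inb: "complex_of_real x \<in> ball 0 1" if "x \<in> {-1/2..1/2}" for x using that by (auto simp: abs_if)
  have cq: "continuous_on {-1/2..1/2} ?q"
    by (rule continuous_on_compose2[OF holomorphic_on_imp_continuous_on[OF assms(1)]])
       (use inb in \<open>auto intro!: continuous_intros\<close>)
  have cdq: "continuous_on {-1/2..1/2} (\<lambda>x. deriv q (complex_of_real x))"
    by (rule continuous_on_compose2[OF holomorphic_on_imp_continuous_on[OF holomorphic_deriv[OF assms(1) open_ball]]])
       (use inb in \<open>auto intro!: continuous_intros\<close>)
  obtain C where "\<forall>x\<in>{-1/2..1/2}. norm (deriv q (complex_of_real x)) \<le> C"
    using compact_imp_bounded[OF compact_continuous_image[OF cdq compact_Icc]]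
    unfolding bounded_iff by auto
  then have C: "\<And>x. x \<in> {-1/2..1/2} \<Longrightarrow> norm (deriv q (complex_of_real x)) \<le> C" by blast
  have "0 \<le> norm (deriv q (complex_of_real 0))" by simp
  also have "\<dots> \<le> C" by (rule C) simp
  finally have "0 \<le> C" .
  \<comment> \<open>The two boundary terms plus the remaining integral over an interval of length
    1.\<close>
  define K where "K = norm (?q (1/2)) + norm (?q (-1/2)) + C"
  have bound: "norm (fourier ?q k) \<le> K / (2 * pi) * inverse (real_of_int \<bar>k\<bar>)" if "k \<noteq> 0" for k
  proof -
    define c where "c = - 2 * of_real pi * \<i> * complex_of_int k"
    have c: "c \<noteq> 0" "norm c = 2 * pi * real_of_int \<bar>k\<bar>" using that by (auto simp: c_def norm_mult)
    define I where "I = integral {-1/2..1/2} (\<lambda>x. deriv q (complex_of_real x) * wave (- of_int k * x))"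
    have intI: "((\<lambda>x. deriv q (complex_of_real x) * wave (- of_int k * x)) has_integral I) {-1/2..1/2}"
      unfolding I_def by (intro integrable_integral integrable_continuous_real continuous_intros cdq)
    let ?y = "wave (- of_int k * (1/2)) * ?q (1/2) - wave (- of_int k * (-1/2)) * ?q (-1/2) - I"
    have 1: "((\<lambda>x. (c * wave (- of_int k * x)) * ?q x) has_integral ?y) {-1/2..1/2}"
    proof (rule integration_by_parts[OF bounded_bilinear_mult, where f = "\<lambda>x. wave (- of_int k * x)" and f' = "\<lambda>x. c * wave (- of_int k * x)" and g = "?q" and g' = "\<lambda>x. deriv q (complex_of_real x)"])
      show "continuous_on {-1/2..1/2} ?q" by (rule cq)
      show "continuous_on {-1/2..1/2} (\<lambda>x. wave (- of_int k * x))" by (intro continuous_intros)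
      show "(?q has_vector_derivative deriv q (complex_of_real x)) (at x)" if "x \<in> {-1/2..1/2}" for x
        by (rule has_vector_derivative_real_field[OF holomorphic_derivI[OF assms(1) open_ball inb[OF that]]])
      show "((\<lambda>x. wave (- of_int k * x)) has_vector_derivative c * wave (- of_int k * x)) (at x)" if "x \<in> {-1/2..1/2}" for x
        using wave_has_vector_derivative[of "- of_int k" x UNIV] by (simp add: c_def)
      show "((\<lambda>x. wave (- of_int k * x) * deriv q (complex_of_real x)) has_integral
         wave (- of_int k * (1/2)) * ?q (1/2) - wave (- of_int k * (-1/2)) * ?q (-1/2) - ?y) {-1/2..1/2}"
        using intI by (simp add: mult.commute)
    qed simp
    have eq: "c * fourier ?q k = ?y"
      using integral_unique[OF 1] unfolding fourier_def integral_mult_right[symmetric]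
      by (simp add: mult_ac)
    have "norm I \<le> C * (1/2 - (-1/2))"
      unfolding I_def
    proof (rule integral_bound)
      show "continuous_on {-1/2..1/2} (\<lambda>x. deriv q (complex_of_real x) * wave (- of_int k * x))"
        by (intro continuous_intros cdq)
    qed (use C in \<open>auto simp: norm_mult\<close>)
    then have "norm (c * fourier ?q k) \<le> K"
      unfolding eq K_def
      by (intro order_trans[OF norm_triangle_ineq4] add_mono) (simp_all add: norm_mult)
    then have "norm (fourier ?q k) * norm c \<le> K" by (simp add: norm_mult mult.commute)
    moreover have "norm c > 0" using c(1) by simp
    ultimately have "norm (fourier ?q k) \<le> K / norm c" by (simp only: pos_le_divide_eq)
    then show ?thesis unfolding c(2) by (simp only: divide_inverse inverse_mult_distrib mult.assoc)
  qed
  have "filterlim (\<lambda>M. real_of_int \<bar>m M\<bar>) at_top sequentially"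
    using assms(2) filterlim_compose filterlim_real_of_int_at_top by blast
  then have lim: "(\<lambda>M. K / (2 * pi) * inverse (real_of_int \<bar>m M\<bar>)) \<longlonglongrightarrow> 0"
    by (intro tendsto_mult_right_zero) (rule filterlim_compose[OF tendsto_inverse_0_at_top filterlim_ident], simp)
  have "eventually (\<lambda>M. 1 \<le> \<bar>m M\<bar>) sequentially"
    using assms(2) unfolding filterlim_at_top by blast
  then have ev: "eventually (\<lambda>M. m M \<noteq> 0) sequentially"
    by eventually_elim auto
  show ?thesis
    by (rule Lim_null_comparison[OF _ lim]) (use ev in eventually_elim, rule bound, simp)
qed

text \<open>With \<open>h x - h 0 = (wave x - 1) * q x\<close> the partial sums of the Fourier series of \<open>h\<close> at
  \<open>0\<close> telescope in the Fourier coefficients of \<open>q\<close>.\<close>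

lemma fourier_series_at_0:
  fixes h :: "complex \<Rightarrow> complex"
  assumes "h holomorphic_on ball 0 1"
  shows "(\<lambda>M. \<Sum>m\<in>{- int M..int M}. fourier (\<lambda>x. h (of_real x)) m) \<longlonglongrightarrow> h 0"
proof -
  define E where "E = (\<lambda>z. exp (2 * of_real pi * \<i> * z) :: complex)"
  have dE: "(E has_field_derivative 2 * of_real pi * \<i> * E z) (at z)" for z
    unfolding E_def by (auto intro!: derivative_eq_intros)
  have E_holo: "E holomorphic_on ball 0 1"
    unfolding E_def by (intro holomorphic_intros)
  have E0: "E 0 = 1" by (simp add: E_def)
  define h1 where "h1 = (\<lambda>z. if z = 0 then deriv h 0 else (h z - h 0) / (z - 0))"
  define e1 where "e1 = (\<lambda>z. if z = 0 then deriv E 0 else (E z - E 0) / (z - 0))"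
  have holo1: "h1 holomorphic_on ball 0 1" "e1 holomorphic_on ball 0 1"
    unfolding h1_def e1_def by (rule pole_lemma_open[OF assms open_ball] pole_lemma_open[OF E_holo open_ball])+
  have h1: "h z - h 0 = z * h1 z" and e1: "E z - 1 = z * e1 z" for z
    by (auto simp: h1_def e1_def E0)
  \<comment> \<open>The zeros of \<open>E z - 1\<close> are the integers, and only 0 lies in the
    unit disc; there the quotient takes the value 2 pi i, the derivative of
    \<open>E\<close>.\<close>
  have e1_nz: "e1 z \<noteq> 0" if "z \<in> ball 0 1" for z
  proof (cases "z = 0")
    case True
    then show ?thesis using DERIV_imp_deriv[OF dE[of 0]] by (simp add: e1_def E0)
  next
    case False
    have "E z \<noteq> 1"
    proof
      assume "E z = 1"
      then have "exp (2 * of_real pi * \<i> * z) = 1" by (simp add: E_def)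
      then obtain n :: int where n: "2 * of_real pi * \<i> * z = of_int (2 * n) * of_real pi * \<i>"
        unfolding exp_eq_1 by (auto simp: complex_eq_iff)
      then have "z = of_int n" by simp
      then have "n \<noteq> 0" "\<bar>n\<bar> < 1" using False that by (auto simp flip: of_int_abs)
      then show False by simp
    qed
    then show ?thesis using e1[of z] by auto
  qed
  define q where "q = (\<lambda>z. h1 z / e1 z)"
  have q_holo: "q holomorphic_on ball 0 1"
    unfolding q_def by (intro holomorphic_intros holo1 e1_nz)
  have hq: "h (of_real x) = h 0 + (wave x - 1) * q (of_real x)" if "x \<in> {-1/2..1/2}" for x
  proof -
    have "complex_of_real x \<in> ball 0 1" using that by (auto simp: abs_if)
    then have "(E (of_real x) - 1) * q (of_real x) = h (of_real x) - h 0"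
      using e1_nz unfolding h1 e1 q_def by simp
    moreover have "E (of_real x) = wave x" by (simp add: E_def wave_exp)
    ultimately show ?thesis by (simp add: algebra_simps)
  qed
  let ?q = "\<lambda>x. q (complex_of_real x)" and ?h = "\<lambda>x. h (complex_of_real x)"
  have cq: "continuous_on {-1/2..1/2} ?q"
    by (rule continuous_on_compose2[OF holomorphic_on_imp_continuous_on[OF q_holo]])
       (auto intro!: continuous_intros simp: abs_if)
  have fc: "fourier (\<lambda>_. h 0) m = (if m = 0 then h 0 else 0)" for m
  proof (cases "m = 0")
    case False
    define c where "c = - 2 * of_real pi * \<i> * complex_of_int m"
    have c: "c \<noteq> 0" using False by (simp add: c_def)
    have "((\<lambda>x. wave (- of_int m * x)) has_vector_derivative c * wave (- of_int m * x)) (at x within {-1/2..1/2})" for x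
      using wave_has_vector_derivative[of "- of_int m" x "{-1/2..1/2}"] by (simp add: c_def)
    then have "((\<lambda>x. c * wave (- of_int m * x)) has_integral wave (- of_int m * (1/2)) - wave (- of_int m * (-1/2))) {-1/2..1/2}"
      by (intro fundamental_theorem_of_calculus) auto
    moreover have "wave (of_int m * (1/2)) = wave (- of_int m * (1/2) + of_int m)" by (rule arg_cong[of _ _ wave]) simp
    then have "wave (of_int m * (1/2)) = wave (- of_int m * (1/2))" unfolding wave_add by simp
    ultimately have "((\<lambda>x. c * wave (- of_int m * x)) has_integral 0) {-1/2..1/2}" by simp
    then have "integral {-1/2..1/2} (\<lambda>x. c * wave (- of_int m * x)) = 0"
      by (rule integral_unique)
    then have "integral {-1/2..1/2} (\<lambda>x. wave (- of_int m * x)) = 0"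
      using c by (simp only: integral_mult_right mult_eq_0_iff simp_thms)
    then show ?thesis
      using False unfolding fourier_def by (simp only: integral_mult_right mult_zero_right if_False)
  qed (simp add: fourier_def)
  \<comment> \<open>Multiplication by \<open>wave x\<close> lowers the index of a Fourier
    coefficient by one, so \<open>(wave x - 1) * q\<close> contributes a difference of neighbouring
    coefficients.\<close>
  have step: "fourier ?h m = (if m = 0 then h 0 else 0) + (fourier ?q (m - 1) - fourier ?q m)" for m
  proof -
    have I: "(\<lambda>x. ?q x * wave (- of_int k * x)) integrable_on {-1/2..1/2}" for k
      by (intro integrable_continuous_real continuous_intros cq)
    have I0: "(\<lambda>x. h 0 * wave (- of_int k * x)) integrable_on {-1/2..1/2}" for k
      by (intro integrable_continuous_real continuous_intros)
    have "fourier ?h m = integral {-1/2..1/2} (\<lambda>x. h 0 * wave (- of_int m * x) +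
        (?q x * wave (- of_int (m - 1) * x) - ?q x * wave (- of_int m * x)))"
      unfolding fourier_def
    proof (rule integral_cong)
      fix x :: real assume x: "x \<in> {-1/2..1/2}"
      have "wave (- of_int (m - 1) * x) = wave (x + - of_int m * x)" by (simp add: algebra_simps)
      then show "h (complex_of_real x) * wave (- real_of_int m * x) = h 0 * wave (- real_of_int m * x) +
         (q (complex_of_real x) * wave (- real_of_int (m - 1) * x) - q (complex_of_real x) * wave (- real_of_int m * x))"
        unfolding hq[OF x] wave_add by (simp add: algebra_simps)
    qed
    also have "\<dots> = fourier (\<lambda>_. h 0) m + (fourier ?q (m - 1) - fourier ?q m)"
      unfolding fourier_def
      by (subst integral_add[OF I0 integrable_diff[OF I I]], subst integral_diff[OF I I]) simp
    finally show ?thesis using fc by simp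
  qed
  have sum: "(\<Sum>m\<in>{- int M..int M}. fourier ?h m) = h 0 + fourier ?q (- int M - 1) - fourier ?q (int M)" for M
  proof (induction M)
    case 0
    show ?case using step[of 0] by simp
  next
    case (Suc M)
    have "{- int (Suc M)..int (Suc M)} = insert (- int (Suc M)) (insert (int (Suc M)) {- int M..int M})"
      by auto
    then have "(\<Sum>m\<in>{- int (Suc M)..int (Suc M)}. fourier ?h m)
       = fourier ?h (- int (Suc M)) + (fourier ?h (int (Suc M)) + (\<Sum>m\<in>{- int M..int M}. fourier ?h m))"
      by simp
    also have "\<dots> = (fourier ?q (- int (Suc M) - 1) - fourier ?q (- int (Suc M)))
       + ((fourier ?q (int (Suc M) - 1) - fourier ?q (int (Suc M))) + (h 0 + fourier ?q (- int M - 1) - fourier ?q (int M)))"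
      unfolding Suc.IH unfolding step by simp
    also have "\<dots> = h 0 + fourier ?q (- int (Suc M) - 1) - fourier ?q (int (Suc M))"
    proof -
      have e: "- int (Suc M) = - int M - 1" "int (Suc M) - 1 = int M" by auto
      have "(A - B) + ((C - D) + (h' + B - C)) = h' + A - D" for A B C D h' :: complex by simp
      then show ?thesis unfolding e .
    qed
    finally show ?case .
  qed
  have "(\<lambda>M. fourier ?q (- int M - 1)) \<longlonglongrightarrow> 0"
  proof (rule fourier_tendsto_0[OF q_holo], unfold filterlim_at_top, intro allI)
    fix Z :: int
    show "\<forall>\<^sub>F M in sequentially. Z \<le> \<bar>- int M - 1\<bar>"
      by (rule eventually_sequentiallyI[of "nat Z"]) linarith
  qed
  moreover have "(\<lambda>M. fourier ?q (int M)) \<longlonglongrightarrow> 0"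
  proof (rule fourier_tendsto_0[OF q_holo], unfold filterlim_at_top, intro allI)
    fix Z :: int
    show "\<forall>\<^sub>F M in sequentially. Z \<le> \<bar>int M\<bar>"
      by (rule eventually_sequentiallyI[of "nat Z"]) linarith
  qed
  ultimately have "(\<lambda>M. h 0 + fourier ?q (- int M - 1) - fourier ?q (int M)) \<longlonglongrightarrow> h 0 + 0 - 0"
    by (intro tendsto_intros)
  then show ?thesis unfolding sum by simp
qed

section \<open>Poisson summation for Gaussians\<close>

lemma gaussian_fourier_std:
  "integrable lborel (\<lambda>x. std_normal_density x *\<^sub>R iexp (t * x))"
  "(LINT x|lborel. std_normal_density x *\<^sub>R iexp (t * x)) = of_real (exp (- (t^2) / 2))"
proof -
  show "integrable lborel (\<lambda>x. std_normal_density x *\<^sub>R iexp (t * x))"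
    by (rule Bochner_Integration.integrable_bound[OF integrable_normal_density[of 1 0]]) (auto simp: norm_mult)
  have "char std_normal_distribution t = (LINT x|lborel. std_normal_density x *\<^sub>R iexp (t * x))"
    unfolding char_def by (subst integral_density) auto
  then show "(LINT x|lborel. std_normal_density x *\<^sub>R iexp (t * x)) = of_real (exp (- (t^2) / 2))"
    by (simp add: char_std_normal_distribution)
qed

text \<open>Scaling by sqrt (2 pi y) turns the Gaussian into the standard normal density, whose
  characteristic function is known; the shift by \<open>u\<close> produces only the phase.\<close>

lemma gaussian_fourier:
  fixes y u :: real and m :: int
  assumes "y > 0"
  shows "((\<lambda>x. of_real (sqrt y * exp (- pi * y * (u + x)^2)) * wave (- of_int m * x)) has_integral
      of_real (exp (- pi * (of_int m)^2 / y)) * wave (of_int m * u)) UNIV"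
proof -
  define c where "c = sqrt (2 * pi * y)"
  have c: "c > 0" "c^2 = 2 * pi * y" using assms by (auto simp: c_def)
  define t where "t = - 2 * pi * of_int m / c"
  let ?f = "\<lambda>x. std_normal_density x *\<^sub>R iexp (t * x)"
  have "has_bochner_integral lborel ?f (of_real (exp (- (t^2) / 2)))"
    using gaussian_fourier_std[of t] by (simp add: has_bochner_integral_iff)
  then have "has_bochner_integral lborel (\<lambda>x. ?f (c * u + c * x)) (of_real (exp (- (t^2) / 2)) /\<^sub>R \<bar>c\<bar>)"
    using lborel_has_bochner_integral_real_affine_iff[of c ?f _ "c * u"] c by simp
  then have "((\<lambda>x. ?f (c * u + c * x)) has_integral of_real (exp (- (t^2) / 2)) /\<^sub>R c) UNIV"
    using has_integral_integral_lborel[of "\<lambda>x. ?f (c * u + c * x)"] c unfolding has_bochner_integral_iff by simp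
  then have "((\<lambda>x. (of_real c * wave (of_int m * u)) * ?f (c * u + c * x)) has_integral
      (of_real c * wave (of_int m * u)) * (of_real (exp (- (t^2) / 2)) /\<^sub>R c)) UNIV"
    by (rule has_integral_mult_right)
  moreover have "(of_real c * wave (of_int m * u)) * ?f (c * u + c * x)
      = of_real (sqrt y * exp (- pi * y * (u + x)^2)) * wave (- of_int m * x)" for x
  proof -
    have "(c * u + c * x)^2 = 2 * pi * y * (u + x)^2"
      using c(2) by (simp add: power_mult_distrib flip: distrib_left)
    then have d: "std_normal_density (c * u + c * x) = exp (- pi * y * (u + x)^2) / sqrt (2 * pi)"
      unfolding std_normal_density_def by simp
    have cs: "c / sqrt (2 * pi) = sqrt y" by (simp add: c_def real_sqrt_mult)
    have "t * (c * u + c * x) = - 2 * pi * (of_int m * (u + x))"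
      using c(1) by (simp add: t_def field_simps)
    then have "iexp (t * (c * u + c * x)) = iexp (- 2 * pi * (of_int m * (u + x)))" by (simp only:)
    also have "\<dots> = wave (- of_int m * u + - of_int m * x)"
      by (simp add: wave_def cis_conv_exp algebra_simps)
    finally have "iexp (t * (c * u + c * x)) = wave (- of_int m * u + - of_int m * x)" .
    then have "wave (of_int m * u) * iexp (t * (c * u + c * x)) = wave (of_int m * u + (- of_int m * u + - of_int m * x))"
      by (simp only: wave_add)
    then have "wave (of_int m * u) * iexp (t * (c * u + c * x)) = wave (- of_int m * x)" by simp
    then have "(of_real c * wave (of_int m * u)) * ?f (c * u + c * x)
       = of_real (c * std_normal_density (c * u + c * x)) * wave (- of_int m * x)"
      by (simp add: scaleR_conv_of_real mult_ac)
    also have "c * std_normal_density (c * u + c * x) = sqrt y * exp (- pi * y * (u + x)^2)"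
      unfolding d using cs by (simp add: field_simps)
    finally show ?thesis .
  qed
  moreover have "t^2 / 2 = pi * (of_int m)^2 / y"
    using c assms unfolding t_def by (simp add: power_mult_distrib power_divide power2_eq_square)
  then have "(of_real c * wave (of_int m * u)) * (of_real (exp (- (t^2) / 2)) /\<^sub>R c)
      = of_real (exp (- pi * (of_int m)^2 / y)) * wave (of_int m * u)"
    using c(1) by (simp add: scaleR_conv_of_real)
  ultimately show ?thesis by simp
qed

lemma summable_on_int_geometric:
  fixes r :: real
  assumes "0 \<le> r" "r < 1"
  shows "(\<lambda>k::int. r ^ nat \<bar>k\<bar>) summable_on UNIV"
proof -
  have s: "(\<lambda>n::nat. r ^ n) summable_on UNIV"
    using assms by (intro summable_nonneg_imp_summable_on) (auto intro: summable_geometric)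
  have "(\<lambda>k::int. r ^ nat \<bar>k\<bar>) summable_on range int"
    by (subst summable_on_reindex) (use s in \<open>auto simp: o_def\<close>)
  moreover have "(\<lambda>k::int. r ^ nat \<bar>k\<bar>) summable_on range (\<lambda>n. - int n)"
    by (subst summable_on_reindex) (use s in \<open>auto simp: o_def inj_on_def\<close>)
  moreover have "(UNIV :: int set) = range int \<union> range (\<lambda>n. - int n)"
    by (auto simp: image_iff) (metis int_cases2)
  ultimately show ?thesis by (metis summable_on_union)
qed

text \<open>The inequality t^2 >= |t| - 1/4 trades the Gaussian for a geometric term in |k|;
  \<open>B\<close> bounds how far t may be displaced from k.\<close>

lemma gaussian_le_geometric:
  fixes y t :: real
  assumes "y > 0" "\<bar>t\<bar> \<ge> \<bar>of_int k\<bar> - B"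
  shows "exp (- pi * y * t^2) \<le> exp (pi * y * (B + 1/4)) * exp (- pi * y) ^ nat \<bar>k\<bar>"
proof -
  have "t^2 - \<bar>t\<bar> + 1/4 = (\<bar>t\<bar> - 1/2)^2" by (simp add: power2_eq_square algebra_simps)
  then have "t^2 \<ge> \<bar>t\<bar> - 1/4" by (smt (verit) zero_le_power2)
  then have "- (t^2) \<le> (B + 1/4) - real (nat \<bar>k\<bar>)" using assms(2) by simp
  then have "pi * y * (- (t^2)) \<le> pi * y * ((B + 1/4) - real (nat \<bar>k\<bar>))"
    using assms(1) by (intro mult_left_mono) auto
  then have "exp (- pi * y * t^2) \<le> exp (pi * y * (B + 1/4) + real (nat \<bar>k\<bar>) * (- pi * y))"
    by (simp add: algebra_simps)
  then show ?thesis by (simp only: exp_add exp_of_nat_mult)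
qed

lemma gaussian_sum_summable:
  fixes y u :: real
  assumes "y > 0"
  shows "(\<lambda>k::int. exp (- pi * y * (of_int k + u)^2)) summable_on UNIV"
proof (rule summable_on_comparison_test)
  show "(\<lambda>k::int. exp (pi * y * (\<bar>u\<bar> + 1/4)) * exp (- pi * y) ^ nat \<bar>k\<bar>) summable_on UNIV"
    using assms by (intro summable_on_cmult_right summable_on_int_geometric) auto
  show "exp (- pi * y * (of_int k + u)^2) \<le> exp (pi * y * (\<bar>u\<bar> + 1/4)) * exp (- pi * y) ^ nat \<bar>k\<bar>" for k :: int
    by (rule gaussian_le_geometric[OF assms]) simp
qed auto

lemma filterlim_symmetric_intervals:
  "filterlim (\<lambda>K. {- int K..int K}) (finite_subsets_at_top UNIV) sequentially"
  unfolding filterlim_finite_subsets_at_top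
proof (intro allI impI)
  fix X :: "int set" assume "finite X \<and> X \<subseteq> UNIV"
  then have "finite X" by simp
  define K0 where "K0 = nat (Max (insert 0 (abs ` X)))"
  have "\<bar>x\<bar> \<le> int K0" if "x \<in> X" for x
    using that \<open>finite X\<close> by (auto simp: K0_def intro: Max_ge)
  then have "X \<subseteq> {- int K..int K}" if "K \<ge> K0" for K
    using that by (force simp: abs_le_iff)
  then show "\<forall>\<^sub>F K in sequentially. finite {- int K..int K} \<and> X \<subseteq> {- int K..int K} \<and> {- int K..int K} \<subseteq> UNIV"
    by (auto intro!: eventually_sequentiallyI[of K0])
qed

text \<open>Fourier partial sums run over symmetric intervals, unordered sums over all finite sets;
  this lets the value of the latter be read off from the former.\<close>

lemma has_sum_int_imp_symmetric_limit:
  fixes f :: "int \<Rightarrow> 'a::{topological_comm_monoid_add,t2_space}"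
  assumes "(f has_sum S) UNIV"
  shows "(\<lambda>K. \<Sum>k\<in>{- int K..int K}. f k) \<longlonglongrightarrow> S"
  using filterlim_compose[OF assms[unfolded has_sum_def] filterlim_symmetric_intervals] .

text \<open>Poisson summation: \<open>h\<close> is the sum of all integer translates of a Gaussian,
  its Fourier coefficients are values of the Fourier transform of that Gaussian, and its Fourier
  series is evaluated at 0.\<close>

theorem theta_transformation:
  fixes y u :: real
  assumes y: "y > 0"
  shows "((\<lambda>m::int. of_real (exp (- pi * (of_int m)^2 / y)) * wave (of_int m * u)) has_sum
      of_real (sqrt y * (\<Sum>\<^sub>\<infinity>k::int. exp (- pi * y * (of_int k + u)^2)))) UNIV"
proof -
  \<comment> \<open>The translates are taken with a complex argument because the Fourier series
    theorem is for functions holomorphic on the unit disc.\<close>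
  define g where "g = (\<lambda>(k::int) z. of_real (sqrt y) * exp (- of_real (pi * y) * (of_int k + of_real u + z)^2) :: complex)"
  \<comment> \<open>On the closed unit disc the imaginary part costs at most the factor exp (pi *
    y), and the real part moves the centre by at most 1, hence the displacement |u| + 1.\<close>
  define M where "M = (\<lambda>k::int. sqrt y * exp (pi * y) * (exp (pi * y * (\<bar>u\<bar> + 1 + 1/4)) * exp (- pi * y) ^ nat \<bar>k\<bar>))"
  have M_sum: "M summable_on UNIV"
    unfolding M_def using y by (intro summable_on_cmult_right summable_on_int_geometric) auto
  have bound: "norm (g k z) \<le> M k" if "z \<in> cball 0 1" for k z
  proof -
    have z: "\<bar>Re z\<bar> \<le> 1" "\<bar>Im z\<bar> \<le> 1" using that abs_Re_le_cmod abs_Im_le_cmod by (auto intro: order_trans)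
    have im: "(Im z)^2 \<le> 1" using z(2) by (simp add: abs_square_le_1)
    have "Re (- of_real (pi * y) * (of_int k + of_real u + z)^2) = - pi * y * ((of_int k + u + Re z)^2 - (Im z)^2)"
      by (simp add: power2_eq_square)
    then have "norm (exp (- of_real (pi * y) * (of_int k + of_real u + z)^2)) = exp (- pi * y * ((of_int k + u + Re z)^2 - (Im z)^2))"
      by (simp only: norm_exp_eq_Re)
    also have "\<dots> = exp (pi * y * (Im z)^2) * exp (- pi * y * (of_int k + u + Re z)^2)"
      by (simp add: algebra_simps flip: exp_add)
    also have "\<dots> \<le> exp (pi * y) * (exp (pi * y * (\<bar>u\<bar> + 1 + 1/4)) * exp (- pi * y) ^ nat \<bar>k\<bar>)"
    proof (rule mult_mono)
      show "exp (pi * y * (Im z)^2) \<le> exp (pi * y)" using im y by simp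
      show "exp (- pi * y * (of_int k + u + Re z)^2) \<le> exp (pi * y * (\<bar>u\<bar> + 1 + 1/4)) * exp (- pi * y) ^ nat \<bar>k\<bar>"
        by (rule gaussian_le_geometric[OF y]) (use z in linarith)
    qed auto
    finally have "sqrt y * norm (exp (- of_real (pi * y) * (of_int k + of_real u + z)^2)) \<le> M k"
      unfolding M_def mult.assoc by (rule mult_left_mono) (use y in simp)
    then show ?thesis using y by (simp add: g_def norm_mult)
  qed
  define h where "h = (\<lambda>z. \<Sum>\<^sub>\<infinity>k. g k z)"
  have ulim: "uniform_limit (cball 0 1) (\<lambda>X z. \<Sum>k\<in>X. g k z) h (finite_subsets_at_top UNIV)"
    unfolding h_def by (rule Weierstrass_m_test_general[OF bound M_sum])
  have g_holo: "g k holomorphic_on S" for k S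
    unfolding g_def by (intro holomorphic_intros)
  have h_holo: "h holomorphic_on ball 0 1"
  proof (rule holomorphic_uniform_limit[OF _ ulim])
    show "\<forall>\<^sub>F X in finite_subsets_at_top UNIV. continuous_on (cball 0 1) (\<lambda>z. \<Sum>k\<in>X. g k z) \<and> (\<lambda>z. \<Sum>k\<in>X. g k z) holomorphic_on ball 0 1"
      by (intro always_eventually allI conjI continuous_on_sum holomorphic_on_sum holomorphic_on_imp_continuous_on g_holo)
  qed auto
  have g_real: "g k (of_real x) = of_real (sqrt y * exp (- pi * y * (of_int k + u + x)^2))" for k x
    unfolding g_def by (simp flip: exp_of_real)
  have coeff: "fourier (\<lambda>x. h (of_real x)) m = of_real (exp (- pi * (of_int m)^2 / y)) * wave (of_int m * u)" for m
  proof -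
    define G where "G = (\<lambda>x. of_real (sqrt y * exp (- pi * y * (u + x)^2)) * wave (- of_int m * x))"
    have Gint: "G integrable_on {a..b}" for a b
      unfolding G_def by (intro integrable_continuous_real continuous_intros)
    have ul: "uniform_limit {-1/2..1/2} (\<lambda>X x. \<Sum>k\<in>X. g k (of_real x) * wave (- of_int m * x))
         (\<lambda>x. h (of_real x) * wave (- of_int m * x)) (finite_subsets_at_top UNIV)"
    proof -
      have eq: "(\<lambda>x. h (complex_of_real x) * wave (- of_int m * x)) = (\<lambda>x. \<Sum>\<^sub>\<infinity>k. g k (of_real x) * wave (- of_int m * x))"
        by (rule ext) (simp only: h_def infsum_cmult_left')
      show ?thesis
        unfolding eq
        by (rule Weierstrass_m_test_general[OF _ M_sum]) (use bound in \<open>auto simp: norm_mult abs_if\<close>)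
    qed
    have gc: "continuous_on {-1/2..1/2} (\<lambda>x. g k (of_real x) * wave (- of_int m * x))" for k
      unfolding g_real by (intro continuous_intros)
    have cont: "continuous_on {-1/2..1/2} (\<lambda>x. \<Sum>k\<in>X. g k (of_real x) * wave (- of_int m * x))" for X
      by (intro continuous_on_sum gc)
    obtain I J where IJ: "\<And>X. ((\<lambda>x. \<Sum>k\<in>X. g k (of_real x) * wave (- of_int m * x)) has_integral I X) {-1/2..1/2}"
        "((\<lambda>x. h (of_real x) * wave (- of_int m * x)) has_integral J) {-1/2..1/2}"
        "(I \<longlongrightarrow> J) (finite_subsets_at_top UNIV)"
      by (rule uniform_limit_integral[OF ul cont finite_subsets_at_top_neq_bot]) (rule that)
    have J: "fourier (\<lambda>x. h (of_real x)) m = J"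
      unfolding fourier_def using IJ(2) by (rule integral_unique)
    \<comment> \<open>Unfolding: translation by k leaves the wave unchanged, so the k-th summand
      over one period is the integral of \<open>G\<close> over the k-th unit interval.\<close>
    have piece: "((\<lambda>x. g k (of_real x) * wave (- of_int m * x)) has_integral integral {of_int k - 1/2..of_int k + 1/2} G) {-1/2..1/2}" for k
    proof -
      have "(G has_integral integral {of_int k - 1/2..of_int k + 1/2} G) {-1/2 + of_int k..1/2 + of_int k}"
        using integrable_integral[OF Gint[of "of_int k - 1/2" "of_int k + 1/2"]] by (simp add: add.commute)
      then have "((\<lambda>x. G (x + of_int k)) has_integral integral {of_int k - 1/2..of_int k + 1/2} G) {-1/2..1/2}"
        using has_integral_shift_Icc_real[of G "of_int k"] by (simp add: o_def add.commute)
      moreover have "G (x + of_int k) = g k (of_real x) * wave (- of_int m * x)" for x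
      proof -
        have "wave (- of_int m * (x + of_int k)) = wave (- of_int m * x + of_int (- m * k))"
          by (simp add: algebra_simps)
        then have "wave (- of_int m * (x + of_int k)) = wave (- of_int m * x)"
          unfolding wave_add wave_int by simp
        then show ?thesis unfolding G_def g_real by (simp add: add_ac)
      qed
      ultimately show ?thesis by simp
    qed
    have I_eq: "I X = (\<Sum>k\<in>X. integral {of_int k - 1/2..of_int k + 1/2} G)" if "finite X" for X
      by (rule has_integral_unique[OF IJ(1) has_integral_sum[OF that piece]])
    have tel: "I {- int K..int K} = integral {- real K - 1/2..real K + 1/2} G" for K
    proof (induction K)
      case (Suc K)
      have ar: "- (1/2) - real K = - real K - 1/2" by simp
      have "{- int (Suc K)..int (Suc K)} = insert (- int (Suc K)) (insert (int (Suc K)) {- int K..int K})"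
        by auto
      then have "I {- int (Suc K)..int (Suc K)} = integral {- real K - 1 - 1/2..- real K - 1/2} G
         + (integral {real K + 1/2..real K + 1 + 1/2} G + I {- int K..int K})"
        by (simp add: I_eq algebra_simps, simp only: ar)
      also have "\<dots> = integral {- real (Suc K) - 1/2..real (Suc K) + 1/2} G"
      proof -
        have c1: "integral {- real K - 1 - 1/2..- real K - 1/2} G + integral {- real K - 1/2..real K + 1/2} G
            = integral {- real K - 1 - 1/2..real K + 1/2} G"
          by (rule Henstock_Kurzweil_Integration.integral_combine[OF _ _ Gint]) auto
        have c2: "integral {- real K - 1 - 1/2..real K + 1/2} G + integral {real K + 1/2..real K + 1 + 1/2} G
            = integral {- real K - 1 - 1/2..real K + 1 + 1/2} G"
          by (rule Henstock_Kurzweil_Integration.integral_combine[OF _ _ Gint]) auto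
        have "X + (Y + Z) = (X + Z) + Y" for X Y Z :: complex by simp
        from this[of "integral {- real K - 1 - 1/2..- real K - 1/2} G"] have
          "integral {- real K - 1 - 1/2..- real K - 1/2} G
           + (integral {real K + 1/2..real K + 1 + 1/2} G + I {- int K..int K})
           = integral {- real K - 1 - 1/2..real K + 1 + 1/2} G"
          unfolding Suc.IH by (simp only: c1 c2)
        moreover have "- real K - 1 = - real (Suc K)" "real K + 1 = real (Suc K)" by simp_all
        ultimately show ?thesis by (simp only:)
      qed
      finally show ?case .
    qed (simp add: I_eq)
    have lim1: "(\<lambda>K. integral {- real K - 1/2..real K + 1/2} G) \<longlonglongrightarrow> J"
      using filterlim_compose[OF IJ(3) filterlim_symmetric_intervals] unfolding tel .
    let ?S = "of_real (exp (- pi * (of_int m)^2 / y)) * wave (of_int m * u)"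
    have "(G has_integral ?S) UNIV"
      unfolding G_def by (rule gaussian_fourier[OF y])
    then have alt: "\<forall>e>0. \<exists>B>0. \<forall>a b. ball 0 B \<subseteq> cbox a b \<longrightarrow> norm (integral (cbox a b) G - ?S) < e"
      unfolding has_integral_alt' by simp
    have lim2: "(\<lambda>K. integral {- real K - 1/2..real K + 1/2} G) \<longlonglongrightarrow> ?S"
    proof (rule LIMSEQ_I)
      fix e :: real assume "e > 0"
      then obtain B where B: "\<And>a b. ball 0 B \<subseteq> cbox a b \<Longrightarrow> norm (integral (cbox a b) G - ?S) < e"
        using alt by blast
      have "norm (integral {- real K - 1/2..real K + 1/2} G - ?S) < e" if "K \<ge> nat \<lceil>B\<rceil>" for K
      proof -
        have "real K \<ge> B" using that by linarith
        then have "ball 0 B \<subseteq> cbox (- real K - 1/2) (real K + 1/2)" by (auto simp: dist_real_def)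
        from B[OF this] show ?thesis by simp
      qed
      then show "\<exists>no. \<forall>K\<ge>no. norm (integral {- real K - 1/2..real K + 1/2} G - ?S) < e" by blast
    qed
    show ?thesis using LIMSEQ_unique[OF lim1 lim2] J by simp
  qed
  have h0: "h 0 = of_real (sqrt y * (\<Sum>\<^sub>\<infinity>k::int. exp (- pi * y * (of_int k + u)^2)))"
  proof -
    have "h 0 = (\<Sum>\<^sub>\<infinity>k. of_real (sqrt y * exp (- pi * y * (of_int k + u)^2)))"
      unfolding h_def using g_real[of _ 0] by simp
    also have "\<dots> = of_real (\<Sum>\<^sub>\<infinity>k::int. sqrt y * exp (- pi * y * (of_int k + u)^2))"
      by (rule infsumI, rule has_sum_of_real, rule has_sum_infsum, rule summable_on_cmult_right, rule gaussian_sum_summable[OF y])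
    finally show ?thesis by (simp add: infsum_cmult_right')
  qed
  \<comment> \<open>Convergence of symmetric partial sums does not give an unordered sum, so
    summability of the dual series is shown separately.\<close>
  have "(\<lambda>m::int. of_real (exp (- pi * (of_int m)^2 / y)) * wave (of_int m * u)) summable_on UNIV"
  proof (rule abs_summable_summable, rule summable_on_cong[THEN iffD1])
    show "(\<lambda>k::int. exp (- pi * (1/y) * (of_int k + 0)^2)) summable_on UNIV"
      using y by (intro gaussian_sum_summable) auto
  qed (simp add: norm_mult)
  then obtain S where S: "((\<lambda>m::int. of_real (exp (- pi * (of_int m)^2 / y)) * wave (of_int m * u)) has_sum S) UNIV"
    unfolding summable_on_def by blast
  have "S = h 0"
    by (rule LIMSEQ_unique[OF has_sum_int_imp_symmetric_limit[OF S]])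
       (rule fourier_series_at_0[OF h_holo, unfolded coeff])
  then show ?thesis using S h0 by simp
qed

section \<open>Theta series with self-dual coefficients\<close>

lemma has_sum_finite_sum:
  fixes f :: "'i \<Rightarrow> 'a \<Rightarrow> 'b::topological_comm_monoid_add"
  assumes "finite I" "\<And>i. i \<in> I \<Longrightarrow> (f i has_sum s i) A"
  shows "((\<lambda>x. \<Sum>i\<in>I. f i x) has_sum (\<Sum>i\<in>I. s i)) A"
  using assms by (induction I rule: finite_induct) (auto intro!: has_sum_add)

text \<open>Indexing by \<open>nat \<bar>m\<bar>\<close> extends the coefficients evenly to all
  integers. Periodicity comes for free: the left side of \<open>selfdual\<close> depends on m only
  modulo \<open>N\<close>, hence so does the right side. The eigenvalue exactly sqrt N is what gives
  the functional equation the sign plus.\<close>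

locale selfdual_coefficients =
  fixes a :: "nat \<Rightarrow> complex" and N :: nat
  assumes N: "N > 0"
    and selfdual: "\<And>m::int. (\<Sum>r<N. a r * wave (of_nat r * of_int m / of_nat N)) = of_real (sqrt N) * a (nat \<bar>m\<bar>)"
    and real: "\<And>n. cnj (a n) = a n"
begin

lemma a_cong:
  assumes "m mod int N = m' mod int N"
  shows "a (nat \<bar>m\<bar>) = a (nat \<bar>m'\<bar>)"
proof -
  obtain k where k: "m = m' + int N * k"
    using assms by (metis mod_eqE)
  have "wave (of_nat r * of_int m / of_nat N) = wave (of_nat r * of_int m' / of_nat N)" for r
  proof -
    have "real r * of_int m / of_nat N = real r * of_int m' / of_nat N + of_int (int r * k)"
      using N by (simp add: k field_simps)
    then show ?thesis by (simp only: wave_add wave_int mult_1_right)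
  qed
  then have "of_real (sqrt N) * a (nat \<bar>m\<bar>) = of_real (sqrt N) * a (nat \<bar>m'\<bar>)"
    unfolding selfdual[symmetric] by simp
  then show ?thesis using N by simp
qed

lemma a_mod: "a (nat \<bar>m\<bar>) = a (nat (m mod int N))"
  using a_cong[of m "m mod int N"] N by simp

definition bound :: real where "bound = (\<Sum>r<N. norm (a r))"

lemma norm_a_le: "norm (a n) \<le> bound"
proof -
  have "a n = a (nat (int n mod int N))" using a_mod[of "int n"] by simp
  also have "nat (int n mod int N) = n mod N" by (simp flip: zmod_int)
  finally have "norm (a n) = norm (a (n mod N))" by simp
  also have "\<dots> \<le> bound" unfolding bound_def using N by (intro member_le_sum) auto
  finally show ?thesis .
qed

lemma bound_nonneg: "bound \<ge> 0"
  unfolding bound_def by (simp add: sum_nonneg)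

definition c :: real where "c = pi / N"

lemma c_pos: "c > 0" using N by (simp add: c_def)

text \<open>In the variable \<open>v = ln x\<close> the substitution \<open>x \<mapsto> 1/x\<close> of the theta transformation is \<open>v \<mapsto> -v\<close>.\<close>

definition summand :: "nat \<Rightarrow> real \<Rightarrow> complex" where
  "summand n v = a (Suc n) * of_real (exp (- (c * real (Suc n) ^ 2 * exp v)))"

definition W :: "real \<Rightarrow> complex" where "W v = (\<Sum>n. summand n v)"

definition theta :: "real \<Rightarrow> complex" where
  "theta x = (\<Sum>\<^sub>\<infinity>n::int. a (nat \<bar>n\<bar>) * of_real (exp (- (c * real_of_int n ^ 2 * x))))"

lemma theta_has_sum:
  assumes "x > 0"
  shows "((\<lambda>n::int. a (nat \<bar>n\<bar>) * of_real (exp (- (c * real_of_int n ^ 2 * x)))) has_sum theta x) UNIV"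
  unfolding theta_def
proof (rule has_sum_infsum, rule abs_summable_summable, rule summable_on_comparison_test)
  show "(\<lambda>n::int. bound * exp (- pi * (x / N) * (of_int n + 0)^2)) summable_on UNIV"
    using assms N by (intro summable_on_cmult_right gaussian_sum_summable) auto
  fix n :: int
  have "norm (a (nat \<bar>n\<bar>) * of_real (exp (- (c * real_of_int n ^ 2 * x)))) = norm (a (nat \<bar>n\<bar>)) * exp (- pi * (x / N) * (of_int n + 0)^2)"
    by (simp add: norm_mult c_def mult_ac)
  also have "\<dots> \<le> bound * exp (- pi * (x / N) * (of_int n + 0)^2)"
    by (intro mult_right_mono norm_a_le) auto
  finally show "norm (a (nat \<bar>n\<bar>) * of_real (exp (- (c * real_of_int n ^ 2 * x)))) \<le> bound * exp (- pi * (x / N) * (of_int n + 0)^2)" .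
qed auto

text \<open>On each residue class modulo \<open>N\<close> the series is a Gaussian sum with y = N x
  and shift r / N, to which Poisson summation applies. The phases this creates are summed over r by
  \<open>selfdual\<close>, which returns the same coefficients times sqrt N.\<close>

lemma theta_inverse:
  assumes x: "x > 0"
  shows "theta (1 / x) = of_real (sqrt x) * theta x"
proof -
  define S where "S = (\<lambda>r::nat. \<Sum>\<^sub>\<infinity>k::int. exp (- pi * (N * x) * (of_int k + r / N)^2))"
  have y: "real N * x > 0" using N x by simp
  have S: "((\<lambda>n. if n mod int N = int r then of_real (exp (- (c * real_of_int n ^ 2 * x))) else 0) has_sum complex_of_real (S r)) UNIV"
    if r: "r < N" for r
  proof -
    have "((\<lambda>k::int. exp (- pi * (N * x) * (of_int k + r / N)^2)) has_sum S r) UNIV"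
      unfolding S_def by (rule has_sum_infsum, rule gaussian_sum_summable[OF y])
    then have "((\<lambda>k::int. complex_of_real (exp (- pi * (N * x) * (of_int k + r / N)^2))) has_sum of_real (S r)) UNIV"
      by (rule has_sum_of_real)
    moreover have "- pi * (N * x) * (of_int k + r / N)^2 = - (c * real_of_int (k * int N + int r) ^ 2 * x)" for k
    proof -
      have "real_of_int (k * int N + int r) = N * (of_int k + r / N)" using N by (simp add: field_simps)
      then show ?thesis using N by (simp add: c_def power_mult_distrib power2_eq_square)
    qed
    ultimately have "((\<lambda>k. complex_of_real (exp (- (c * real_of_int (k * int N + int r) ^ 2 * x)))) has_sum of_real (S r)) UNIV"
      by (simp only:)
    moreover have "bij_betw (\<lambda>k. k * int N + int r) UNIV {n. n mod int N = int r}"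
    proof (rule bij_betwI[where g = "\<lambda>n. n div int N"])
      show "(k * int N + int r) div int N = k" for k using r N by simp
      show "n div int N * int N + int r = n" if "n \<in> {n. n mod int N = int r}" for n
        using that by (metis div_mult_mod_eq mem_Collect_eq)
    qed (use r in auto)
    ultimately have "((\<lambda>n. complex_of_real (exp (- (c * real_of_int n ^ 2 * x)))) has_sum of_real (S r)) {n. n mod int N = int r}"
      using has_sum_reindex_bij_betw[of "\<lambda>k. k * int N + int r" UNIV "{n. n mod int N = int r}"
          "\<lambda>n. complex_of_real (exp (- (c * real_of_int n ^ 2 * x)))"] by simp
    \<comment> \<open>Each class is extended by zero, so that the finitely many classes can be added
      term by term.\<close>
    then show ?thesis
      by (rule has_sum_cong_neutral[THEN iffD1, rotated -1]) auto
  qed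
  have "((\<lambda>n. \<Sum>r<N. a r * (if n mod int N = int r then of_real (exp (- (c * real_of_int n ^ 2 * x))) else 0)) has_sum
      (\<Sum>r<N. a r * complex_of_real (S r))) UNIV"
    by (intro has_sum_finite_sum has_sum_cmult_right S) auto
  moreover have "(\<Sum>r<N. a r * (if n mod int N = int r then of_real (exp (- (c * real_of_int n ^ 2 * x))) else 0))
      = a (nat \<bar>n\<bar>) * of_real (exp (- (c * real_of_int n ^ 2 * x)))" for n
  proof -
    have "(\<Sum>r<N. a r * (if n mod int N = int r then of_real (exp (- (c * real_of_int n ^ 2 * x))) else 0))
        = (\<Sum>r<N. if r = nat (n mod int N) then a r * of_real (exp (- (c * real_of_int n ^ 2 * x))) else 0)"
      using N by (intro sum.cong) (auto simp: nat_eq_iff)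
    also have "nat (n mod int N) < N" using N by (simp add: nat_less_iff)
    then have "(\<Sum>r<N. if r = nat (n mod int N) then a r * of_real (exp (- (c * real_of_int n ^ 2 * x))) else 0)
        = a (nat (n mod int N)) * of_real (exp (- (c * real_of_int n ^ 2 * x)))" by simp
    finally show ?thesis unfolding a_mod[of n, symmetric] .
  qed
  ultimately have T: "theta x = (\<Sum>r<N. a r * complex_of_real (S r))"
    using theta_has_sum[OF x] has_sum_unique by auto
  have "((\<lambda>m::int. \<Sum>r<N. a r * (of_real (exp (- pi * (of_int m)^2 / (N * x))) * wave (of_int m * (r / N)))) has_sum
      (\<Sum>r<N. a r * of_real (sqrt (N * x) * S r))) UNIV"
    unfolding S_def by (intro has_sum_finite_sum has_sum_cmult_right theta_transformation y) auto
  moreover have "(\<Sum>r<N. a r * (of_real (exp (- pi * (of_int m)^2 / (N * x))) * wave (of_int m * (r / N))))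
      = of_real (sqrt N) * (a (nat \<bar>m\<bar>) * of_real (exp (- (c * real_of_int m ^ 2 * (1 / x)))))" for m
  proof -
    have L: "(\<Sum>r<N. a r * (of_real (exp (- pi * (of_int m)^2 / (N * x))) * wave (of_int m * (r / N))))
       = (\<Sum>r<N. a r * wave (of_nat r * of_int m / of_nat N)) * of_real (exp (- pi * (of_int m)^2 / (N * x)))"
      unfolding sum_distrib_right by (intro sum.cong) (auto simp: mult_ac)
    have e: "- pi * (of_int m)^2 / (N * x) = - (c * real_of_int m ^ 2 * (1 / x))"
      by (simp add: c_def)
    show ?thesis by (rule trans[OF L], unfold selfdual, unfold e, rule mult.assoc)
  qed
  ultimately have 1: "((\<lambda>m. of_real (sqrt N) * (a (nat \<bar>m\<bar>) * of_real (exp (- (c * real_of_int m ^ 2 * (1 / x)))))) has_sum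
      (\<Sum>r<N. a r * of_real (sqrt (N * x) * S r))) UNIV" by simp
  have 2: "((\<lambda>m. of_real (sqrt N) * (a (nat \<bar>m\<bar>) * of_real (exp (- (c * real_of_int m ^ 2 * (1 / x)))))) has_sum
      of_real (sqrt N) * theta (1 / x)) UNIV"
    using x by (intro has_sum_cmult_right theta_has_sum) auto
  have "of_real (sqrt N) * theta (1 / x) = (\<Sum>r<N. a r * of_real (sqrt (N * x) * S r))"
    using has_sum_unique[OF 2 1] .
  also have "\<dots> = of_real (sqrt N) * (of_real (sqrt x) * theta x)"
    unfolding T sum_distrib_left by (intro sum.cong) (auto simp: real_sqrt_mult mult_ac)
  finally show ?thesis using N by simp
qed

lemma summand_sums: "(\<lambda>n. summand n v) sums ((theta (exp v) - a 0) / 2)"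
proof -
  let ?g = "\<lambda>n::int. a (nat \<bar>n\<bar>) * of_real (exp (- (c * real_of_int n ^ 2 * exp v)))"
  have "(\<Sum>n\<in>{- int K..int K}. ?g n) = a 0 + 2 * (\<Sum>n<K. summand n v)" for K
  proof (induction K)
    case (Suc K)
    have "{- int (Suc K)..int (Suc K)} = insert (- int (Suc K)) (insert (int (Suc K)) {- int K..int K})"
      by auto
    then have "(\<Sum>n\<in>{- int (Suc K)..int (Suc K)}. ?g n) = ?g (- int (Suc K)) + (?g (int (Suc K)) + (\<Sum>n\<in>{- int K..int K}. ?g n))"
      by simp
    also have "?g (- int (Suc K)) = summand K v" by (simp add: summand_def nat_add_distrib power2_eq_square algebra_simps)
    also have "?g (int (Suc K)) = summand K v" by (simp add: summand_def nat_add_distrib power2_eq_square algebra_simps)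
    finally show ?case unfolding Suc.IH by (simp add: algebra_simps)
  qed simp
  then have "(\<lambda>K. a 0 + 2 * (\<Sum>n<K. summand n v)) \<longlonglongrightarrow> theta (exp v)"
    using has_sum_int_imp_symmetric_limit[OF theta_has_sum[of "exp v"]] by simp
  then have "(\<lambda>K. ((a 0 + 2 * (\<Sum>n<K. summand n v)) - a 0) / 2) \<longlonglongrightarrow> (theta (exp v) - a 0) / 2"
    by (intro tendsto_intros) auto
  then show ?thesis by (simp add: sums_def)
qed

lemma theta_eq_W: "theta (exp v) = a 0 + 2 * W v"
proof -
  have "(theta (exp v) - a 0) / 2 = W v"
    unfolding W_def by (rule sums_unique[OF summand_sums])
  then have "theta (exp v) - a 0 = 2 * W v" by simp
  then show ?thesis by (metis add.commute diff_add_cancel)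
qed

text \<open>The inversion formula for \<open>theta (exp v) = a 0 + 2 * W v\<close>. The term n = 0,
  absent from \<open>W\<close>, leaves the elementary exponentials that later become the poles of
  \<open>Lam\<close>.\<close>

lemma W_reflect: "W (- v) = of_real (exp (v / 2)) * W v + a 0 / 2 * (of_real (exp (v / 2)) - 1)"
proof -
  have "sqrt (exp v) = exp (v / 2)"
    by (rule real_sqrt_unique) (simp_all add: power2_eq_square flip: exp_add)
  moreover have "exp (- v) = 1 / exp v" by (simp add: exp_minus inverse_eq_divide)
  ultimately have "a 0 + 2 * W (- v) = of_real (exp (v / 2)) * (a 0 + 2 * W v)"
    using theta_inverse[of "exp v"] theta_eq_W[of v] theta_eq_W[of "- v"] by simp
  then show ?thesis by (simp add: field_simps)
qed

lemma cnj_W: "cnj (W v) = W v"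
proof -
  have "(\<lambda>n. cnj (summand n v)) sums cnj (W v)"
    using summand_sums[of v] unfolding W_def by (subst sums_cnj) (auto simp: sums_iff)
  then show ?thesis by (simp add: summand_def real W_def sums_iff)
qed

end

section \<open>Analytic continuation and functional equation\<close>

lemma Gamma_integral_exp_1:
  fixes z :: complex
  assumes z: "Re z > 0"
  shows "has_bochner_integral lborel (\<lambda>v. exp (z * of_real v - of_real (exp v))) (Gamma z)"
proof -
  define F where "F = (\<lambda>t. complex_of_real t powr (z - 1) / of_real (exp t))"
  have Fabs: "F absolutely_integrable_on {0<..}"
    unfolding F_def by (rule absolutely_integrable_Gamma_integral'[OF z])
  have Fint: "(F has_integral Gamma z) {0<..}"
    unfolding F_def by (rule Gamma_integral_complex'[OF z])
  define G where "G = (\<lambda>v. exp (z * of_real v - of_real (exp v)) :: complex)"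
  have FG: "exp v *\<^sub>R F (exp v) = G v" for v
  proof -
    have "complex_of_real (exp v) powr (z - 1) = exp ((z - 1) * of_real v)"
      by (simp add: powr_def Ln_of_real mult.commute flip: exp_of_real)
    then have "exp v *\<^sub>R F (exp v) = exp (of_real v) * (exp ((z - 1) * of_real v) / exp (of_real (exp v)))"
      by (simp add: F_def scaleR_conv_of_real flip: exp_of_real)
    also have "\<dots> = G v"
      by (simp add: G_def algebra_simps flip: exp_add exp_diff)
    finally show ?thesis .
  qed
  have img: "exp ` UNIV = {0::real<..}"
    by (auto simp: image_iff) (metis exp_ln)
  have inj: "inj (exp :: real \<Rightarrow> real)" by (simp add: inj_on_def)
  \<comment> \<open>The change of variables is made for real-valued functions, hence through a
    real-linear functional, later instantiated with \<open>Re\<close> and \<open>Im\<close>.\<close>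
  have cov: "(\<lambda>x. L (G x)) absolutely_integrable_on UNIV \<and> integral UNIV (\<lambda>x. L (G x)) = L (Gamma z)"
    if L: "bounded_linear L" for L :: "complex \<Rightarrow> real"
  proof -
    have "(\<lambda>t. L (F t)) absolutely_integrable_on {0<..}"
      using absolutely_integrable_linear[OF Fabs L] by (simp add: o_def)
    moreover have "integral {0<..} (\<lambda>t. L (F t)) = L (Gamma z)"
      using has_integral_linear[OF Fint L] by (simp add: o_def integral_unique)
    ultimately have "(\<lambda>x. \<bar>exp x\<bar> * L (F (exp x))) absolutely_integrable_on UNIV \<and>
        integral UNIV (\<lambda>x. \<bar>exp x\<bar> * L (F (exp x))) = L (Gamma z)"
      using has_absolute_integral_change_of_variables_1'[of UNIV exp exp "\<lambda>t. L (F t)" "L (Gamma z)"]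
      by (simp add: img DERIV_exp inj)
    moreover have "\<bar>exp x\<bar> * L (F (exp x)) = L (G x)" for x
      unfolding FG[symmetric] by (simp add: linear_scale[OF bounded_linear.linear[OF L]])
    ultimately show ?thesis by simp
  qed
  have "integrable lebesgue (\<lambda>x. Re (G x))" "integrable lebesgue (\<lambda>x. Im (G x))"
    using cov[OF bounded_linear_Re] cov[OF bounded_linear_Im] by (auto simp: set_integrable_def)
  moreover have meas: "G \<in> borel_measurable borel"
    unfolding G_def by (intro borel_measurable_continuous_onI continuous_intros)
  then have "(\<lambda>x. Re (G x)) \<in> borel_measurable borel" "(\<lambda>x. Im (G x)) \<in> borel_measurable borel"
    by measurable
  ultimately have int: "integrable lborel (\<lambda>x. Re (G x))" "integrable lborel (\<lambda>x. Im (G x))"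
    by (auto simp: integrable_completion)
  have G: "integrable lborel G"
  proof -
    have "integrable lborel (\<lambda>x. of_real (Re (G x)) + \<i> * of_real (Im (G x)))"
      by (intro Bochner_Integration.integrable_add integrable_mult_right integrable_of_real int)
    then show ?thesis by (simp flip: complex_eq)
  qed
  have "(G has_integral integral\<^sup>L lborel G) UNIV"
    by (rule has_integral_integral_lborel[OF G])
  then have "((\<lambda>x. Re (G x)) has_integral Re (integral\<^sup>L lborel G)) UNIV" "((\<lambda>x. Im (G x)) has_integral Im (integral\<^sup>L lborel G)) UNIV"
    using has_integral_linear[OF _ bounded_linear_Re] has_integral_linear[OF _ bounded_linear_Im] by (auto simp: o_def)
  then have "integral\<^sup>L lborel G = Gamma z"
    using cov[OF bounded_linear_Re] cov[OF bounded_linear_Im] by (simp add: complex_eq_iff integral_unique)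
  then show ?thesis using G unfolding G_def has_bochner_integral_iff by simp
qed

lemma Gamma_integral_exp:
  fixes z :: complex and b :: real
  assumes z: "Re z > 0" and b: "b > 0"
  shows "has_bochner_integral lborel (\<lambda>v. exp (z * of_real v - of_real (b * exp v))) (Gamma z * exp (- z * of_real (ln b)))"
proof -
  have "has_bochner_integral lborel (\<lambda>v. exp (z * of_real (ln b + 1 * v) - of_real (exp (ln b + 1 * v)))) (Gamma z)"
    using lborel_has_bochner_integral_real_affine_iff[of 1 "\<lambda>v. exp (z * of_real v - of_real (exp v))" "Gamma z" "ln b"]
      Gamma_integral_exp_1[OF z] by simp
  then have "has_bochner_integral lborel (\<lambda>v. exp (z * of_real (ln b + 1 * v) - of_real (exp (ln b + 1 * v))) * exp (- z * of_real (ln b)))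
      (Gamma z * exp (- z * of_real (ln b)))"
    by (rule has_bochner_integral_mult_left[rotated])
  moreover have "exp (z * of_real (ln b + 1 * v) - of_real (exp (ln b + 1 * v))) * exp (- z * of_real (ln b))
      = exp (z * of_real v - of_real (b * exp v))" for v
  proof -
    have "z * of_real (ln b + 1 * v) - of_real (exp (ln b + 1 * v)) + - z * of_real (ln b) = z * of_real v - of_real (b * exp v)"
      using b by (simp add: exp_add algebra_simps)
    then show ?thesis by (simp only: flip: exp_add)
  qed
  ultimately show ?thesis by simp
qed

lemma integral_exp_half_line:
  fixes z :: complex
  assumes "Re z < 0"
  shows "has_bochner_integral lborel (\<lambda>v. indicator {0..} v *\<^sub>R exp (z * of_real v)) (- 1 / z)"
proof -
  have z0: "z \<noteq> 0" using assms by auto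
  let ?f = "\<lambda>v. exp (z * of_real v)" and ?F = "\<lambda>v. exp (z * of_real v) / z"
  have der: "(?F has_vector_derivative ?f x) (at x)" for x
  proof -
    have "((\<lambda>w. exp (z * w) / z) has_field_derivative ?f x) (at (of_real x))"
      using z0 by (auto intro!: derivative_eq_intros)
    then show ?thesis by (rule has_vector_derivative_real_field)
  qed
  have int: "set_integrable lborel {0<..} ?f"
    unfolding set_integrable_def
  proof (rule Bochner_Integration.integrable_bound)
    show "integrable lborel (\<lambda>v. indicator {0<..} v *\<^sub>R exp (- (v * (- Re z))))"
      using integrable_I0i_exp_mscale[of "- Re z"] assms by (simp add: set_integrable_def)
    show "(\<lambda>v. indicator {0<..} v *\<^sub>R ?f v) \<in> borel_measurable lborel"
      by (intro borel_measurable_scaleR borel_measurable_indicator) (auto intro!: borel_measurable_continuous_onI continuous_intros)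
  qed (auto simp: norm_exp_eq_Re indicator_def mult.commute)
  have "(?F \<longlongrightarrow> 0) at_top"
  proof (rule tendsto_norm_zero_cancel)
    have "((\<lambda>v. exp (Re z * v)) \<longlongrightarrow> 0) at_top"
      using filterlim_compose[OF exp_at_bot filterlim_tendsto_neg_mult_at_bot[OF tendsto_const assms filterlim_ident]] by simp
    then have "((\<lambda>v. exp (Re z * v) / norm z) \<longlongrightarrow> 0 / norm z) at_top"
      using z0 by (intro tendsto_intros) auto
    then show "((\<lambda>v. norm (?F v)) \<longlongrightarrow> 0) at_top"
      by (simp add: norm_divide norm_exp_eq_Re)
  qed
  moreover have "(?F \<longlongrightarrow> ?F 0) (at_right 0)"
    using z0 by (intro tendsto_intros) auto
  moreover have ei: "einterval 0 \<infinity> = {0<..}"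
    by (auto simp: einterval_def zero_ereal_def)
  ultimately have "(LBINT x=0..\<infinity>. ?f x) = 0 - ?F 0"
    using der int
    by (intro interval_integral_FTC_integrable)
       (auto simp: ereal_tendsto_simps zero_ereal_def simp del: of_real_0 intro!: continuous_intros)
  then have "(LINT v|lborel. indicator {0<..} v *\<^sub>R ?f v) = - 1 / z"
    by (simp add: interval_lebesgue_integral_0_infty set_lebesgue_integral_def)
  then have b: "has_bochner_integral lborel (\<lambda>v. indicator {0<..} v *\<^sub>R ?f v) (- 1 / z)"
    using int by (simp add: has_bochner_integral_iff set_integrable_def)
  have "AE v in lborel. indicator {0<..} v *\<^sub>R ?f v = indicator {0..} v *\<^sub>R ?f v"
    by (rule eventually_mono[OF AE_lborel_singleton[of 0]]) (auto simp: indicator_def)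
  moreover have "(\<lambda>v. indicator {0<..} v *\<^sub>R ?f v) \<in> borel_measurable lborel" "(\<lambda>v. indicator {0..} v *\<^sub>R ?f v) \<in> borel_measurable lborel"
    by (intro borel_measurable_scaleR borel_measurable_indicator; auto intro!: borel_measurable_continuous_onI continuous_intros)+
  ultimately show ?thesis
    using b has_bochner_integral_cong_AE by blast
qed

section \<open>Mellin transform and completed Dirichlet series\<close>

context selfdual_coefficients
begin

lemma norm_summand_le: "norm (summand n v) \<le> bound * exp (- (c * exp v)) ^ Suc n"
proof -
  have "real (Suc n) \<le> real (Suc n) ^ 2" by (simp add: power2_eq_square)
  then have "real (Suc n) * (- (c * exp v)) \<ge> - (c * real (Suc n) ^ 2 * exp v)"
    using c_pos by (simp add: mult_ac mult_left_mono)
  then have "exp (- (c * real (Suc n) ^ 2 * exp v)) \<le> exp (real (Suc n) * (- (c * exp v)))"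
    by simp
  also have "\<dots> = exp (- (c * exp v)) ^ Suc n" by (simp only: exp_of_nat_mult)
  finally show ?thesis
    unfolding summand_def norm_mult norm_of_real abs_exp_cancel
    by (intro mult_mono norm_a_le bound_nonneg) auto
qed

text \<open>The geometric majorant of \<open>W v\<close> has denominator 1 - exp (- c * exp v),
  which for v >= 0 is smallest at v = 0.\<close>

definition K :: real where "K = bound / (1 - exp (- c))"

lemma K_nonneg: "K \<ge> 0"
  using bound_nonneg c_pos by (simp add: K_def)

lemma norm_W_le:
  assumes "v \<ge> 0"
  shows "norm (W v) \<le> K * exp (- (c * exp v))"
proof -
  define q where "q = exp (- (c * exp v))"
  have q: "0 < q" "q < 1" using c_pos by (auto simp: q_def)
  have qc: "q \<le> exp (- c)" using assms c_pos by (simp add: q_def)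
  have c1: "exp (- c) < 1" using c_pos by simp
  have "(\<lambda>n. bound * q ^ Suc n) sums (bound * (q * (1 / (1 - q))))"
    unfolding power_Suc by (intro sums_mult geometric_sums) (use q in auto)
  moreover have "norm (summand n v) \<le> bound * q ^ Suc n" for n
    unfolding q_def by (rule norm_summand_le)
  ultimately have "norm (W v) \<le> bound * (q * (1 / (1 - q)))"
    unfolding W_def by (metis norm_suminf_le sums_iff)
  also have "1 / (1 - q) \<le> 1 / (1 - exp (- c))"
    by (rule frac_le) (use qc c1 in auto)
  then have "bound * (q * (1 / (1 - q))) \<le> bound * (q * (1 / (1 - exp (- c))))"
    using q bound_nonneg by (intro mult_left_mono) auto
  finally show ?thesis by (simp add: q_def K_def)
qed

lemma W_measurable [measurable]: "W \<in> borel_measurable borel"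
  unfolding W_def summand_def by measurable

text \<open>The part v >= 0 of the Mellin integral of \<open>W\<close>. The doubly exponential decay
  of \<open>W\<close> there makes it converge for every s.\<close>

definition half :: "complex \<Rightarrow> complex" where
  "half s = (LINT v|lborel. indicator {0..} v *\<^sub>R (W v * exp (s * of_real v / 2)))"

definition decay :: "real \<Rightarrow> real \<Rightarrow> real" where
  "decay R v = indicator {0..} v * (K * exp (R * v - c * exp v))"

lemma integrable_decay: "integrable lborel (decay R)"
proof -
  \<comment> \<open>The Gamma integral asks for a positive exponent; on v >= 0 enlarging
    \<open>R\<close> only enlarges the function to be bounded.\<close>
  define R' where "R' = max R 1"
  have "has_bochner_integral lborel (\<lambda>v. exp (complex_of_real R' * of_real v - of_real (c * exp v))) (Gamma (of_real R') * exp (- of_real R' * of_real (ln c)))"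
    by (rule Gamma_integral_exp) (use c_pos in \<open>auto simp: R'_def\<close>)
  then have "integrable lborel (\<lambda>v. norm (exp (complex_of_real R' * of_real v - of_real (c * exp v))))"
    by (intro integrable_norm) (auto simp: has_bochner_integral_iff)
  then have i: "integrable lborel (\<lambda>v. K * exp (R' * v - c * exp v))"
    by (intro integrable_mult_right) (simp add: norm_exp_eq_Re)
  show ?thesis
  proof (rule Bochner_Integration.integrable_bound[OF i])
    show "decay R \<in> borel_measurable lborel" unfolding decay_def by measurable
    have "norm (decay R v) \<le> norm (K * exp (R' * v - c * exp v))" for v
    proof (cases "v \<ge> 0")
      case True
      then have "R * v \<le> R' * v" by (intro mult_right_mono) (auto simp: R'_def)
      then show ?thesis using K_nonneg True by (simp add: decay_def abs_mult mult_left_mono)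
    qed (simp add: decay_def)
    then show "AE v in lborel. norm (decay R v) \<le> norm (K * exp (R' * v - c * exp v))" by simp
  qed
qed

lemma norm_half_integrand_le:
  "norm (indicator {0..} v *\<^sub>R (W v * exp (s * of_real v / 2))) \<le> decay (Re s / 2) v"
proof (cases "v \<ge> 0")
  case True
  have "norm (W v * exp (s * of_real v / 2)) = norm (W v) * exp (Re s / 2 * v)"
    by (simp add: norm_mult norm_exp_eq_Re)
  also have "\<dots> \<le> K * exp (- (c * exp v)) * exp (Re s / 2 * v)"
    by (intro mult_right_mono norm_W_le True) auto
  also have "\<dots> = decay (Re s / 2) v"
    using True by (simp add: decay_def algebra_simps flip: exp_add)
  finally show ?thesis using True by simp
qed (simp add: decay_def)

lemma integrable_half: "integrable lborel (\<lambda>v. indicator {0..} v *\<^sub>R (W v * exp (s * of_real v / 2)))"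
proof (rule Bochner_Integration.integrable_bound[OF integrable_decay[of "Re s / 2"]])
  show "AE v in lborel. norm (indicator {0..} v *\<^sub>R (W v * exp (s * of_real v / 2))) \<le> norm (decay (Re s / 2) v)"
    unfolding real_norm_def
    by (intro always_eventually allI order_trans[OF norm_half_integrand_le abs_ge_self])
qed measurable

text \<open>Expanding the exponential in powers of s and integrating term by term gives a power
  series for \<open>half\<close> on every disc about 0; \<open>decay (norm s / 2)\<close> dominates
  all partial sums at once.\<close>

lemma half_entire: "half holomorphic_on UNIV"
proof -
  have "half holomorphic_on ball 0 R" for R :: real
  proof (rule power_series_holomorphic)
    fix s :: complex assume "s \<in> ball 0 R"
    define g where "g = (\<lambda>k v. indicator {0..} v *\<^sub>R (W v * ((s * of_real v / 2) ^ k /\<^sub>R fact k)))"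
    have g_bound: "(\<Sum>k<n. norm (g k v)) \<le> decay (norm s / 2) v" for n v
    proof (cases "v \<ge> 0")
      case True
      have sm: "(\<lambda>k. (norm s / 2 * v) ^ k /\<^sub>R fact k) sums exp (norm s / 2 * v)"
        by (rule exp_converges)
      have "norm ((s * of_real v / 2) ^ k /\<^sub>R fact k) = (norm s / 2 * v) ^ k /\<^sub>R fact k" for k
        using True by (simp add: norm_mult norm_divide norm_power)
      then have "norm (g k v) = norm (W v) * ((norm s / 2 * v) ^ k /\<^sub>R fact k)" for k
        using True unfolding g_def by (simp only: indicator_simps(1) atLeast_iff scaleR_one norm_mult)
      then have "(\<Sum>k<n. norm (g k v)) = norm (W v) * (\<Sum>k<n. (norm s / 2 * v) ^ k /\<^sub>R fact k)"
        by (simp add: sum_distrib_left)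
      also have "\<dots> \<le> norm (W v) * exp (norm s / 2 * v)"
      proof (rule mult_left_mono)
        have "(\<Sum>k<n. (norm s / 2 * v) ^ k /\<^sub>R fact k) \<le> (\<Sum>k. (norm s / 2 * v) ^ k /\<^sub>R fact k)"
          by (rule sum_le_suminf[OF sums_summable[OF sm]]) (use True in auto)
        then show "(\<Sum>k<n. (norm s / 2 * v) ^ k /\<^sub>R fact k) \<le> exp (norm s / 2 * v)"
          unfolding sums_unique[OF sm, symmetric] .
      qed simp
      also have "\<dots> \<le> K * exp (- (c * exp v)) * exp (norm s / 2 * v)"
        by (intro mult_right_mono norm_W_le True) auto
      also have "\<dots> = decay (norm s / 2) v"
        using True by (simp add: decay_def algebra_simps flip: exp_add)
      finally show ?thesis .
    qed (simp add: g_def decay_def)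
    have g_int: "integrable lborel (g k)" for k
    proof (rule Bochner_Integration.integrable_bound[OF integrable_decay[of "norm s / 2"]])
      show "g k \<in> borel_measurable lborel" unfolding g_def by measurable
      have "norm (g k v) \<le> (\<Sum>k<Suc k. norm (g k v))" for v by (simp add: sum_nonneg)
      then show "AE v in lborel. norm (g k v) \<le> norm (decay (norm s / 2) v)"
        unfolding real_norm_def
        by (intro always_eventually allI order_trans[OF _ order_trans[OF g_bound[where n = "Suc k"] abs_ge_self]])
    qed
    have g_sums: "(\<lambda>k. g k v) sums (indicator {0..} v *\<^sub>R (W v * exp (s * of_real v / 2)))" for v
      unfolding g_def by (intro sums_scaleR_right sums_mult exp_converges)
    have "(\<lambda>n. LINT v|lborel. (\<Sum>k<n. g k v)) \<longlonglongrightarrow> half s"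
      unfolding half_def
    proof (rule integral_dominated_convergence[where w = "decay (norm s / 2)"])
      show "AE v in lborel. (\<lambda>n. \<Sum>k<n. g k v) \<longlonglongrightarrow> indicator {0..} v *\<^sub>R (W v * exp (s * of_real v / 2))"
        using g_sums by (simp add: sums_def)
      show "AE v in lborel. norm (\<Sum>k<n. g k v) \<le> decay (norm s / 2) v" for n
        by (intro always_eventually allI order_trans[OF norm_sum g_bound])
      show "(\<lambda>v. \<Sum>k<n. g k v) \<in> borel_measurable lborel" for n unfolding g_def by measurable
      show "(\<lambda>v. indicator {0..} v *\<^sub>R (W v * exp (s * of_real v / 2))) \<in> borel_measurable lborel" by measurable
    qed (rule integrable_decay)
    then have "(\<lambda>k. integral\<^sup>L lborel (g k)) sums half s"
      unfolding sums_def by (subst (asm) Bochner_Integration.integral_sum) (auto intro: g_int)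
    moreover have "integral\<^sup>L lborel (g k) = (LINT v|lborel. indicator {0..} v *\<^sub>R (W v * ((of_real v / 2) ^ k /\<^sub>R fact k))) * (s - 0) ^ k" for k
      unfolding g_def
      by (subst integral_mult_left_zero[symmetric]) (rule Bochner_Integration.integral_cong, auto simp: power_mult_distrib power_divide)
    ultimately show "(\<lambda>k. (LINT v|lborel. indicator {0..} v *\<^sub>R (W v * ((of_real v / 2) ^ k /\<^sub>R fact k))) * (s - 0) ^ k) sums half s"
      by simp
  qed
  then have "half analytic_on {z}" for z
    unfolding analytic_at by (intro exI[of _ "ball 0 (norm z + 1)"]) auto
  then show ?thesis
    using analytic_on_analytic_at analytic_imp_holomorphic by blast
qed

lemma cnj_half: "cnj (half s) = half (cnj s)"
  unfolding half_def using integral_bounded_linear[OF bounded_linear_cnj integrable_half[of s]]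
  by (simp add: cnj_W exp_cnj)

text \<open>For Re s > 1 this is c^(-s/2) Gamma(s/2) times the Dirichlet series, in the shape given
  by Riemann's splitting of the Mellin integral: the symmetry under s -> 1-s is visible and all
  poles sit in the last term. With 1 / 0 = 0 the symmetry holds at 0 and 1 too.\<close>

definition Lam :: "complex \<Rightarrow> complex" where
  "Lam s = half s + half (1 - s) + a 0 * (1 / (s - 1) - 1 / s)"

lemma Lam_reflect: "Lam (1 - s) = Lam s"
  by (simp add: Lam_def divide_inverse minus_diff_eq[of s 1, symmetric] del: minus_diff_eq)

lemma cnj_Lam: "cnj (Lam s) = Lam (cnj s)"
  by (simp add: Lam_def cnj_half real)

lemma Lam_holomorphic: "Lam holomorphic_on - {0, 1}"
proof -
  have "half holomorphic_on A" for A using half_entire holomorphic_on_subset by blast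
  moreover have "(half \<circ> (\<lambda>s. 1 - s)) holomorphic_on A" for A
    by (rule holomorphic_on_compose_gen[OF _ half_entire]) (auto intro!: holomorphic_intros)
  then have "(\<lambda>s. half (1 - s)) holomorphic_on A" for A
    by (simp add: o_def)
  ultimately show ?thesis
    unfolding Lam_def by (intro holomorphic_intros) auto
qed

text \<open>The integral is cut at v = 0 and \<open>W_reflect\<close> folds the negative half onto
  the positive one. This yields \<open>half (1 - s)\<close> and two exponential integrals; the one
  with exponent (1 - s) / 2 converges because Re s > 1.\<close>

lemma Mellin_W:
  assumes s: "Re s > 1"
  shows "has_bochner_integral lborel (\<lambda>v. W v * exp (s * of_real v / 2)) (Lam s)"
proof -
  have pos: "has_bochner_integral lborel (\<lambda>v. indicator {0..} v *\<^sub>R (W v * exp (s * of_real v / 2))) (half s)"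
    using integrable_half by (simp add: half_def has_bochner_integral_iff)
  have h: "has_bochner_integral lborel (\<lambda>v. indicator {0..} v *\<^sub>R (W v * exp ((1 - s) * of_real v / 2))) (half (1 - s))"
    using integrable_half by (simp add: half_def has_bochner_integral_iff)
  have e1: "has_bochner_integral lborel (\<lambda>v. a 0 / 2 * (indicator {0..} v *\<^sub>R exp ((1 - s) / 2 * of_real v))) (a 0 / 2 * (- 1 / ((1 - s) / 2)))"
    by (rule has_bochner_integral_mult_right[rotated], rule integral_exp_half_line) (use s in auto)
  have e2: "has_bochner_integral lborel (\<lambda>v. a 0 / 2 * (indicator {0..} v *\<^sub>R exp (- s / 2 * of_real v))) (a 0 / 2 * (- 1 / (- s / 2)))"
    by (rule has_bochner_integral_mult_right[rotated], rule integral_exp_half_line) (use s in auto)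
  have neg: "has_bochner_integral lborel (\<lambda>v. indicator {0..} v *\<^sub>R (W v * exp ((1 - s) * of_real v / 2))
      + (a 0 / 2 * (indicator {0..} v *\<^sub>R exp ((1 - s) / 2 * of_real v)) - a 0 / 2 * (indicator {0..} v *\<^sub>R exp (- s / 2 * of_real v))))
      (half (1 - s) + (a 0 / 2 * (- 1 / ((1 - s) / 2)) - a 0 / 2 * (- 1 / (- s / 2))))"
    by (intro has_bochner_integral_add has_bochner_integral_diff h e1 e2)
  have eq: "indicator {0..} v *\<^sub>R (W v * exp ((1 - s) * of_real v / 2))
      + (a 0 / 2 * (indicator {0..} v *\<^sub>R exp ((1 - s) / 2 * of_real v)) - a 0 / 2 * (indicator {0..} v *\<^sub>R exp (- s / 2 * of_real v)))
      = indicator {0..} v *\<^sub>R (W (- v) * exp (s * of_real (- v) / 2))" for v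
  proof -
    have "exp ((1 - s) * complex_of_real v / 2) = of_real (exp (v / 2)) * exp (s * of_real (- v) / 2)"
      by (simp add: algebra_simps diff_divide_distrib flip: exp_of_real exp_add)
    moreover have "(1 - s) / 2 * complex_of_real v = (1 - s) * complex_of_real v / 2" "- s / 2 * complex_of_real v = s * of_real (- v) / 2" by simp_all
    ultimately show ?thesis unfolding W_reflect by (simp add: algebra_simps)
  qed
  have "has_bochner_integral lborel (\<lambda>v. indicator {0..} v *\<^sub>R (W (- v) * exp (s * of_real (- v) / 2)))
      (half (1 - s) + (a 0 / 2 * (- 1 / ((1 - s) / 2)) - a 0 / 2 * (- 1 / (- s / 2))))"
    using neg unfolding eq .
  then have "has_bochner_integral lborel (\<lambda>v. indicator {0..} (0 + (-1) * v) *\<^sub>R (W (- (0 + (-1) * v)) * exp (s * of_real (- (0 + (-1) * v)) / 2)))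
      ((half (1 - s) + (a 0 / 2 * (- 1 / ((1 - s) / 2)) - a 0 / 2 * (- 1 / (- s / 2)))) /\<^sub>R \<bar>- 1\<bar>)"
    by (rule lborel_has_bochner_integral_real_affine_iff[THEN iffD1, rotated]) simp
  then have neg': "has_bochner_integral lborel (\<lambda>v. indicator {..0} v *\<^sub>R (W v * exp (s * of_real v / 2)))
      (half (1 - s) + (a 0 / 2 * (- 1 / ((1 - s) / 2)) - a 0 / 2 * (- 1 / (- s / 2))))"
    by (simp add: indicator_def)
  have "has_bochner_integral lborel (\<lambda>v. indicator {0..} v *\<^sub>R (W v * exp (s * of_real v / 2)) + indicator {..0} v *\<^sub>R (W v * exp (s * of_real v / 2)))
     (half s + (half (1 - s) + (a 0 / 2 * (- 1 / ((1 - s) / 2)) - a 0 / 2 * (- 1 / (- s / 2)))))"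
    by (intro has_bochner_integral_add pos neg')
  moreover have "half s + (half (1 - s) + (a 0 / 2 * (- 1 / ((1 - s) / 2)) - a 0 / 2 * (- 1 / (- s / 2)))) = Lam s"
  proof -
    have "s \<noteq> 0" "s - 1 \<noteq> 0" "1 - s \<noteq> 0" using s by auto
    then have "- 1 / ((1 - s) / 2) = 2 * (1 / (s - 1))" "- 1 / (- s / 2) = 2 * (1 / s)"
      by (simp_all add: divide_simps)
    then show ?thesis by (simp only: Lam_def) (simp add: algebra_simps)
  qed
  \<comment> \<open>Both halves contain the point v = 0, which is a null set.\<close>
  moreover have "AE v in lborel. indicator {0..} v *\<^sub>R (W v * exp (s * of_real v / 2)) + indicator {..0} v *\<^sub>R (W v * exp (s * of_real v / 2))
      = W v * exp (s * of_real v / 2)"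
  proof (rule eventually_mono[OF AE_lborel_singleton[of 0]])
    fix v :: real assume "v \<noteq> 0"
    then show "indicator {0..} v *\<^sub>R (W v * exp (s * of_real v / 2)) + indicator {..0} v *\<^sub>R (W v * exp (s * of_real v / 2))
      = W v * exp (s * of_real v / 2)" by (cases "v > 0") (auto simp: indicator_def)
  qed
  ultimately show ?thesis
    by (subst (asm) has_bochner_integral_cong_AE) (auto intro!: borel_measurable_has_bochner_integral)
qed

text \<open>Each term of \<open>W\<close> has a Gamma integral as its Mellin transform.
  Interchanging sum and integral expresses \<open>Lam s\<close> through the Dirichlet series, and
  \<open>rGamma\<close> divides the Gamma factor out without introducing poles.\<close>

theorem dirichlet_series_continuation:
  assumes s: "Re s > 1"
  shows "(\<lambda>n. a (Suc n) / of_nat (Suc n) powr s) sums (Lam s * exp (s / 2 * of_real (ln c)) * rGamma (s / 2))"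
proof -
  define g where "g = (\<lambda>n v. summand n v * exp (s * of_real v / 2))"
  define b where "b = (\<lambda>n. c * real (Suc n) ^ 2)"
  have b: "b n > 0" for n using c_pos by (simp add: b_def)
  have eb: "exp (- (z / 2) * of_real (ln (b n))) = exp (- (z / 2) * of_real (ln c)) * (1 / of_nat (Suc n) powr z)" for n and z :: complex
  proof -
    have "ln (b n) = ln c + 2 * ln (real (Suc n))" using c_pos by (simp add: b_def ln_mult ln_realpow)
    then have "- (z / 2) * of_real (ln (b n)) = - (z / 2) * of_real (ln c) + - (z * of_real (ln (real (Suc n))))"
      by (simp add: algebra_simps)
    moreover have "of_nat (Suc n) powr z = exp (z * of_real (ln (real (Suc n))))"
      by (simp add: powr_def Ln_of_nat del: of_nat_Suc)
    ultimately show ?thesis by (simp only: exp_add exp_minus inverse_eq_divide)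
  qed
  have core: "has_bochner_integral lborel (\<lambda>v. exp (z / 2 * of_real v - of_real (b n * exp v))) (Gamma (z / 2) * exp (- (z / 2) * of_real (ln (b n))))"
    if "Re z > 1" for n z
    by (rule Gamma_integral_exp[OF _ b]) (use that in simp)
  have g_eq: "g n v = a (Suc n) * exp (s / 2 * of_real v - of_real (b n * exp v))" for n v
  proof -
    have "s / 2 * of_real v - of_real (b n * exp v) = s * of_real v / 2 + of_real (- (b n * exp v))"
      by simp
    then have e: "exp (s / 2 * of_real v - of_real (b n * exp v)) = exp (s * of_real v / 2) * of_real (exp (- (b n * exp v)))"
      by (simp only: exp_add exp_of_real)
    show ?thesis
      unfolding g_def summand_def e unfolding b_def by (simp only: mult_ac)
  qed
  have g_int: "has_bochner_integral lborel (g n) (a (Suc n) * (Gamma (s / 2) * exp (- (s / 2) * of_real (ln (b n)))))" for n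
    unfolding g_eq by (rule has_bochner_integral_mult_right[rotated, OF core[OF s]]) 
  define \<sigma> where "\<sigma> = Re s"
  \<comment> \<open>The norm of the n-th integrand belongs to the same Gamma integral at the real
    point \<open>\<sigma>\<close>. Its value is C (n+1)^(-\<sigma>) times the norm of the
    coefficient, summable since \<sigma> > 1.\<close>
  define C where "C = norm (Gamma (complex_of_real \<sigma> / 2) * exp (- (complex_of_real \<sigma> / 2) * of_real (ln c)))"
  have ng_int: "(LINT v|lborel. norm (g n v)) = norm (a (Suc n)) * (C * real (Suc n) powr (- \<sigma>))" for n
  proof -
    have "(LINT v|lborel. exp (complex_of_real \<sigma> / 2 * of_real v - of_real (b n * exp v)))
        = Gamma (complex_of_real \<sigma> / 2) * exp (- (complex_of_real \<sigma> / 2) * of_real (ln (b n)))"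
      using core[of "of_real \<sigma>" n] s by (simp add: has_bochner_integral_iff \<sigma>_def)
    moreover have "exp (complex_of_real \<sigma> / 2 * of_real v - of_real (b n * exp v)) = of_real (exp (\<sigma> / 2 * v - b n * exp v))" for v
      by (simp flip: exp_of_real)
    ultimately have "complex_of_real (LINT v|lborel. exp (\<sigma> / 2 * v - b n * exp v))
        = Gamma (complex_of_real \<sigma> / 2) * exp (- (complex_of_real \<sigma> / 2) * of_real (ln (b n)))"
      by (simp only: integral_complex_of_real)
    then have "norm (complex_of_real (LINT v|lborel. exp (\<sigma> / 2 * v - b n * exp v)))
        = norm (Gamma (complex_of_real \<sigma> / 2) * exp (- (complex_of_real \<sigma> / 2) * of_real (ln c))) * norm (1 / of_nat (Suc n) powr complex_of_real \<sigma>)"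
      unfolding eb by (simp only: norm_mult mult.assoc)
    moreover have "(LINT v|lborel. exp (\<sigma> / 2 * v - b n * exp v)) \<ge> 0" by simp
    moreover have "norm (of_nat (Suc n) powr complex_of_real \<sigma>) = real (Suc n) powr \<sigma>"
      using norm_powr_real_powr[of "of_nat (Suc n)" "complex_of_real \<sigma>"] by simp
    ultimately have "(LINT v|lborel. exp (\<sigma> / 2 * v - b n * exp v)) = C * real (Suc n) powr (- \<sigma>)"
      by (simp only: C_def norm_divide norm_one norm_of_real abs_of_nonneg powr_minus_divide)
    moreover have "norm (g n v) = norm (a (Suc n)) * exp (\<sigma> / 2 * v - b n * exp v)" for v
      unfolding g_eq by (simp add: norm_mult norm_exp_eq_Re \<sigma>_def)
    ultimately show ?thesis by simp
  qed
  have sm: "summable (\<lambda>n. LINT v|lborel. norm (g n v))"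
  proof (rule summable_comparison_test')
    have "summable (\<lambda>n. real n powr (- \<sigma>))" using s by (simp add: summable_real_powr_iff \<sigma>_def)
    then have "summable (\<lambda>n. real (Suc n) powr (- \<sigma>))" by (subst summable_Suc_iff)
    then show "summable (\<lambda>n. bound * (C * real (Suc n) powr (- \<sigma>)))" by (intro summable_mult)
    show "norm (LINT v|lborel. norm (g n v)) \<le> bound * (C * real (Suc n) powr (- \<sigma>))" if "n \<ge> 0" for n
    proof -
      have "C \<ge> 0" by (simp add: C_def)
      then show ?thesis unfolding ng_int
        by (subst real_norm_def, subst abs_of_nonneg) (auto intro!: mult_right_mono norm_a_le)
    qed
  qed
  have AE: "summable (\<lambda>n. norm (g n v))" for v
  proof (rule summable_comparison_test')
    have "exp (- (c * exp v)) < 1" using c_pos by simp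
    then have "summable (\<lambda>n. exp (- (c * exp v)) ^ n)" by (intro summable_geometric) auto
    then show "summable (\<lambda>n. bound * exp (- (c * exp v)) ^ Suc n * norm (exp (s * of_real v / 2)))"
      by (intro summable_mult summable_mult2) (subst summable_Suc_iff)
    show "norm (norm (g n v)) \<le> bound * exp (- (c * exp v)) ^ Suc n * norm (exp (s * of_real v / 2))" if "n \<ge> 0" for n
    proof -
      have "norm (norm (g n v)) = norm (summand n v) * norm (exp (s * of_real v / 2))"
        by (simp add: g_def norm_mult)
      also have "\<dots> \<le> bound * exp (- (c * exp v)) ^ Suc n * norm (exp (s * of_real v / 2))"
        by (intro mult_right_mono norm_summand_le) auto
      finally show ?thesis .
    qed
  qed
  have sums_int: "(\<lambda>n. integral\<^sup>L lborel (g n)) sums (LINT v|lborel. (\<Sum>n. g n v))"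
    by (rule sums_integral) (use g_int sm AE in \<open>auto simp: has_bochner_integral_iff\<close>)
  have "(\<Sum>n. g n v) = W v * exp (s * of_real v / 2)" for v
    unfolding g_def W_def using summand_sums[of v] by (intro suminf_mult2[symmetric]) (simp add: sums_iff)
  then have "(LINT v|lborel. (\<Sum>n. g n v)) = Lam s"
    using Mellin_W[OF s] by (simp add: has_bochner_integral_iff)
  moreover have "integral\<^sup>L lborel (g n) = a (Suc n) / of_nat (Suc n) powr s * (Gamma (s / 2) * exp (- (s / 2) * of_real (ln c)))" for n
    using g_int[of n] unfolding eb by (simp add: has_bochner_integral_iff)
  ultimately have "(\<lambda>n. a (Suc n) / of_nat (Suc n) powr s * (Gamma (s / 2) * exp (- (s / 2) * of_real (ln c)))) sums Lam s"
    using sums_int by simp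
  then have "(\<lambda>n. a (Suc n) / of_nat (Suc n) powr s * (Gamma (s / 2) * exp (- (s / 2) * of_real (ln c))) * (exp (s / 2 * of_real (ln c)) * rGamma (s / 2)))
      sums (Lam s * (exp (s / 2 * of_real (ln c)) * rGamma (s / 2)))"
    by (rule sums_mult2)
  moreover have "Gamma (s / 2) * exp (- (s / 2) * of_real (ln c)) * (exp (s / 2 * of_real (ln c)) * rGamma (s / 2)) = 1"
  proof -
    have "s / 2 \<notin> \<int>\<^sub>\<le>\<^sub>0" using s by (auto elim!: nonpos_Ints_cases simp: complex_eq_iff)
    then have "Gamma (s / 2) * rGamma (s / 2) = 1"
      by (simp add: rGamma_inverse_Gamma Gamma_eq_zero_iff)
    moreover have "exp (- (s / 2) * complex_of_real (ln c)) * exp (s / 2 * of_real (ln c)) = 1"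
      by (simp flip: exp_add)
    ultimately show ?thesis by (metis (no_types, opaque_lifting) mult.assoc mult.commute mult_1_right)
  qed
  ultimately show ?thesis by (simp only: mult.assoc mult_1_right)
qed

end

section \<open>Zeros near a double zero on the critical line\<close>

text \<open>Besides the inverse \<open>g\<close>, injectivity of \<open>p\<close> on the ball is
  recorded: it forces every solution of \<open>p s = w\<close> in the ball to be \<open>g w\<close>,
  which is how an arbitrary trajectory is recognised.\<close>

lemma local_holomorphic_inverse:
  fixes p :: "complex \<Rightarrow> complex"
  assumes "p holomorphic_on ball z r" "0 < r" "deriv p z \<noteq> 0"
  obtains r' \<epsilon> g where "0 < r'" "ball z r' \<subseteq> ball z r" "0 < \<epsilon>" "inj_on p (ball z r')"
    "continuous_on (ball (p z) \<epsilon>) g"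
    "\<And>w. w \<in> ball (p z) \<epsilon> \<Longrightarrow> g w \<in> ball z r' \<and> p (g w) = w" "g (p z) = z"
    "(g has_field_derivative inverse (deriv p z)) (at (p z))"
proof -
  have zr: "z \<in> ball z r" using assms(2) by simp
  obtain r' where r': "0 < r'" "ball z r' \<subseteq> ball z r" "open (p ` ball z r')" "inj_on p (ball z r')"
    using has_complex_derivative_locally_invertible[OF assms(1) zr open_ball assms(3)] by metis
  have hol: "p holomorphic_on ball z r'"
    using assms(1) r'(2) holomorphic_on_subset by blast
  obtain g where g: "g holomorphic_on (p ` ball z r')"
      "\<And>w. w \<in> ball z r' \<Longrightarrow> deriv p w * deriv g (p w) = 1"
      "\<And>w. w \<in> ball z r' \<Longrightarrow> g (p w) = w"
    using holomorphic_has_inverse[OF hol open_ball r'(4)] by metis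
  have zr': "z \<in> ball z r'" using r' by simp
  then obtain \<epsilon> where \<epsilon>: "0 < \<epsilon>" "ball (p z) \<epsilon> \<subseteq> p ` ball z r'"
    using r'(3) unfolding open_contains_ball by blast
  have cont: "continuous_on (ball (p z) \<epsilon>) g"
    using g(1) \<epsilon>(2) holomorphic_on_imp_continuous_on continuous_on_subset by blast
  have "(g has_field_derivative deriv g (p z)) (at (p z))"
    using g(1) r'(3) zr' holomorphic_derivI by blast
  moreover have "deriv g (p z) = inverse (deriv p z)"
    using g(2)[OF zr'] assms(3) by (simp add: field_simps)
  ultimately have der: "(g has_field_derivative inverse (deriv p z)) (at (p z))" by simp
  show ?thesis
  proof (rule that[OF r'(1,2) \<epsilon>(1) r'(4) cont _ _ der])
    show "g w \<in> ball z r' \<and> p (g w) = w" if "w \<in> ball (p z) \<epsilon>" for w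
      using that \<epsilon>(2) g(3) by force
    show "g (p z) = z" by (rule g(3)[OF zr'])
  qed
qed

lemma Re_sign_near_derivative:
  fixes g :: "complex \<Rightarrow> complex"
  assumes "(g has_field_derivative c) (at 0)" "Re c > 0"
  obtains \<delta> where "\<delta> > 0"
    "\<And>x. 0 < x \<Longrightarrow> x < \<delta> \<Longrightarrow> Re (g (of_real x)) > Re (g 0)"
    "\<And>x. 0 < x \<Longrightarrow> x < \<delta> \<Longrightarrow> Re (g (- of_real x)) < Re (g 0)"
proof -
  have "((\<lambda>x. g (of_real x)) has_vector_derivative c) (at 0)"
    by (rule has_vector_derivative_real_field) (use assms in simp)
  then have d: "((\<lambda>x. Re (g (of_real x))) has_real_derivative Re c) (at 0)"
    unfolding has_real_derivative_iff_has_vector_derivative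
    by (rule bounded_linear.has_vector_derivative[OF bounded_linear_Re])
  obtain d1 where d1: "d1 > 0" "\<And>h. h > 0 \<Longrightarrow> h < d1 \<Longrightarrow> Re (g (of_real 0)) < Re (g (of_real (0 + h)))"
    using DERIV_pos_inc_right[OF d assms(2)] by blast
  obtain d2 where d2: "d2 > 0" "\<And>h. h > 0 \<Longrightarrow> h < d2 \<Longrightarrow> Re (g (of_real 0)) > Re (g (of_real (0 - h)))"
    using DERIV_pos_inc_left[OF d assms(2)] by blast
  show ?thesis
    using that[of "min d1 d2"] d1 d2 by auto
qed

lemma DERIV_linear_factor:
  fixes P :: "complex \<Rightarrow> complex"
  assumes "P holomorphic_on ball z r" "0 < r"
  shows "((\<lambda>s. (s - z) * P s) has_field_derivative P z) (at z)"
proof -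
  have P: "(P has_field_derivative deriv P z) (at z)"
    using assms by (intro holomorphic_derivI[OF _ open_ball]) auto
  show ?thesis
    by (rule derivative_eq_intros P HOL.refl | simp)+
qed

lemma dist_reflect_line:
  assumes "Re \<rho> = 1/2" shows "dist \<rho> (1 - cnj s) = dist \<rho> s"
proof -
  have "\<rho> - (1 - cnj s) = - cnj (\<rho> - s)"
    using assms by (simp add: complex_eq_iff)
  then have "norm (\<rho> - (1 - cnj s)) = norm (\<rho> - s)"
    by (metis complex_mod_cnj norm_minus_cancel)
  then show ?thesis
    by (simp add: dist_norm)
qed

text \<open>The map s -> 1 - cnj s reverses the real direction, so differentiation flips the sign of
  the symmetry. The parameter \<open>\<epsilon>\<close> covers the symmetric \<open>D\<close> and
  the antisymmetric \<open>H\<close> together.\<close>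

lemma deriv_reflect:
  fixes G :: "complex \<Rightarrow> complex" and \<epsilon> :: real
  assumes hol: "G holomorphic_on ball \<rho> r" and line: "Re \<rho> = 1/2"
    and refl: "\<And>s. s \<in> ball \<rho> r \<Longrightarrow> G (1 - cnj s) = of_real \<epsilon> * cnj (G s)"
    and s: "s \<in> ball \<rho> r"
  shows "deriv G (1 - cnj s) = - of_real \<epsilon> * cnj (deriv G s)"
proof -
  have s': "1 - cnj s \<in> ball \<rho> r"
    using s dist_reflect_line[OF line] by simp
  have "(G has_field_derivative deriv G s) (at s)"
    using hol holomorphic_derivI open_ball s by blast
  then have "((\<lambda>w. G (1 - w)) has_field_derivative - deriv G s) (at (cnj (cnj (1 - s))))"
    using DERIV_chain2[of G "deriv G s" "\<lambda>w. 1 - w" "1 - s" "-1" UNIV]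
      DERIV_diff[OF DERIV_const DERIV_ident, of 1 "1 - s" UNIV] by simp
  then have "((\<lambda>z. cnj (G (1 - cnj z))) has_field_derivative cnj (- deriv G s)) (at (cnj (1 - s)))"
    using has_field_derivative_cnj_cnj[of "\<lambda>w. G (1 - w)" "- deriv G s" "cnj (1 - s)"]
    by (simp add: o_def)
  then have "((\<lambda>z. of_real \<epsilon> * cnj (G (1 - cnj z))) has_field_derivative of_real \<epsilon> * cnj (- deriv G s)) (at (1 - cnj s))"
    using DERIV_cmult by fastforce
  moreover have "of_real \<epsilon> * cnj (G (1 - cnj z)) = G z" if "z \<in> ball \<rho> r" for z
  proof -
    have "1 - cnj z \<in> ball \<rho> r"
      using that dist_reflect_line[OF line] by simp
    from refl[OF this] show ?thesis by simp
  qed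
  ultimately have "(G has_field_derivative of_real \<epsilon> * cnj (- deriv G s)) (at (1 - cnj s))"
    using has_field_derivative_transform_within_open[OF _ open_ball s'] by blast
  then show ?thesis
    using DERIV_imp_deriv by fastforce
qed

lemma zero_trajectory_near:
  assumes "zero_trajectory g \<tau>\<^sub>0 \<theta> \<rho>" "\<theta> > 0" "r > 0"
  obtains \<delta> where "0 < \<delta>" "\<delta> \<le> \<theta>" "\<And>\<tau>. \<bar>\<tau> - \<tau>\<^sub>0\<bar> < \<delta> \<Longrightarrow> \<rho> \<tau> \<in> ball (\<rho> \<tau>\<^sub>0) r \<and> g (\<rho> \<tau>) \<tau> = 0"
proof -
  have c: "continuous_on {\<tau>\<^sub>0 - \<theta><..<\<tau>\<^sub>0 + \<theta>} \<rho>"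
    and z: "\<And>\<tau>. \<tau> \<in> {\<tau>\<^sub>0 - \<theta><..<\<tau>\<^sub>0 + \<theta>} \<Longrightarrow> g (\<rho> \<tau>) \<tau> = 0"
    using assms(1) unfolding zero_trajectory_def by auto
  obtain d where d: "d > 0" "\<And>x. x \<in> {\<tau>\<^sub>0 - \<theta><..<\<tau>\<^sub>0 + \<theta>} \<Longrightarrow> dist x \<tau>\<^sub>0 < d \<Longrightarrow> dist (\<rho> x) (\<rho> \<tau>\<^sub>0) < r"
    using c[unfolded continuous_on_iff, rule_format, of \<tau>\<^sub>0 r] assms(2,3) by auto
  show ?thesis
    by (rule that[of "min d \<theta>"]) (use d z assms(2) in \<open>auto simp: dist_real_def dist_commute abs_less_iff\<close>)
qed

section \<open>Local model of a double zero on the critical line\<close>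

text \<open>\<open>a\<close> is the cofactor of the double zero at time
  \<open>\<tau>\<^sub>0\<close>, and \<open>D\<close> is the \<tau>-derivative of the family divided
  by \<open>\<kappa>\<close>. The family is affine in \<tau>, so \<open>f_eq\<close> has no higher
  terms. The reflection laws and the sign in \<open>\<kappa>_log_deriv\<close> carry all the
  arithmetic that the local argument needs.\<close>

locale reflected_double_zero =
  fixes a D \<kappa> :: "complex \<Rightarrow> complex" and \<rho>\<^sub>0 :: complex and R :: real
    and f :: "complex \<Rightarrow> real \<Rightarrow> complex" and \<tau>\<^sub>0 :: real
  assumes R: "0 < R" and line: "Re \<rho>\<^sub>0 = 1/2"
    and a_holo: "a holomorphic_on ball \<rho>\<^sub>0 R"
    and D_holo: "D holomorphic_on ball \<rho>\<^sub>0 R"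
    and \<kappa>_holo: "\<kappa> holomorphic_on ball \<rho>\<^sub>0 R"
    and a_reflect: "\<And>s. s \<in> ball \<rho>\<^sub>0 R \<Longrightarrow> a (1 - cnj s) = cnj (a s)"
    and D_reflect: "\<And>s. s \<in> ball \<rho>\<^sub>0 R \<Longrightarrow> D (1 - cnj s) = cnj (D s)"
    and a_nz: "a \<rho>\<^sub>0 \<noteq> 0"
    and \<kappa>_nz: "\<And>s. s \<in> ball \<rho>\<^sub>0 R \<Longrightarrow> \<kappa> s \<noteq> 0"
    and \<kappa>_log_deriv: "Re (deriv \<kappa> \<rho>\<^sub>0 / \<kappa> \<rho>\<^sub>0) < 0"
    and f_eq: "\<And>s \<tau>. s \<in> ball \<rho>\<^sub>0 R \<Longrightarrow> f s \<tau> = \<kappa> s * ((s - \<rho>\<^sub>0)^2 * a s + of_real (\<tau> - \<tau>\<^sub>0) * D s)"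
begin

abbreviation f' :: "complex \<Rightarrow> real \<Rightarrow> complex" where
  "f' \<equiv> \<lambda>s \<tau>. deriv (\<lambda>z. f z \<tau>) s"

lemma centre: "\<rho>\<^sub>0 \<in> ball \<rho>\<^sub>0 R" using R by simp

lemma reflect_centre: "1 - cnj \<rho>\<^sub>0 = \<rho>\<^sub>0"
  using line by (simp add: complex_eq_iff)

lemma reflect_in_ball: "1 - cnj s \<in> ball \<rho>\<^sub>0 r \<longleftrightarrow> s \<in> ball \<rho>\<^sub>0 r"
  using dist_reflect_line[OF line] by simp

lemma reflect_diff: "(1 - cnj s) - \<rho>\<^sub>0 = - cnj (s - \<rho>\<^sub>0)"
  using line by (simp add: complex_eq_iff)

lemma a_centre_real: "Im (a \<rho>\<^sub>0) = 0" and D_centre_real: "Im (D \<rho>\<^sub>0) = 0"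
  using a_reflect[OF centre] D_reflect[OF centre] reflect_centre by (auto simp: complex_eq_iff)

text \<open>On the critical line \<open>D\<close> is real, hence so is its derivative in the
  vertical direction, which is \<i> times \<open>deriv D\<close>.\<close>

lemma D_deriv_imaginary: "Re (deriv D \<rho>\<^sub>0) = 0"
  using deriv_reflect[OF D_holo line, of 1 \<rho>\<^sub>0] D_reflect centre reflect_centre
  by (auto simp: complex_eq_iff)

text \<open>\<open>\<kappa>\<close> stays inside the derivatives, since dropping it would move the
  zeros of \<open>f'\<close>. At \<open>\<tau>\<^sub>0\<close> the zero is simple with leading
  coefficient \<open>2 * (\<kappa> \<rho>\<^sub>0 * a \<rho>\<^sub>0)\<close>, and \<tau> still
  enters linearly.\<close>

lemma f'_eq:
  assumes "s \<in> ball \<rho>\<^sub>0 R"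
  shows "f' s \<tau> = (s - \<rho>\<^sub>0) * (2 * (\<kappa> s * a s) + (s - \<rho>\<^sub>0) * deriv (\<lambda>z. \<kappa> z * a z) s)
     + of_real (\<tau> - \<tau>\<^sub>0) * deriv (\<lambda>z. \<kappa> z * D z) s"
proof -
  have b: "((\<lambda>z. \<kappa> z * a z) has_field_derivative deriv (\<lambda>z. \<kappa> z * a z) s) (at s)"
    by (rule holomorphic_derivI[OF _ open_ball assms]) (intro holomorphic_intros \<kappa>_holo a_holo)
  have d: "((\<lambda>z. \<kappa> z * D z) has_field_derivative deriv (\<lambda>z. \<kappa> z * D z) s) (at s)"
    by (rule holomorphic_derivI[OF _ open_ball assms]) (intro holomorphic_intros \<kappa>_holo D_holo)
  have "((\<lambda>z. (z - \<rho>\<^sub>0)^2 * (\<kappa> z * a z) + of_real (\<tau> - \<tau>\<^sub>0) * (\<kappa> z * D z)) has_field_derivative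
     (s - \<rho>\<^sub>0) * (2 * (\<kappa> s * a s) + (s - \<rho>\<^sub>0) * deriv (\<lambda>z. \<kappa> z * a z) s)
     + of_real (\<tau> - \<tau>\<^sub>0) * deriv (\<lambda>z. \<kappa> z * D z) s) (at s)"
    by (rule derivative_eq_intros b d refl | simp)+ (simp add: algebra_simps power2_eq_square)
  then have "((\<lambda>z. f z \<tau>) has_field_derivative
     (s - \<rho>\<^sub>0) * (2 * (\<kappa> s * a s) + (s - \<rho>\<^sub>0) * deriv (\<lambda>z. \<kappa> z * a z) s)
     + of_real (\<tau> - \<tau>\<^sub>0) * deriv (\<lambda>z. \<kappa> z * D z) s) (at s)"
    by (rule has_field_derivative_transform_within_open[OF _ open_ball assms])
       (simp add: f_eq algebra_simps)
  then show ?thesis by (rule DERIV_imp_deriv)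
qed

lemma deriv_\<kappa>D: "s \<in> ball \<rho>\<^sub>0 R \<Longrightarrow> deriv (\<lambda>z. \<kappa> z * D z) s = deriv \<kappa> s * D s + \<kappa> s * deriv D s"
proof -
  assume s: "s \<in> ball \<rho>\<^sub>0 R"
  have "\<kappa> field_differentiable at s" "D field_differentiable at s"
    using s \<kappa>_holo D_holo holomorphic_on_imp_differentiable_at open_ball by blast+
  then show ?thesis by (simp add: deriv_mult algebra_simps)
qed

definition leaves_line :: bool where "leaves_line \<longleftrightarrow>
  (\<exists>\<theta>>0. \<exists>\<rho>. zero_trajectory f \<tau>\<^sub>0 \<theta> \<rho> \<and> \<rho> \<tau>\<^sub>0 = \<rho>\<^sub>0 \<and>
        (\<forall>\<tau>\<in>{\<tau>\<^sub>0 - \<theta><..<\<tau>\<^sub>0}. Re (\<rho> \<tau>) = 1/2) \<and>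
        (\<forall>\<tau>\<in>{\<tau>\<^sub>0<..<\<tau>\<^sub>0 + \<theta>}. Re (\<rho> \<tau>) < 1/2))"

definition deriv_crosses_line :: bool where "deriv_crosses_line \<longleftrightarrow>
  (\<exists>\<eta>>0. \<exists>\<rho>'. zero_trajectory f' \<tau>\<^sub>0 \<eta> \<rho>' \<and> \<rho>' \<tau>\<^sub>0 = \<rho>\<^sub>0 \<and>
        (\<forall>\<tau>\<in>{\<tau>\<^sub>0 - \<eta><..<\<tau>\<^sub>0}. Re (\<rho>' \<tau>) > 1/2) \<and>
        (\<forall>\<tau>\<in>{\<tau>\<^sub>0<..<\<tau>\<^sub>0 + \<eta>}. Re (\<rho>' \<tau>) < 1/2))"

section \<open>The case where the double zero splits\<close>

text \<open>Divided by \<open>\<kappa>\<close>, this derivative is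
  \<open>deriv \<kappa> / \<kappa> * D + deriv D\<close>. At the centre the second term is
  imaginary, while the first has nonzero real part because \<open>D\<close> is real there.\<close>

lemma deriv_\<kappa>D_nz:
  assumes "D \<rho>\<^sub>0 \<noteq> 0"
  shows "deriv (\<lambda>z. \<kappa> z * D z) \<rho>\<^sub>0 \<noteq> 0"
proof
  assume "deriv (\<lambda>z. \<kappa> z * D z) \<rho>\<^sub>0 = 0"
  then have "deriv \<kappa> \<rho>\<^sub>0 / \<kappa> \<rho>\<^sub>0 * D \<rho>\<^sub>0 = - deriv D \<rho>\<^sub>0"
    using deriv_\<kappa>D[OF centre] \<kappa>_nz[OF centre] by (simp add: field_simps eq_neg_iff_add_eq_0)
  then have "Re (deriv \<kappa> \<rho>\<^sub>0 / \<kappa> \<rho>\<^sub>0 * D \<rho>\<^sub>0) = 0"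
    using D_deriv_imaginary by simp
  then have "Re (deriv \<kappa> \<rho>\<^sub>0 / \<kappa> \<rho>\<^sub>0) * Re (D \<rho>\<^sub>0) = 0"
    using D_centre_real unfolding times_complex.sel by simp
  then show False
    using \<kappa>_log_deriv assms D_centre_real by (auto simp: complex_eq_iff)
qed

text \<open>Near the centre \<open>f' s \<tau> = 0\<close> can be solved for \<tau>, giving
  \<open>p s = \<tau> - \<tau>\<^sub>0\<close> with a simple zero of \<open>p\<close>. The local
  inverse \<open>g\<close> then follows the zero of the derivative, and \<open>c\<close> is its
  velocity at \<open>\<tau>\<^sub>0\<close>.\<close>

lemma f'_zero_inverse:
  assumes D0: "D \<rho>\<^sub>0 \<noteq> 0"
  obtains p g r' \<epsilon> c where "0 < r'" "r' \<le> R" "0 < \<epsilon>" "inj_on p (ball \<rho>\<^sub>0 r')"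
    "continuous_on (ball 0 \<epsilon>) g" "\<And>w. w \<in> ball 0 \<epsilon> \<Longrightarrow> g w \<in> ball \<rho>\<^sub>0 r' \<and> p (g w) = w"
    "g 0 = \<rho>\<^sub>0" "(g has_field_derivative c) (at 0)"
    "\<And>s \<tau>. s \<in> ball \<rho>\<^sub>0 r' \<Longrightarrow> f' s \<tau> = 0 \<longleftrightarrow> p s = of_real (\<tau> - \<tau>\<^sub>0)"
    "c = - (deriv \<kappa> \<rho>\<^sub>0 / \<kappa> \<rho>\<^sub>0 * D \<rho>\<^sub>0 + deriv D \<rho>\<^sub>0) / (2 * a \<rho>\<^sub>0)"
proof -
  define d where "d = deriv (\<lambda>z. \<kappa> z * D z)"
  have d_holo: "d holomorphic_on ball \<rho>\<^sub>0 R"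
    unfolding d_def by (intro holomorphic_deriv holomorphic_intros \<kappa>_holo D_holo open_ball)
  have "d \<rho>\<^sub>0 \<noteq> 0" using deriv_\<kappa>D_nz[OF D0] by (simp add: d_def)
  then obtain e where e: "e > 0" "\<forall>y\<in>ball \<rho>\<^sub>0 R. dist \<rho>\<^sub>0 y < e \<longrightarrow> d y \<noteq> 0"
    using continuous_on_avoid[OF holomorphic_on_imp_continuous_on[OF d_holo] centre] by blast
  define r where "r = min e R"
  have r: "0 < r" "r \<le> R" "\<And>s. s \<in> ball \<rho>\<^sub>0 r \<Longrightarrow> d s \<noteq> 0"
    using e R by (auto simp: r_def)
  have sub: "ball \<rho>\<^sub>0 r \<subseteq> ball \<rho>\<^sub>0 R" using r by (simp add: subset_ball)
  define b where "b = (\<lambda>s. 2 * (\<kappa> s * a s) + (s - \<rho>\<^sub>0) * deriv (\<lambda>z. \<kappa> z * a z) s)"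
  have b_holo: "b holomorphic_on ball \<rho>\<^sub>0 R"
    unfolding b_def by (intro holomorphic_intros \<kappa>_holo a_holo holomorphic_deriv open_ball)
  define P where "P = (\<lambda>s. - b s / d s)"
  have P_holo: "P holomorphic_on ball \<rho>\<^sub>0 r"
    unfolding P_def by (intro holomorphic_intros holomorphic_on_subset[OF b_holo sub] holomorphic_on_subset[OF d_holo sub] r)
  define p where "p = (\<lambda>s. (s - \<rho>\<^sub>0) * P s)"
  have p_holo: "p holomorphic_on ball \<rho>\<^sub>0 r"
    unfolding p_def by (intro holomorphic_intros P_holo)
  have "(p has_field_derivative P \<rho>\<^sub>0) (at \<rho>\<^sub>0)"
    unfolding p_def by (rule DERIV_linear_factor[OF P_holo r(1)])
  then have dp: "deriv p \<rho>\<^sub>0 = P \<rho>\<^sub>0" by (rule DERIV_imp_deriv)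
  have P0: "P \<rho>\<^sub>0 = - (2 * \<kappa> \<rho>\<^sub>0 * a \<rho>\<^sub>0) / d \<rho>\<^sub>0"
    by (simp add: P_def b_def)
  have dnz: "deriv p \<rho>\<^sub>0 \<noteq> 0"
    unfolding dp P0 using a_nz \<kappa>_nz[OF centre] r by simp
  have p0: "p \<rho>\<^sub>0 = 0" by (simp add: p_def)
  obtain r' \<epsilon> g where g: "0 < r'" "ball \<rho>\<^sub>0 r' \<subseteq> ball \<rho>\<^sub>0 r" "0 < \<epsilon>" "inj_on p (ball \<rho>\<^sub>0 r')"
    "continuous_on (ball 0 \<epsilon>) g"
    "\<And>w. w \<in> ball 0 \<epsilon> \<Longrightarrow> g w \<in> ball \<rho>\<^sub>0 r' \<and> p (g w) = w" "g 0 = \<rho>\<^sub>0"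
    "(g has_field_derivative inverse (deriv p \<rho>\<^sub>0)) (at 0)"
    using local_holomorphic_inverse[OF p_holo r(1) dnz] unfolding p0 by metis
  have iff: "f' s \<tau> = 0 \<longleftrightarrow> p s = of_real (\<tau> - \<tau>\<^sub>0)" if "s \<in> ball \<rho>\<^sub>0 r'" for s \<tau>
  proof -
    have s: "s \<in> ball \<rho>\<^sub>0 r" "s \<in> ball \<rho>\<^sub>0 R" using that g(2) sub by blast+
    have "f' s \<tau> = (s - \<rho>\<^sub>0) * b s + of_real (\<tau> - \<tau>\<^sub>0) * d s"
      using f'_eq[OF s(2)] by (simp add: b_def d_def)
    also have "\<dots> = d s * (of_real (\<tau> - \<tau>\<^sub>0) - p s)"
      using r(3)[OF s(1)] by (simp add: p_def P_def field_simps)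
    finally show ?thesis using r(3)[OF s(1)] by auto
  qed
  have c: "inverse (deriv p \<rho>\<^sub>0) = - (deriv \<kappa> \<rho>\<^sub>0 / \<kappa> \<rho>\<^sub>0 * D \<rho>\<^sub>0 + deriv D \<rho>\<^sub>0) / (2 * a \<rho>\<^sub>0)"
    unfolding dp P0 d_def deriv_\<kappa>D[OF centre]
    using \<kappa>_nz[OF centre] a_nz by (simp add: field_simps)
  have "r' \<le> R"
    using g(1,2) sub by (auto simp: ball_subset_ball_iff)
  then show ?thesis using that[OF g(1) _ g(3,4,5,6,7,8) iff c] by simp
qed

text \<open>\<open>a\<close> and \<open>D\<close> are real at the centre and \<open>deriv D\<close>
  is imaginary, so the latter drops out of the real part.\<close>

lemma Re_f'_velocity:
  assumes "D \<rho>\<^sub>0 \<noteq> 0"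
  shows "Re (- (deriv \<kappa> \<rho>\<^sub>0 / \<kappa> \<rho>\<^sub>0 * D \<rho>\<^sub>0 + deriv D \<rho>\<^sub>0) / (2 * a \<rho>\<^sub>0))
     = - Re (deriv \<kappa> \<rho>\<^sub>0 / \<kappa> \<rho>\<^sub>0) * Re (D \<rho>\<^sub>0) / (2 * Re (a \<rho>\<^sub>0))"
proof -
  obtain x where x: "a \<rho>\<^sub>0 = of_real x"
    using a_centre_real by (metis complex_is_Real_iff Reals_cases)
  obtain y where y: "D \<rho>\<^sub>0 = of_real y"
    using D_centre_real by (metis complex_is_Real_iff Reals_cases)
  have two: "2 * complex_of_real x = of_real (2 * x)" by simp
  show ?thesis
    unfolding x y two Re_divide_of_real using D_deriv_imaginary
    by (simp only: uminus_complex.sel plus_complex.sel times_complex.sel Re_complex_of_real Im_complex_of_real) simp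
qed

lemma deriv_crosses_line_if:
  assumes "Re (D \<rho>\<^sub>0) / Re (a \<rho>\<^sub>0) < 0"
  shows deriv_crosses_line
proof -
  have D0: "D \<rho>\<^sub>0 \<noteq> 0" using assms by auto
  obtain r' \<epsilon> p g c where g: "0 < r'" "r' \<le> R" "0 < \<epsilon>" "inj_on p (ball \<rho>\<^sub>0 r')"
    "continuous_on (ball 0 \<epsilon>) g" "\<And>w. w \<in> ball 0 \<epsilon> \<Longrightarrow> g w \<in> ball \<rho>\<^sub>0 r' \<and> p (g w) = w"
    "g 0 = \<rho>\<^sub>0" "(g has_field_derivative c) (at 0)"
    and iff: "\<And>s \<tau>. s \<in> ball \<rho>\<^sub>0 r' \<Longrightarrow> f' s \<tau> = 0 \<longleftrightarrow> p s = of_real (\<tau> - \<tau>\<^sub>0)"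
    and c: "c = - (deriv \<kappa> \<rho>\<^sub>0 / \<kappa> \<rho>\<^sub>0 * D \<rho>\<^sub>0 + deriv D \<rho>\<^sub>0) / (2 * a \<rho>\<^sub>0)"
    by (rule f'_zero_inverse[OF D0]) (rule that)
  have "Re c = - Re (deriv \<kappa> \<rho>\<^sub>0 / \<kappa> \<rho>\<^sub>0) / 2 * (Re (D \<rho>\<^sub>0) / Re (a \<rho>\<^sub>0))"
    using Re_f'_velocity[OF D0] c by simp
  also have "\<dots> < 0"
    using assms \<kappa>_log_deriv by (intro mult_pos_neg) auto
  finally have "Re c < 0" .
  \<comment> \<open>The sign lemma is stated for a positive real part, so it is applied to
    \<open>- g\<close>.\<close>
  then have c': "Re (- c) > 0" by simp
  have g': "((\<lambda>z. - g z) has_field_derivative - c) (at 0)"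
    using g(8) by (rule DERIV_minus)
  obtain \<delta> where \<delta>: "\<delta> > 0"
    "\<And>x. 0 < x \<Longrightarrow> x < \<delta> \<Longrightarrow> Re (- g (of_real x)) > Re (- g 0)"
    "\<And>x. 0 < x \<Longrightarrow> x < \<delta> \<Longrightarrow> Re (- g (- of_real x)) < Re (- g 0)"
    by (rule Re_sign_near_derivative[OF g' c']) (rule that)
  define \<eta> where "\<eta> = min \<delta> \<epsilon>"
  define \<rho>' where "\<rho>' = (\<lambda>\<tau>. g (of_real (\<tau> - \<tau>\<^sub>0)))"
  have in_ball: "complex_of_real (\<tau> - \<tau>\<^sub>0) \<in> ball 0 \<epsilon>" if "\<tau> \<in> {\<tau>\<^sub>0 - \<eta><..<\<tau>\<^sub>0 + \<eta>}" for \<tau>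
    using that unfolding mem_ball dist_0_norm norm_of_real by (auto simp: \<eta>_def abs_less_iff)
  have "continuous_on {\<tau>\<^sub>0 - \<eta><..<\<tau>\<^sub>0 + \<eta>} \<rho>'"
    unfolding \<rho>'_def by (rule continuous_on_compose2[OF g(5)]) (use in_ball in \<open>auto intro!: continuous_intros\<close>)
  then have "zero_trajectory f' \<tau>\<^sub>0 \<eta> \<rho>'"
    unfolding zero_trajectory_def using iff g(6) in_ball by (auto simp: \<rho>'_def)
  moreover have "\<eta> > 0" "\<rho>' \<tau>\<^sub>0 = \<rho>\<^sub>0"
    using \<delta> g by (auto simp: \<eta>_def \<rho>'_def)
  moreover have "Re (\<rho>' \<tau>) > 1/2" if "\<tau> \<in> {\<tau>\<^sub>0 - \<eta><..<\<tau>\<^sub>0}" for \<tau>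
    using \<delta>(3)[of "\<tau>\<^sub>0 - \<tau>"] that line g(7) by (auto simp: \<rho>'_def \<eta>_def)
  moreover have "Re (\<rho>' \<tau>) < 1/2" if "\<tau> \<in> {\<tau>\<^sub>0<..<\<tau>\<^sub>0 + \<eta>}" for \<tau>
    using \<delta>(2)[of "\<tau> - \<tau>\<^sub>0"] that line g(7) by (auto simp: \<rho>'_def \<eta>_def)
  ultimately show ?thesis unfolding deriv_crosses_line_def by blast
qed

text \<open>Injectivity of \<open>p\<close> identifies any trajectory with
  \<open>g (of_real (\<tau> - \<tau>\<^sub>0))\<close> near \<open>\<tau>\<^sub>0\<close>. Its
  velocity now has positive real part, so just before \<open>\<tau>\<^sub>0\<close> it lies to the
  left of the line.\<close>

lemma not_deriv_crosses_line_if: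
  assumes "Re (D \<rho>\<^sub>0) / Re (a \<rho>\<^sub>0) > 0"
  shows "\<not> deriv_crosses_line"
proof
  assume deriv_crosses_line
  then obtain \<eta> \<rho>' where \<eta>: "\<eta> > 0" and traj: "zero_trajectory f' \<tau>\<^sub>0 \<eta> \<rho>'" "\<rho>' \<tau>\<^sub>0 = \<rho>\<^sub>0"
    and gt: "\<And>\<tau>. \<tau> \<in> {\<tau>\<^sub>0 - \<eta><..<\<tau>\<^sub>0} \<Longrightarrow> Re (\<rho>' \<tau>) > 1/2"
    unfolding deriv_crosses_line_def by blast
  have D0: "D \<rho>\<^sub>0 \<noteq> 0" using assms by auto
  obtain r' \<epsilon> p g c where g: "0 < r'" "r' \<le> R" "0 < \<epsilon>" "inj_on p (ball \<rho>\<^sub>0 r')"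
    "continuous_on (ball 0 \<epsilon>) g" "\<And>w. w \<in> ball 0 \<epsilon> \<Longrightarrow> g w \<in> ball \<rho>\<^sub>0 r' \<and> p (g w) = w"
    "g 0 = \<rho>\<^sub>0" "(g has_field_derivative c) (at 0)"
    and iff: "\<And>s \<tau>. s \<in> ball \<rho>\<^sub>0 r' \<Longrightarrow> f' s \<tau> = 0 \<longleftrightarrow> p s = of_real (\<tau> - \<tau>\<^sub>0)"
    and c: "c = - (deriv \<kappa> \<rho>\<^sub>0 / \<kappa> \<rho>\<^sub>0 * D \<rho>\<^sub>0 + deriv D \<rho>\<^sub>0) / (2 * a \<rho>\<^sub>0)"
    by (rule f'_zero_inverse[OF D0]) (rule that)
  have "Re c = - Re (deriv \<kappa> \<rho>\<^sub>0 / \<kappa> \<rho>\<^sub>0) / 2 * (Re (D \<rho>\<^sub>0) / Re (a \<rho>\<^sub>0))"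
    using Re_f'_velocity[OF D0] c by simp
  also have "\<dots> > 0"
    using assms \<kappa>_log_deriv by (intro mult_pos_pos) auto
  finally have c': "Re c > 0" .
  obtain \<delta> where \<delta>0: "\<delta> > 0"
    "\<And>x. 0 < x \<Longrightarrow> x < \<delta> \<Longrightarrow> Re (g (of_real x)) > Re (g 0)"
    and \<delta>1: "\<And>x. 0 < x \<Longrightarrow> x < \<delta> \<Longrightarrow> Re (g (- of_real x)) < Re (g 0)"
    by (rule Re_sign_near_derivative[OF g(8) c']) (rule that)
  note \<delta> = \<delta>0(1) \<delta>1
  obtain \<delta>' where \<delta>': "0 < \<delta>'" "\<delta>' \<le> \<eta>"
     "\<And>\<tau>. \<bar>\<tau> - \<tau>\<^sub>0\<bar> < \<delta>' \<Longrightarrow> \<rho>' \<tau> \<in> ball \<rho>\<^sub>0 r' \<and> f' (\<rho>' \<tau>) \<tau> = 0"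
    by (rule zero_trajectory_near[OF traj(1) \<eta> g(1), unfolded traj(2)]) (rule that)
  define x where "x = min (min \<delta> \<delta>') \<epsilon> / 2"
  have x: "0 < x" "x < \<delta>" "x < \<delta>'" "x < \<epsilon>" using \<delta> \<delta>' g by (auto simp: x_def)
  define \<tau> where "\<tau> = \<tau>\<^sub>0 - x"
  have s: "\<rho>' \<tau> \<in> ball \<rho>\<^sub>0 r'" "p (\<rho>' \<tau>) = - of_real x"
    using \<delta>'(3)[of \<tau>] iff[of "\<rho>' \<tau>" \<tau>] x by (auto simp: \<tau>_def)
  have "- complex_of_real x \<in> ball 0 \<epsilon>" using x by simp
  then have "\<rho>' \<tau> = g (- of_real x)"
    using g(4,6) s unfolding inj_on_def by metis
  then have "Re (\<rho>' \<tau>) < 1/2" using \<delta>(2)[of x] x g(7) line by simp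
  moreover have "Re (\<rho>' \<tau>) > 1/2" using gt[of \<tau>] x \<delta>' by (simp add: \<tau>_def)
  ultimately show False by simp
qed

text \<open>\<open>\<epsilon>\<close> is the sign of the real number
  \<open>- a \<rho>\<^sub>0 / D \<rho>\<^sub>0\<close>; by continuity the real part keeps this sign
  nearby.\<close>

lemma quotient_holo_near:
  assumes "D \<rho>\<^sub>0 \<noteq> 0" "\<epsilon> = 1 \<or> \<epsilon> = -1" "\<epsilon> * (Re (D \<rho>\<^sub>0) / Re (a \<rho>\<^sub>0)) < 0"
  obtains r where "0 < r" "r \<le> R" "(\<lambda>s. - a s / D s) holomorphic_on ball \<rho>\<^sub>0 r"
    "\<And>s. s \<in> ball \<rho>\<^sub>0 r \<Longrightarrow> D s \<noteq> 0" "\<And>s. s \<in> ball \<rho>\<^sub>0 r \<Longrightarrow> \<epsilon> * Re (- a s / D s) > 0"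
proof -
  obtain e where e: "e > 0" "\<forall>y\<in>ball \<rho>\<^sub>0 R. dist \<rho>\<^sub>0 y < e \<longrightarrow> D y \<noteq> 0"
    using continuous_on_avoid[OF holomorphic_on_imp_continuous_on[OF D_holo] centre assms(1)] by blast
  define r where "r = min e R"
  have r: "0 < r" "r \<le> R" "\<And>s. s \<in> ball \<rho>\<^sub>0 r \<Longrightarrow> D s \<noteq> 0"
    using e R by (auto simp: r_def)
  have sub: "ball \<rho>\<^sub>0 r \<subseteq> ball \<rho>\<^sub>0 R" using r by (simp add: subset_ball)
  have m: "(\<lambda>s. - a s / D s) holomorphic_on ball \<rho>\<^sub>0 r"
    by (intro holomorphic_intros holomorphic_on_subset[OF a_holo sub] holomorphic_on_subset[OF D_holo sub] r)
  have a: "a \<rho>\<^sub>0 = of_real (Re (a \<rho>\<^sub>0))" and D: "D \<rho>\<^sub>0 = of_real (Re (D \<rho>\<^sub>0))"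
    using a_centre_real D_centre_real by (auto simp: complex_eq_iff)
  have "\<epsilon> * Re (- a \<rho>\<^sub>0 / D \<rho>\<^sub>0) = - \<epsilon> * (Re (a \<rho>\<^sub>0) / Re (D \<rho>\<^sub>0))"
    by (subst a, subst D) (simp del: of_real_divide flip: of_real_divide)
  also have "\<dots> > 0"
    using assms(2,3) by (auto simp: divide_less_0_iff zero_less_divide_iff)
  finally have pos: "\<epsilon> * Re (- a \<rho>\<^sub>0 / D \<rho>\<^sub>0) > 0" .
  have "continuous_on (ball \<rho>\<^sub>0 r) (\<lambda>s. \<epsilon> * Re (- a s / D s))"
    by (intro continuous_intros holomorphic_on_imp_continuous_on[OF m])
  then have "isCont (\<lambda>s. \<epsilon> * Re (- a s / D s)) \<rho>\<^sub>0"
    using r(1) by (simp add: continuous_on_eq_continuous_at)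
  then have "((\<lambda>s. \<epsilon> * Re (- a s / D s)) \<longlongrightarrow> \<epsilon> * Re (- a \<rho>\<^sub>0 / D \<rho>\<^sub>0)) (nhds \<rho>\<^sub>0)"
    using isCont_def tendsto_at_iff_tendsto_nhds by blast
  then have "eventually (\<lambda>s. \<epsilon> * Re (- a s / D s) > 0) (nhds \<rho>\<^sub>0)"
    using pos by (rule order_tendstoD)
  then obtain d where d: "d > 0" "\<And>s. dist s \<rho>\<^sub>0 < d \<Longrightarrow> \<epsilon> * Re (- a s / D s) > 0"
    unfolding eventually_nhds_metric by blast
  show ?thesis
    by (rule that[of "min r d"]) (use r d holomorphic_on_subset[OF m] in \<open>auto simp: dist_commute subset_ball\<close>)
qed

text \<open>On the line \<open>(s - \<rho>\<^sub>0)^2\<close> is real and not positive, and here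
  \<open>- a s / D s\<close> has negative real part. Their product is
  \<open>\<tau> - \<tau>\<^sub>0\<close>, so no zero on the line occurs before
  \<open>\<tau>\<^sub>0\<close>.\<close>

lemma not_leaves_line_if:
  assumes "Re (D \<rho>\<^sub>0) / Re (a \<rho>\<^sub>0) > 0"
  shows "\<not> leaves_line"
proof
  assume leaves_line
  then obtain \<theta> \<rho> where \<theta>: "\<theta> > 0" and traj: "zero_trajectory f \<tau>\<^sub>0 \<theta> \<rho>" "\<rho> \<tau>\<^sub>0 = \<rho>\<^sub>0"
    and on: "\<And>\<tau>. \<tau> \<in> {\<tau>\<^sub>0 - \<theta><..<\<tau>\<^sub>0} \<Longrightarrow> Re (\<rho> \<tau>) = 1/2"
    unfolding leaves_line_def by blast
  have D0: "D \<rho>\<^sub>0 \<noteq> 0" using assms by auto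
  have neg: "-1 * (Re (D \<rho>\<^sub>0) / Re (a \<rho>\<^sub>0)) < 0" using assms by simp
  obtain r where r: "0 < r" "r \<le> R" "(\<lambda>s. - a s / D s) holomorphic_on ball \<rho>\<^sub>0 r"
      "\<And>s. s \<in> ball \<rho>\<^sub>0 r \<Longrightarrow> D s \<noteq> 0" "\<And>s. s \<in> ball \<rho>\<^sub>0 r \<Longrightarrow> -1 * Re (- a s / D s) > 0"
    by (rule quotient_holo_near[OF D0 disjI2[OF HOL.refl] neg]) (rule that)
  obtain \<delta> where \<delta>: "0 < \<delta>" "\<delta> \<le> \<theta>"
     "\<And>\<tau>. \<bar>\<tau> - \<tau>\<^sub>0\<bar> < \<delta> \<Longrightarrow> \<rho> \<tau> \<in> ball \<rho>\<^sub>0 r \<and> f (\<rho> \<tau>) \<tau> = 0"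
    by (rule zero_trajectory_near[OF traj(1) \<theta> r(1), unfolded traj(2)]) (rule that)
  define \<tau> where "\<tau> = \<tau>\<^sub>0 - \<delta>/2"
  define s where "s = \<rho> \<tau>"
  have s: "s \<in> ball \<rho>\<^sub>0 r" "f s \<tau> = 0" "Re s = 1/2"
    using \<delta> on[of \<tau>] by (auto simp: \<tau>_def s_def)
  have sR: "s \<in> ball \<rho>\<^sub>0 R" using s(1) r(2) by auto
  have "(s - \<rho>\<^sub>0)^2 * a s + of_real (\<tau> - \<tau>\<^sub>0) * D s = 0"
    using f_eq[OF sR] \<kappa>_nz[OF sR] s(2) by simp
  then have "of_real (\<tau> - \<tau>\<^sub>0) = (s - \<rho>\<^sub>0)^2 * (- a s / D s)"
    using r(4)[OF s(1)] by (simp add: field_simps eq_neg_iff_add_eq_0 add.commute)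
  moreover have "(s - \<rho>\<^sub>0)^2 = of_real (- ((Im s - Im \<rho>\<^sub>0)^2))"
    using s(3) line by (simp add: complex_eq_iff power2_eq_square)
  ultimately have "complex_of_real (\<tau> - \<tau>\<^sub>0) = of_real (- ((Im s - Im \<rho>\<^sub>0)^2)) * (- a s / D s)"
    by simp
  then have "Re (complex_of_real (\<tau> - \<tau>\<^sub>0)) = Re (of_real (- ((Im s - Im \<rho>\<^sub>0)^2)) * (- a s / D s))"
    by (rule arg_cong)
  then have "\<tau> - \<tau>\<^sub>0 = - ((Im s - Im \<rho>\<^sub>0)^2) * Re (- a s / D s)"
    unfolding times_complex.sel by simp
  then have "\<tau> - \<tau>\<^sub>0 \<ge> 0" using r(5)[OF s(1)] by (simp add: mult_nonneg_nonpos)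
  then show False using \<delta> by (simp add: \<tau>_def)
qed

text \<open>Here \<open>m = - a / D\<close> has positive real part, so its principal square root is
  holomorphic and turns the equation for the zeros into
  \<open>p s ^ 2 = \<tau> - \<tau>\<^sub>0\<close>. Since \<open>p\<close> is locally invertible,
  each square root of \<open>\<tau> - \<tau>\<^sub>0\<close> yields one of the two zeros.\<close>

lemma leaves_line_if:
  assumes "Re (D \<rho>\<^sub>0) / Re (a \<rho>\<^sub>0) < 0"
  shows leaves_line
proof -
  have D0: "D \<rho>\<^sub>0 \<noteq> 0" using assms by auto
  have pos: "1 * (Re (D \<rho>\<^sub>0) / Re (a \<rho>\<^sub>0)) < 0" using assms by simp
  obtain r0 where r0: "0 < r0" "r0 \<le> R" "(\<lambda>s. - a s / D s) holomorphic_on ball \<rho>\<^sub>0 r0"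
      "\<And>s. s \<in> ball \<rho>\<^sub>0 r0 \<Longrightarrow> D s \<noteq> 0" "\<And>s. s \<in> ball \<rho>\<^sub>0 r0 \<Longrightarrow> 1 * Re (- a s / D s) > 0"
    by (rule quotient_holo_near[OF D0 disjI1[OF HOL.refl] pos]) (rule that)
  define m where "m = (\<lambda>s. - a s / D s)"
  have m_pos: "Re (m s) > 0" if "s \<in> ball \<rho>\<^sub>0 r0" for s
    using r0(5)[OF that] by (simp add: m_def)
  have subR: "s \<in> ball \<rho>\<^sub>0 R" if "s \<in> ball \<rho>\<^sub>0 r0" for s using that r0(2) by simp
  have m_reflect: "m (1 - cnj s) = cnj (m s)" if "s \<in> ball \<rho>\<^sub>0 r0" for s
    using a_reflect[OF subR[OF that]] D_reflect[OF subR[OF that]] by (simp add: m_def)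
  have c: "\<rho>\<^sub>0 \<in> ball \<rho>\<^sub>0 r0" using r0 by simp
  have m_notin: "m s \<notin> \<real>\<^sub>\<le>\<^sub>0" if "s \<in> ball \<rho>\<^sub>0 r0" for s
    using m_pos[OF that] by (auto simp: complex_nonpos_Reals_iff)
  define p where "p = (\<lambda>s. (s - \<rho>\<^sub>0) * csqrt (m s))"
  have sq_holo: "(\<lambda>s. csqrt (m s)) holomorphic_on ball \<rho>\<^sub>0 r0"
    using r0(3) m_notin by (intro holomorphic_intros) (auto simp: m_def)
  have p_holo: "p holomorphic_on ball \<rho>\<^sub>0 r0"
    unfolding p_def by (intro holomorphic_intros sq_holo)
  have "(p has_field_derivative csqrt (m \<rho>\<^sub>0)) (at \<rho>\<^sub>0)"
    unfolding p_def by (rule DERIV_linear_factor[OF sq_holo r0(1)])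
  then have dp: "deriv p \<rho>\<^sub>0 = csqrt (m \<rho>\<^sub>0)" by (rule DERIV_imp_deriv)
  have "m \<rho>\<^sub>0 \<in> \<real>"
    using m_reflect[OF c] reflect_centre by (metis Reals_cnj_iff)
  then obtain x where x: "m \<rho>\<^sub>0 = of_real x" by (auto elim: Reals_cases)
  have "x > 0" using m_pos[OF c] x by simp
  then have dp': "deriv p \<rho>\<^sub>0 = of_real (sqrt x)" unfolding dp x by simp
  have dnz: "deriv p \<rho>\<^sub>0 \<noteq> 0" using dp' \<open>x > 0\<close> by simp
  have p0: "p \<rho>\<^sub>0 = 0" by (simp add: p_def)
  obtain r' \<epsilon> g where g: "0 < r'" "ball \<rho>\<^sub>0 r' \<subseteq> ball \<rho>\<^sub>0 r0" "0 < \<epsilon>" "inj_on p (ball \<rho>\<^sub>0 r')"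
    "continuous_on (ball 0 \<epsilon>) g"
    "\<And>w. w \<in> ball 0 \<epsilon> \<Longrightarrow> g w \<in> ball \<rho>\<^sub>0 r' \<and> p (g w) = w" "g 0 = \<rho>\<^sub>0"
    "(g has_field_derivative inverse (deriv p \<rho>\<^sub>0)) (at 0)"
    by (rule local_holomorphic_inverse[OF p_holo r0(1) dnz, unfolded p0]) (rule that)
  have c': "Re (inverse (deriv p \<rho>\<^sub>0)) > 0"
    unfolding dp' using \<open>x > 0\<close> by (simp flip: of_real_inverse)
  obtain \<delta> where \<delta>0: "\<delta> > 0"
    "\<And>x. 0 < x \<Longrightarrow> x < \<delta> \<Longrightarrow> Re (g (of_real x)) > Re (g 0)"
    and \<delta>1: "\<And>x. 0 < x \<Longrightarrow> x < \<delta> \<Longrightarrow> Re (g (- of_real x)) < Re (g 0)"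
    by (rule Re_sign_near_derivative[OF g(8) c']) (rule that)
  note \<delta> = \<delta>0(1) \<delta>1
  \<comment> \<open>\<open>p\<close> sends the reflection of s to the reflection of
    \<open>p s\<close> in the imaginary axis. A point with imaginary value and its mirror image
    therefore have the same image, and injectivity makes them equal.\<close>
  have g_line: "Re (g (\<i> * of_real v)) = 1/2" if "\<i> * of_real v \<in> ball 0 \<epsilon>" for v
  proof -
    define s where "s = g (\<i> * of_real v)"
    have s: "s \<in> ball \<rho>\<^sub>0 r'" "p s = \<i> * of_real v" using g(6)[OF that] by (auto simp: s_def)
    have s0: "s \<in> ball \<rho>\<^sub>0 r0" using s g by blast
    have "csqrt (m (1 - cnj s)) = cnj (csqrt (m s))"
      unfolding m_reflect[OF s0] using m_pos[OF s0] by (intro cnj_csqrt[symmetric]) (auto simp: complex_nonpos_Reals_iff)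
    then have "p (1 - cnj s) = - cnj (p s)"
      unfolding p_def reflect_diff by (simp add: algebra_simps)
    then have "p (1 - cnj s) = p s" using s by simp
    then have "1 - cnj s = s"
      using g(4) s(1) reflect_in_ball unfolding inj_on_def by blast
    then show ?thesis by (simp add: s_def complex_eq_iff)
  qed
  \<comment> \<open>A continuous choice of square root of \<open>\<tau> - \<tau>\<^sub>0\<close>:
    imaginary before \<open>\<tau>\<^sub>0\<close>, where \<open>g\<close> then stays on the line,
    and negative real afterwards, where \<open>g\<close> moves to the left.\<close>
  define w where "w = (\<lambda>\<tau>. \<i> * of_real (sqrt (max 0 (\<tau>\<^sub>0 - \<tau>))) - complex_of_real (sqrt (max 0 (\<tau> - \<tau>\<^sub>0))))"
  have w2: "w \<tau> ^ 2 = of_real (\<tau> - \<tau>\<^sub>0)" for \<tau>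
  proof (cases "\<tau> \<le> \<tau>\<^sub>0")
    case True
    then show ?thesis
      by (simp add: w_def power_mult_distrib max_def flip: of_real_power)
  next
    case False
    then show ?thesis
      by (simp add: w_def power_mult_distrib max_def flip: of_real_power)
  qed
  \<comment> \<open>The norm of \<open>w \<tau>\<close> is the square root of |\<tau> -
    \<open>\<tau>\<^sub>0\<close>|, hence the squares.\<close>
  define \<theta> where "\<theta> = min (\<epsilon>^2) (\<delta>^2)"
  have \<theta>: "\<theta> > 0" using g(3) \<delta>(1) by (simp add: \<theta>_def)
  have norm_w: "norm (w \<tau>) ^ 2 < \<theta>" if "\<tau> \<in> {\<tau>\<^sub>0 - \<theta><..<\<tau>\<^sub>0 + \<theta>}" for \<tau>
  proof -
    have "norm (w \<tau>) ^ 2 = \<bar>\<tau> - \<tau>\<^sub>0\<bar>" using w2[of \<tau>] by (metis norm_of_real norm_power)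
    then show ?thesis using that by (auto simp: abs_less_iff)
  qed
  have in_ball: "w \<tau> \<in> ball 0 \<epsilon>" "norm (w \<tau>) < \<delta>" if "\<tau> \<in> {\<tau>\<^sub>0 - \<theta><..<\<tau>\<^sub>0 + \<theta>}" for \<tau>
    using norm_w[OF that] g(3) \<delta>(1) power_less_imp_less_base[of "norm (w \<tau>)" 2]
    by (auto simp: \<theta>_def)
  define \<rho> where "\<rho> = (\<lambda>\<tau>. g (w \<tau>))"
  have "continuous_on {\<tau>\<^sub>0 - \<theta><..<\<tau>\<^sub>0 + \<theta>} \<rho>"
    unfolding \<rho>_def
    by (rule continuous_on_compose2[OF g(5)]) (use in_ball in \<open>auto simp: w_def intro!: continuous_intros\<close>)
  moreover have "f (\<rho> \<tau>) \<tau> = 0" if \<tau>: "\<tau> \<in> {\<tau>\<^sub>0 - \<theta><..<\<tau>\<^sub>0 + \<theta>}" for \<tau>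
  proof -
    define s where "s = \<rho> \<tau>"
    have s: "s \<in> ball \<rho>\<^sub>0 r'" "p s = w \<tau>" using g(6)[OF in_ball(1)[OF \<tau>]] by (auto simp: s_def \<rho>_def)
    have s0: "s \<in> ball \<rho>\<^sub>0 r0" using s g by blast
    have "p s ^ 2 = (s - \<rho>\<^sub>0)^2 * m s" by (simp add: p_def power_mult_distrib)
    then have "of_real (\<tau> - \<tau>\<^sub>0) = (s - \<rho>\<^sub>0)^2 * m s" using w2[of \<tau>] s by simp
    then have "(s - \<rho>\<^sub>0)^2 * a s + of_real (\<tau> - \<tau>\<^sub>0) * D s = 0"
      using r0(4)[OF s0] by (simp add: m_def)
    then show ?thesis using f_eq[OF subR[OF s0], of \<tau>] by (simp add: s_def)
  qed
  ultimately have "zero_trajectory f \<tau>\<^sub>0 \<theta> \<rho>" unfolding zero_trajectory_def by blast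
  moreover have "\<rho> \<tau>\<^sub>0 = \<rho>\<^sub>0" using g(7) by (simp add: \<rho>_def w_def)
  moreover have "Re (\<rho> \<tau>) = 1/2" if "\<tau> \<in> {\<tau>\<^sub>0 - \<theta><..<\<tau>\<^sub>0}" for \<tau>
  proof -
    have "w \<tau> = \<i> * of_real (sqrt (\<tau>\<^sub>0 - \<tau>))" using that by (simp add: w_def max_def)
    then show ?thesis using g_line[of "sqrt (\<tau>\<^sub>0 - \<tau>)"] in_ball(1)[of \<tau>] that \<theta> by (simp add: \<rho>_def)
  qed
  moreover have "Re (\<rho> \<tau>) < 1/2" if "\<tau> \<in> {\<tau>\<^sub>0<..<\<tau>\<^sub>0 + \<theta>}" for \<tau>
  proof -
    have w: "w \<tau> = - of_real (sqrt (\<tau> - \<tau>\<^sub>0))" using that by (simp add: w_def max_def)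
    have "norm (w \<tau>) < \<delta>" using in_ball(2)[of \<tau>] that \<theta> by simp
    then show ?thesis using \<delta>(2)[of "sqrt (\<tau> - \<tau>\<^sub>0)"] that g(7) line w by (simp add: \<rho>_def)
  qed
  ultimately show ?thesis using \<theta> unfolding leaves_line_def by blast
qed

section \<open>The case of a common zero for all parameters\<close>

text \<open>Once \<open>D s = (s - \<rho>\<^sub>0) * e s\<close>, the bracket in \<open>f_eq\<close>
  splits off the fixed zero \<open>\<rho>\<^sub>0\<close>, and
  \<open>H e (\<tau> - \<tau>\<^sub>0)\<close> is what remains: it carries the other zero.\<close>

definition H :: "(complex \<Rightarrow> complex) \<Rightarrow> complex \<Rightarrow> complex \<Rightarrow> complex" where
  "H e \<sigma> s = (s - \<rho>\<^sub>0) * a s + \<sigma> * e s"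

text \<open>\<open>s - \<rho>\<^sub>0\<close> changes sign and is conjugated under reflection, so
  the cofactor of the symmetric \<open>D\<close> is antisymmetric. At the centre its value is
  \<open>deriv D \<rho>\<^sub>0\<close>, which is imaginary.\<close>

lemma D_factor:
  assumes "D \<rho>\<^sub>0 = 0"
  obtains e where "e holomorphic_on ball \<rho>\<^sub>0 R" "\<And>s. s \<in> ball \<rho>\<^sub>0 R \<Longrightarrow> D s = (s - \<rho>\<^sub>0) * e s"
    "\<And>s. s \<in> ball \<rho>\<^sub>0 R \<Longrightarrow> e (1 - cnj s) = - cnj (e s)"
proof -
  define e where "e = (\<lambda>s. if s = \<rho>\<^sub>0 then deriv D \<rho>\<^sub>0 else (D s - D \<rho>\<^sub>0) / (s - \<rho>\<^sub>0))"
  have holo: "e holomorphic_on ball \<rho>\<^sub>0 R"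
    unfolding e_def by (rule pole_lemma_open) (use D_holo in auto)
  have eq: "D s = (s - \<rho>\<^sub>0) * e s" for s using assms by (simp add: e_def)
  have refl: "e (1 - cnj s) = - cnj (e s)" if "s \<in> ball \<rho>\<^sub>0 R" for s
  proof (cases "s = \<rho>\<^sub>0")
    case True
    have "e \<rho>\<^sub>0 = deriv D \<rho>\<^sub>0" by (simp add: e_def)
    then show ?thesis unfolding True reflect_centre using D_deriv_imaginary by (simp add: complex_eq_iff)
  next
    case False
    have "- cnj (s - \<rho>\<^sub>0) * e (1 - cnj s) = cnj (s - \<rho>\<^sub>0) * cnj (e s)"
      using eq[of "1 - cnj s"] eq[of s] D_reflect[OF that] unfolding reflect_diff by simp
    moreover have "cnj (s - \<rho>\<^sub>0) \<noteq> 0" using False by simp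
    ultimately show ?thesis by (metis minus_mult_left minus_mult_right mult_left_cancel minus_minus)
  qed
  show ?thesis by (rule that[OF holo eq refl])
qed

context
  fixes e assumes e_holo: "e holomorphic_on ball \<rho>\<^sub>0 R"
    and e_eq: "\<And>s. s \<in> ball \<rho>\<^sub>0 R \<Longrightarrow> D s = (s - \<rho>\<^sub>0) * e s"
    and e_reflect: "\<And>s. s \<in> ball \<rho>\<^sub>0 R \<Longrightarrow> e (1 - cnj s) = - cnj (e s)"
begin

lemma H_holo: "H e \<sigma> holomorphic_on ball \<rho>\<^sub>0 R"
  unfolding H_def by (intro holomorphic_intros a_holo e_holo)

lemma H_reflect: "s \<in> ball \<rho>\<^sub>0 R \<Longrightarrow> H e (of_real \<sigma>) (1 - cnj s) = - cnj (H e (of_real \<sigma>) s)"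
  using a_reflect[of s] e_reflect[of s] unfolding H_def reflect_diff by (simp add: algebra_simps)

lemma f_eq_H: "s \<in> ball \<rho>\<^sub>0 R \<Longrightarrow> f s \<tau> = \<kappa> s * ((s - \<rho>\<^sub>0) * H e (of_real (\<tau> - \<tau>\<^sub>0)) s)"
  using f_eq[of s \<tau>] e_eq[of s] by (simp add: H_def power2_eq_square algebra_simps)

text \<open>This is \<open>H e 0\<close>. Splitting it off makes the derivatives of \<open>H\<close>
  explicit in \<open>\<sigma>\<close>, as the joint limits in \<open>\<sigma>\<close> and s
  require.\<close>

definition k :: "complex \<Rightarrow> complex" where "k s = (s - \<rho>\<^sub>0) * a s"

lemma k_holo: "k holomorphic_on ball \<rho>\<^sub>0 R"
  unfolding k_def by (intro holomorphic_intros a_holo)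

lemma deriv_H: "s \<in> ball \<rho>\<^sub>0 R \<Longrightarrow> deriv (H e \<sigma>) s = deriv k s + \<sigma> * deriv e s"
proof -
  assume s: "s \<in> ball \<rho>\<^sub>0 R"
  have "(k has_field_derivative deriv k s) (at s)" "(e has_field_derivative deriv e s) (at s)"
    using s k_holo e_holo holomorphic_derivI open_ball by blast+
  then have "((\<lambda>s. k s + \<sigma> * e s) has_field_derivative deriv k s + \<sigma> * deriv e s) (at s)"
    by (intro DERIV_add DERIV_cmult)
  moreover have "(\<lambda>s. k s + \<sigma> * e s) = H e \<sigma>" by (auto simp: k_def H_def)
  ultimately show ?thesis by (metis DERIV_imp_deriv)
qed

lemma deriv2_H: "s \<in> ball \<rho>\<^sub>0 R \<Longrightarrow>
   (deriv (H e \<sigma>) has_field_derivative deriv (deriv k) s + \<sigma> * deriv (deriv e) s) (at s)"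
proof -
  assume s: "s \<in> ball \<rho>\<^sub>0 R"
  have "(deriv k has_field_derivative deriv (deriv k) s) (at s)" "(deriv e has_field_derivative deriv (deriv e) s) (at s)"
    using s holomorphic_deriv[OF k_holo open_ball] holomorphic_deriv[OF e_holo open_ball] holomorphic_derivI open_ball by blast+
  then have "((\<lambda>s. deriv k s + \<sigma> * deriv e s) has_field_derivative deriv (deriv k) s + \<sigma> * deriv (deriv e) s) (at s)"
    by (intro DERIV_add DERIV_cmult)
  then show ?thesis
    by (rule has_field_derivative_transform_within_open[OF _ open_ball s]) (simp add: deriv_H)
qed

lemma deriv_k_centre: "deriv k \<rho>\<^sub>0 = a \<rho>\<^sub>0"
proof -
  have "(k has_field_derivative a \<rho>\<^sub>0) (at \<rho>\<^sub>0)"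
    unfolding k_def by (rule DERIV_linear_factor[OF a_holo R])
  then show ?thesis by (rule DERIV_imp_deriv)
qed

text \<open>All three are strict inequalities at \<sigma> = 0, s = \<open>\<rho>\<^sub>0\<close>,
  where \<open>H\<close> vanishes and its derivative is \<open>a \<rho>\<^sub>0\<close>; joint
  continuity spreads them to a neighbourhood. The second quantity is the derivative of
  \<open>Re (deriv H * cnj H)\<close> along the real direction.\<close>

lemma H_estimates:
  obtains \<delta> where "0 < \<delta>" "\<delta> \<le> R"
    "\<And>\<sigma> s. norm \<sigma> < \<delta> \<Longrightarrow> s \<in> ball \<rho>\<^sub>0 \<delta> \<Longrightarrow> norm (deriv (H e \<sigma>) s - a \<rho>\<^sub>0) < norm (a \<rho>\<^sub>0) / 2"
    "\<And>\<sigma> s. norm \<sigma> < \<delta> \<Longrightarrow> s \<in> ball \<rho>\<^sub>0 \<delta> \<Longrightarrow>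
       Re ((deriv (deriv k) s + \<sigma> * deriv (deriv e) s) * cnj (H e \<sigma> s)) + norm (deriv (H e \<sigma>) s) ^ 2 > 0"
    "\<And>s. s \<in> ball \<rho>\<^sub>0 \<delta> \<Longrightarrow> Re (deriv \<kappa> s / \<kappa> s) < 0"
proof -
  let ?F = "nhds (0 :: complex, \<rho>\<^sub>0)"
  have lim: "((\<lambda>x. G (snd x)) \<longlongrightarrow> G \<rho>\<^sub>0) ?F" if "G holomorphic_on ball \<rho>\<^sub>0 R" for G :: "complex \<Rightarrow> complex"
  proof -
    have "isCont G \<rho>\<^sub>0"
      using holomorphic_on_imp_continuous_on[OF that] centre by (simp add: continuous_on_eq_continuous_at)
    then have "(G \<longlongrightarrow> G \<rho>\<^sub>0) (nhds \<rho>\<^sub>0)"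
      using isCont_def tendsto_at_iff_tendsto_nhds by blast
    moreover have "filterlim snd (nhds \<rho>\<^sub>0) ?F"
      using tendsto_snd[of "\<lambda>x. x" "(0::complex, \<rho>\<^sub>0)" ?F] by (simp add: filterlim_ident)
    ultimately show ?thesis by (rule filterlim_compose)
  qed
  have fst_lim: "((\<lambda>x. fst x) \<longlongrightarrow> 0) ?F"
    using tendsto_fst[of "\<lambda>x. x" "(0::complex, \<rho>\<^sub>0)" ?F] by (simp add: filterlim_ident)
  note hd = holomorphic_deriv[OF _ open_ball]
  note L = lim[OF k_holo] lim[OF e_holo] lim[OF hd[OF k_holo]] lim[OF hd[OF e_holo]]
    lim[OF hd[OF hd[OF k_holo]]] lim[OF hd[OF hd[OF e_holo]]] fst_lim
  have "((\<lambda>x. norm (deriv k (snd x) + fst x * deriv e (snd x) - a \<rho>\<^sub>0)) \<longlongrightarrow> norm (deriv k \<rho>\<^sub>0 + 0 * deriv e \<rho>\<^sub>0 - a \<rho>\<^sub>0)) ?F"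
    by (intro tendsto_intros L)
  then have ev1: "eventually (\<lambda>x. norm (deriv k (snd x) + fst x * deriv e (snd x) - a \<rho>\<^sub>0) < norm (a \<rho>\<^sub>0) / 2) ?F"
    by (rule order_tendstoD) (use a_nz deriv_k_centre in auto)
  have "((\<lambda>x. Re ((deriv (deriv k) (snd x) + fst x * deriv (deriv e) (snd x)) * cnj (k (snd x) + fst x * e (snd x)))
      + norm (deriv k (snd x) + fst x * deriv e (snd x)) ^ 2) \<longlongrightarrow>
      Re ((deriv (deriv k) \<rho>\<^sub>0 + 0 * deriv (deriv e) \<rho>\<^sub>0) * cnj (k \<rho>\<^sub>0 + 0 * e \<rho>\<^sub>0))
      + norm (deriv k \<rho>\<^sub>0 + 0 * deriv e \<rho>\<^sub>0) ^ 2) ?F"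
    by (intro tendsto_intros L)
  then have ev2: "eventually (\<lambda>x. Re ((deriv (deriv k) (snd x) + fst x * deriv (deriv e) (snd x)) * cnj (k (snd x) + fst x * e (snd x)))
      + norm (deriv k (snd x) + fst x * deriv e (snd x)) ^ 2 > 0) ?F"
    by (rule order_tendstoD) (use a_nz deriv_k_centre in \<open>auto simp: k_def\<close>)
  have "((\<lambda>x. Re (deriv \<kappa> (snd x) / \<kappa> (snd x))) \<longlongrightarrow> Re (deriv \<kappa> \<rho>\<^sub>0 / \<kappa> \<rho>\<^sub>0)) ?F"
    by (intro tendsto_intros lim[OF \<kappa>_holo] lim[OF hd[OF \<kappa>_holo]] \<kappa>_nz centre)
  then have ev3: "eventually (\<lambda>x. Re (deriv \<kappa> (snd x) / \<kappa> (snd x)) < 0) ?F"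
    by (rule order_tendstoD) (rule \<kappa>_log_deriv)
  obtain d where d: "d > 0" "\<And>x. dist x (0, \<rho>\<^sub>0) < d \<Longrightarrow>
      norm (deriv k (snd x) + fst x * deriv e (snd x) - a \<rho>\<^sub>0) < norm (a \<rho>\<^sub>0) / 2 \<and>
      Re ((deriv (deriv k) (snd x) + fst x * deriv (deriv e) (snd x)) * cnj (k (snd x) + fst x * e (snd x)))
      + norm (deriv k (snd x) + fst x * deriv e (snd x)) ^ 2 > 0 \<and>
      Re (deriv \<kappa> (snd x) / \<kappa> (snd x)) < 0"
    using eventually_conj[OF ev1 eventually_conj[OF ev2 ev3]] unfolding eventually_nhds_metric by blast
  \<comment> \<open>The distance in the product is at most the sum of the two distances, hence half
    of \<open>d\<close> for each.\<close>
  define \<delta> where "\<delta> = min (d/2) R"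
  have \<delta>: "0 < \<delta>" "\<delta> \<le> R" "\<delta> \<le> d/2" using d(1) R by (auto simp: \<delta>_def)
  have near: "dist (\<sigma>, s) (0, \<rho>\<^sub>0) < d" if "norm \<sigma> < \<delta>" "s \<in> ball \<rho>\<^sub>0 \<delta>" for \<sigma> s
  proof -
    have "dist (\<sigma>, s) (0, \<rho>\<^sub>0) \<le> dist \<sigma> 0 + dist s \<rho>\<^sub>0"
      unfolding dist_prod_def fst_conv snd_conv by (rule sqrt_sum_squares_le_sum) auto
    also have "\<dots> < d" using that \<delta>(3) by (simp add: dist_commute)
    finally show ?thesis .
  qed
  have inR: "s \<in> ball \<rho>\<^sub>0 R" if "s \<in> ball \<rho>\<^sub>0 \<delta>" for s using that \<delta>(2) by simp
  have kH: "k s + \<sigma> * e s = H e \<sigma> s" for s \<sigma> by (simp add: k_def H_def)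
  show ?thesis
  proof (rule that[OF \<delta>(1,2)])
    fix \<sigma> s :: complex assume *: "norm \<sigma> < \<delta>" "s \<in> ball \<rho>\<^sub>0 \<delta>"
    show "norm (deriv (H e \<sigma>) s - a \<rho>\<^sub>0) < norm (a \<rho>\<^sub>0) / 2"
      using d(2)[OF near[OF *]] deriv_H[OF inR[OF *(2)], of \<sigma>] by simp
    show "Re ((deriv (deriv k) s + \<sigma> * deriv (deriv e) s) * cnj (H e \<sigma> s)) + norm (deriv (H e \<sigma>) s) ^ 2 > 0"
      using d(2)[OF near[OF *]] unfolding deriv_H[OF inR[OF *(2)], of \<sigma>] kH[symmetric] fst_conv snd_conv by blast
  next
    fix s assume "s \<in> ball \<rho>\<^sub>0 \<delta>"
    then show "Re (deriv \<kappa> s / \<kappa> s) < 0"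
      using d(2)[OF near[of 0 s]] \<delta>(1) by simp
  qed
qed

text \<open>The estimate makes \<open>H\<close> differ from the linear map with slope
  \<open>a \<rho>\<^sub>0\<close> by a function of Lipschitz constant at most half that slope, so
  \<open>H\<close> has at most one zero in the ball. The mirror image of a zero is again one, hence
  equal to it.\<close>

lemma H_zero_on_line:
  assumes "0 < \<delta>" "\<delta> \<le> R"
    and est: "\<And>s. s \<in> ball \<rho>\<^sub>0 \<delta> \<Longrightarrow> norm (deriv (H e (of_real \<sigma>)) s - a \<rho>\<^sub>0) < norm (a \<rho>\<^sub>0) / 2"
    and s: "s \<in> ball \<rho>\<^sub>0 \<delta>" "H e (of_real \<sigma>) s = 0"
  shows "Re s = 1/2"
proof -
  let ?h = "H e (of_real \<sigma>)"
  have inR: "z \<in> ball \<rho>\<^sub>0 R" if "z \<in> ball \<rho>\<^sub>0 \<delta>" for z using that assms(2) by simp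
  have s': "1 - cnj s \<in> ball \<rho>\<^sub>0 \<delta>" using reflect_in_ball s by blast
  have z': "?h (1 - cnj s) = 0" using H_reflect[OF inR[OF s(1)], of \<sigma>] s(2) by simp
  have der: "((\<lambda>z. ?h z - a \<rho>\<^sub>0 * z) has_field_derivative deriv ?h z - a \<rho>\<^sub>0) (at z within ball \<rho>\<^sub>0 \<delta>)"
    if "z \<in> ball \<rho>\<^sub>0 \<delta>" for z
  proof -
    have "(?h has_field_derivative deriv ?h z) (at z)"
      using H_holo inR[OF that] holomorphic_derivI open_ball by blast
    then have "((\<lambda>z. ?h z - a \<rho>\<^sub>0 * z) has_field_derivative deriv ?h z - a \<rho>\<^sub>0) (at z)"
      by (auto intro!: derivative_eq_intros)
    then show ?thesis by (rule has_field_derivative_at_within)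
  qed
  have "norm ((?h s - a \<rho>\<^sub>0 * s) - (?h (1 - cnj s) - a \<rho>\<^sub>0 * (1 - cnj s))) \<le> norm (a \<rho>\<^sub>0) / 2 * norm (s - (1 - cnj s))"
    by (rule field_differentiable_bound[OF convex_ball der]) (use est s s' in \<open>auto intro: less_imp_le\<close>)
  moreover have "(?h s - a \<rho>\<^sub>0 * s) - (?h (1 - cnj s) - a \<rho>\<^sub>0 * (1 - cnj s)) = - a \<rho>\<^sub>0 * (s - (1 - cnj s))"
    using s(2) z' by (simp add: algebra_simps)
  ultimately have "norm (a \<rho>\<^sub>0) * norm (s - (1 - cnj s)) \<le> norm (a \<rho>\<^sub>0) / 2 * norm (s - (1 - cnj s))"
    by (metis norm_minus_cancel norm_mult)
  then have "norm (s - (1 - cnj s)) = 0"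
    using a_nz by (auto simp: field_simps)
  then show ?thesis by (simp add: complex_eq_iff)
qed

text \<open>\<open>Re (deriv H * cnj H)\<close> vanishes on the critical line and increases with \<open>Re s\<close>.\<close>

lemma H_log_deriv_neg:
  assumes "0 < \<delta>" "\<delta> \<le> R"
    and est: "\<And>s. s \<in> ball \<rho>\<^sub>0 \<delta> \<Longrightarrow>
       Re ((deriv (deriv k) s + of_real \<sigma> * deriv (deriv e) s) * cnj (H e (of_real \<sigma>) s)) + norm (deriv (H e (of_real \<sigma>)) s) ^ 2 > 0"
    and s: "s \<in> ball \<rho>\<^sub>0 \<delta>" "Re s < 1/2"
  shows "Re (deriv (H e (of_real \<sigma>)) s * cnj (H e (of_real \<sigma>) s)) < 0"
proof -
  let ?h = "H e (of_real \<sigma>)"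
  define J where "J = (\<lambda>x. Re (deriv ?h (of_real x + \<i> * Im s) * cnj (?h (of_real x + \<i> * Im s))))"
  \<comment> \<open>Moving horizontally from s towards the line only brings the point closer to
    \<open>\<rho>\<^sub>0\<close>, so the segment stays in the ball.\<close>
  have inB: "of_real x + \<i> * Im s \<in> ball \<rho>\<^sub>0 \<delta>" if "Re s \<le> x" "x \<le> 1/2" for x
  proof -
    have "norm (of_real x + \<i> * Im s - \<rho>\<^sub>0) \<le> norm (s - \<rho>\<^sub>0)"
      unfolding cmod_def using that s line
      by (auto intro!: real_sqrt_le_mono add_mono simp: abs_le_square_iff[symmetric])
    then show ?thesis using s(1) by (simp add: dist_norm norm_minus_commute)
  qed
  have dJ: "\<exists>y. DERIV J x :> y \<and> y > 0" if x: "Re s \<le> x" "x \<le> 1/2" for x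
  proof -
    let ?z = "complex_of_real x + \<i> * Im s"
    have zR: "?z \<in> ball \<rho>\<^sub>0 R" using inB[OF x] assms(2) by simp
    have line_der: "((\<lambda>x. of_real x + \<i> * Im s) has_vector_derivative 1) (at x)"
      by (auto intro!: derivative_eq_intros)
    have d1: "((\<lambda>x. ?h (of_real x + \<i> * Im s)) has_vector_derivative 1 * deriv ?h ?z) (at x)"
      using field_vector_diff_chain_at[OF line_der holomorphic_derivI[OF H_holo open_ball zR]] by (simp add: o_def)
    have d2: "((\<lambda>x. deriv ?h (of_real x + \<i> * Im s)) has_vector_derivative
         1 * (deriv (deriv k) ?z + of_real \<sigma> * deriv (deriv e) ?z)) (at x)"
      using field_vector_diff_chain_at[OF line_der deriv2_H[OF zR]] by (simp add: o_def)
    have "(J has_vector_derivative Re (deriv ?h ?z * cnj (1 * deriv ?h ?z) + (1 * (deriv (deriv k) ?z + of_real \<sigma> * deriv (deriv e) ?z)) * cnj (?h ?z))) (at x)"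
      unfolding J_def
      by (intro bounded_linear.has_vector_derivative[OF bounded_linear_Re] has_vector_derivative_mult
          bounded_linear.has_vector_derivative[OF bounded_linear_cnj] d1 d2)
    moreover have "Re (deriv ?h ?z * cnj (1 * deriv ?h ?z) + (1 * (deriv (deriv k) ?z + of_real \<sigma> * deriv (deriv e) ?z)) * cnj (?h ?z)) > 0"
      using est[OF inB[OF x]] by (simp add: complex_mult_cnj cmod_power2 add.commute)
    ultimately show ?thesis
      unfolding has_real_derivative_iff_has_vector_derivative by blast
  qed
  have "J (Re s) < J (1/2)"
    by (rule DERIV_pos_imp_increasing[OF s(2)]) (use dJ in auto)
  \<comment> \<open>On the line the antisymmetric \<open>H\<close> is imaginary and its derivative
    is real.\<close>
  moreover have "J (1/2) = 0"
  proof -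
    let ?z = "complex_of_real (1/2) + \<i> * Im s"
    have zR: "?z \<in> ball \<rho>\<^sub>0 R" using inB[of "1/2"] s(2) assms(2) by simp
    have z: "1 - cnj ?z = ?z" by (simp add: complex_eq_iff)
    have "deriv ?h (1 - cnj ?z) = - of_real (-1) * cnj (deriv ?h ?z)"
      by (rule deriv_reflect[OF H_holo line _ zR]) (use H_reflect in simp)
    then have "Im (deriv ?h ?z) = 0" unfolding z by (simp add: complex_eq_iff)
    moreover have "Re (?h ?z) = 0" using H_reflect[OF zR, of \<sigma>] unfolding z by (simp add: complex_eq_iff)
    ultimately show ?thesis by (simp add: J_def)
  qed
  moreover have "of_real (Re s) + \<i> * Im s = s" by (simp add: complex_eq_iff)
  ultimately show ?thesis by (simp add: J_def)
qed

text \<open>A zero of \<open>f\<close> off the line differs from \<open>\<rho>\<^sub>0\<close>, so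
  it would be a zero of \<open>H\<close>; but those near \<open>\<rho>\<^sub>0\<close> lie on the
  line.\<close>

lemma not_leaves_line_common_zero: "\<not> leaves_line"
proof
  assume leaves_line
  then obtain \<theta> \<rho> where \<theta>: "\<theta> > 0" and traj: "zero_trajectory f \<tau>\<^sub>0 \<theta> \<rho>" "\<rho> \<tau>\<^sub>0 = \<rho>\<^sub>0"
    and less: "\<And>\<tau>. \<tau> \<in> {\<tau>\<^sub>0<..<\<tau>\<^sub>0 + \<theta>} \<Longrightarrow> Re (\<rho> \<tau>) < 1/2"
    unfolding leaves_line_def by blast
  obtain \<delta> where \<delta>: "0 < \<delta>" "\<delta> \<le> R"
    "\<And>\<sigma> s. norm \<sigma> < \<delta> \<Longrightarrow> s \<in> ball \<rho>\<^sub>0 \<delta> \<Longrightarrow> norm (deriv (H e \<sigma>) s - a \<rho>\<^sub>0) < norm (a \<rho>\<^sub>0) / 2"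
    by (rule H_estimates) (rule that)
  obtain \<delta>' where \<delta>': "0 < \<delta>'" "\<delta>' \<le> \<theta>"
     "\<And>\<tau>. \<bar>\<tau> - \<tau>\<^sub>0\<bar> < \<delta>' \<Longrightarrow> \<rho> \<tau> \<in> ball \<rho>\<^sub>0 \<delta> \<and> f (\<rho> \<tau>) \<tau> = 0"
    by (rule zero_trajectory_near[OF traj(1) \<theta> \<delta>(1), unfolded traj(2)]) (rule that)
  define \<sigma> where "\<sigma> = min \<delta> \<delta>' / 2"
  have \<sigma>: "0 < \<sigma>" "\<sigma> < \<delta>" "\<sigma> < \<delta>'" using \<delta> \<delta>' by (auto simp: \<sigma>_def)
  define s where "s = \<rho> (\<tau>\<^sub>0 + \<sigma>)"
  have s: "s \<in> ball \<rho>\<^sub>0 \<delta>" "f s (\<tau>\<^sub>0 + \<sigma>) = 0" "Re s < 1/2"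
    using \<delta>'(3)[of "\<tau>\<^sub>0 + \<sigma>"] less[of "\<tau>\<^sub>0 + \<sigma>"] \<sigma> \<delta>' by (auto simp: s_def)
  have sR: "s \<in> ball \<rho>\<^sub>0 R" using s(1) \<delta>(2) by simp
  have "s \<noteq> \<rho>\<^sub>0" using s(3) line by auto
  then have "H e (of_real \<sigma>) s = 0" using f_eq_H[OF sR, of "\<tau>\<^sub>0 + \<sigma>"] \<kappa>_nz[OF sR] s(2) by simp
  then have "Re s = 1/2"
    by (intro H_zero_on_line[OF \<delta>(1,2) \<delta>(3) s(1)]) (use \<sigma> in auto)
  then show False using s(3) by simp
qed

text \<open>A zero of \<open>f'\<close> left of the line would satisfy \<kappa>'/\<kappa> + 1/(s -
  \<open>\<rho>\<^sub>0\<close>) + H'/H = 0. All three terms have negative real part there: the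
  first by continuity, the second because s lies left of \<open>\<rho>\<^sub>0\<close>, the third by
  \<open>H_log_deriv_neg\<close>.\<close>

lemma not_deriv_crosses_line_common_zero: "\<not> deriv_crosses_line"
proof
  assume deriv_crosses_line
  then obtain \<theta> \<rho> where \<theta>: "\<theta> > 0" and traj: "zero_trajectory f' \<tau>\<^sub>0 \<theta> \<rho>" "\<rho> \<tau>\<^sub>0 = \<rho>\<^sub>0"
    and less: "\<And>\<tau>. \<tau> \<in> {\<tau>\<^sub>0<..<\<tau>\<^sub>0 + \<theta>} \<Longrightarrow> Re (\<rho> \<tau>) < 1/2"
    unfolding deriv_crosses_line_def by blast
  obtain \<delta> where \<delta>: "0 < \<delta>" "\<delta> \<le> R"
    "\<And>\<sigma> s. norm \<sigma> < \<delta> \<Longrightarrow> s \<in> ball \<rho>\<^sub>0 \<delta> \<Longrightarrow> norm (deriv (H e \<sigma>) s - a \<rho>\<^sub>0) < norm (a \<rho>\<^sub>0) / 2"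
    "\<And>\<sigma> s. norm \<sigma> < \<delta> \<Longrightarrow> s \<in> ball \<rho>\<^sub>0 \<delta> \<Longrightarrow>
       Re ((deriv (deriv k) s + \<sigma> * deriv (deriv e) s) * cnj (H e \<sigma> s)) + norm (deriv (H e \<sigma>) s) ^ 2 > 0"
    "\<And>s. s \<in> ball \<rho>\<^sub>0 \<delta> \<Longrightarrow> Re (deriv \<kappa> s / \<kappa> s) < 0"
    by (rule H_estimates) (rule that)
  obtain \<delta>' where \<delta>': "0 < \<delta>'" "\<delta>' \<le> \<theta>"
     "\<And>\<tau>. \<bar>\<tau> - \<tau>\<^sub>0\<bar> < \<delta>' \<Longrightarrow> \<rho> \<tau> \<in> ball \<rho>\<^sub>0 \<delta> \<and> f' (\<rho> \<tau>) \<tau> = 0"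
    by (rule zero_trajectory_near[OF traj(1) \<theta> \<delta>(1), unfolded traj(2)]) (rule that)
  define \<sigma> where "\<sigma> = min \<delta> \<delta>' / 2"
  have \<sigma>: "0 < \<sigma>" "\<sigma> < \<delta>" "\<sigma> < \<delta>'" using \<delta>(1) \<delta>'(1) by (auto simp: \<sigma>_def)
  define s where "s = \<rho> (\<tau>\<^sub>0 + \<sigma>)"
  have s: "s \<in> ball \<rho>\<^sub>0 \<delta>" "f' s (\<tau>\<^sub>0 + \<sigma>) = 0" "Re s < 1/2"
    using \<delta>'(3)[of "\<tau>\<^sub>0 + \<sigma>"] less[of "\<tau>\<^sub>0 + \<sigma>"] \<sigma> \<delta>'(1,2) by (auto simp: s_def)
  have sR: "s \<in> ball \<rho>\<^sub>0 R" using s(1) \<delta>(2) by simp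
  let ?h = "H e (of_real \<sigma>)"
  have h_nz: "?h s \<noteq> 0"
  proof
    assume "?h s = 0"
    then have "Re s = 1/2"
      by (intro H_zero_on_line[OF \<delta>(1,2) \<delta>(3) s(1)]) (use \<sigma> in auto)
    then show False using s(3) by simp
  qed
  have u_nz: "s - \<rho>\<^sub>0 \<noteq> 0" using s(3) line by auto
  have dh: "(?h has_field_derivative deriv ?h s) (at s)"
    using H_holo sR holomorphic_derivI open_ball by blast
  have d\<kappa>: "(\<kappa> has_field_derivative deriv \<kappa> s) (at s)"
    using \<kappa>_holo sR holomorphic_derivI open_ball by blast
  have "((\<lambda>z. \<kappa> z * ((z - \<rho>\<^sub>0) * ?h z)) has_field_derivative
      deriv \<kappa> s * ((s - \<rho>\<^sub>0) * ?h s) + \<kappa> s * (?h s + (s - \<rho>\<^sub>0) * deriv ?h s)) (at s)"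
    by (rule derivative_eq_intros dh d\<kappa> HOL.refl | simp)+
  then have "((\<lambda>z. f z (\<tau>\<^sub>0 + \<sigma>)) has_field_derivative
      deriv \<kappa> s * ((s - \<rho>\<^sub>0) * ?h s) + \<kappa> s * (?h s + (s - \<rho>\<^sub>0) * deriv ?h s)) (at s)"
    by (rule has_field_derivative_transform_within_open[OF _ open_ball sR]) (simp add: f_eq_H)
  then have "deriv \<kappa> s * ((s - \<rho>\<^sub>0) * ?h s) + \<kappa> s * (?h s + (s - \<rho>\<^sub>0) * deriv ?h s) = 0"
    using s(2) DERIV_imp_deriv by fastforce
  then have sum0: "deriv \<kappa> s / \<kappa> s + 1 / (s - \<rho>\<^sub>0) + deriv ?h s / ?h s = 0"
    using h_nz u_nz \<kappa>_nz[OF sR] by (simp add: field_simps)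
  have "deriv ?h s / ?h s = deriv ?h s * cnj (?h s) / of_real (norm (?h s) ^ 2)"
    using h_nz unfolding complex_norm_square by simp
  then have "Re (deriv ?h s / ?h s) = Re (deriv ?h s * cnj (?h s)) / norm (?h s) ^ 2"
    by (simp only: Re_divide_of_real)
  moreover have "Re (deriv ?h s * cnj (?h s)) < 0"
    by (rule H_log_deriv_neg[OF \<delta>(1,2) \<delta>(4) s(1,3)]) (use \<sigma> in auto)
  ultimately have 1: "Re (deriv ?h s / ?h s) < 0"
    using h_nz by (simp add: divide_neg_pos)
  have "Re (1 / (s - \<rho>\<^sub>0)) = Re (s - \<rho>\<^sub>0) / (norm (s - \<rho>\<^sub>0))^2"
    by (simp add: Re_divide cmod_power2)
  then have 2: "Re (1 / (s - \<rho>\<^sub>0)) < 0"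
    using s(3) line u_nz by (simp add: divide_neg_pos)
  have "Re (deriv \<kappa> s / \<kappa> s) + Re (1 / (s - \<rho>\<^sub>0)) + Re (deriv ?h s / ?h s) = 0"
    using arg_cong[OF sum0, of Re] by (simp only: plus_complex.sel zero_complex.sel)
  then show False using 1 2 \<delta>(5)[OF s(1)] by linarith
qed

end

theorem leaves_line_iff_deriv_crosses_line: "leaves_line \<longleftrightarrow> deriv_crosses_line"
proof (cases "D \<rho>\<^sub>0 = 0")
  case True
  obtain e where e: "e holomorphic_on ball \<rho>\<^sub>0 R" "\<And>s. s \<in> ball \<rho>\<^sub>0 R \<Longrightarrow> D s = (s - \<rho>\<^sub>0) * e s"
    "\<And>s. s \<in> ball \<rho>\<^sub>0 R \<Longrightarrow> e (1 - cnj s) = - cnj (e s)"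
    by (rule D_factor[OF True]) (rule that)
  show ?thesis
    using not_leaves_line_common_zero[OF e] not_deriv_crosses_line_common_zero[OF e] by simp
next
  case False
  then have "Re (D \<rho>\<^sub>0) \<noteq> 0" "Re (a \<rho>\<^sub>0) \<noteq> 0"
    using a_nz a_centre_real D_centre_real by (auto simp: complex_eq_iff)
  then have "Re (D \<rho>\<^sub>0) / Re (a \<rho>\<^sub>0) < 0 \<or> Re (D \<rho>\<^sub>0) / Re (a \<rho>\<^sub>0) > 0"
    by (auto simp: divide_less_0_iff zero_less_divide_iff)
  then show ?thesis
    using leaves_line_if deriv_crosses_line_if not_leaves_line_if not_deriv_crosses_line_if by blast
qed

end

section \<open>The interpolating family\<close>

text \<open>Supplies the reflection law of the cofactor at the double zero itself, where one cannot
  divide by the square.\<close>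

lemma continuous_on_ball_eq_centre:
  fixes f g :: "complex \<Rightarrow> complex"
  assumes "continuous_on (ball z r) f" "continuous_on (ball z r) g" "0 < r"
    and "\<And>s. s \<in> ball z r \<Longrightarrow> s \<noteq> z \<Longrightarrow> f s = g s"
  shows "f z = g z"
proof -
  have f: "(f \<longlongrightarrow> f z) (at z)" and g: "(g \<longlongrightarrow> g z) (at z)"
    using assms(1-3) by (metis centre_in_ball continuous_on_eq_continuous_at isCont_def open_ball)+
  have "eventually (\<lambda>s. s \<in> ball z r - {z}) (at z)"
    using assms(3) by (intro eventually_at_in_open) auto
  then have "eventually (\<lambda>s. f s = g s) (at z)"
    by eventually_elim (use assms(4) in auto)
  then have "(g \<longlongrightarrow> f z) (at z)"
    using f tendsto_cong by fast
  then show ?thesis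
    by (rule tendsto_unique[OF trivial_limit_at _ g])
qed

text \<open>Digamma z is the limit of ln m minus the sum of 1/(z + n) over n < m. The height 10
  makes the real parts of the terms n = 0, 1, 2 at most 3/100 <= 1/32. From n = 3 on they are at
  most 1/n <= ln n - ln (n - 1), which telescopes to ln (m - 1) - ln 2. The surplus ln 2 >= 1/2
  beats 3/32 and leaves at least 1/4.\<close>

lemma Re_Digamma_pos:
  fixes z :: complex
  assumes re: "0 < Re z" "Re z \<le> 1/2" and im: "\<bar>Im z\<bar> \<ge> 10"
  shows "Re (Digamma z) > 0"
proof -
  define t where "t = (\<lambda>n::nat. Re (inverse (z + of_nat n)))"
  have t_eq: "t n = (Re z + n) / ((Re z + n)^2 + (Im z)^2)" for n
    by (simp add: t_def complex_inverse)
  have im2: "(Im z)^2 \<ge> 100"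
    using power_mono[of 10 "\<bar>Im z\<bar>" 2] im by simp
  have t_small: "t n \<le> 1 / 32" if "n < 3" for n
  proof -
    have "Re z + n \<le> 3" using re(2) that by (auto simp: less_eq_real_def) 
    moreover have "(Re z + n)^2 + (Im z)^2 \<ge> 100" using im2 by (smt (verit) zero_le_power2)
    ultimately have "t n \<le> 3 / 100"
      unfolding t_eq using re(1) by (intro frac_le) auto
    then show ?thesis by simp
  qed
  have t_ln: "t n \<le> ln (real n) - ln (real n - 1)" if "n \<ge> 3" for n
  proof -
    have "(Re z + n) / ((Re z + n)^2 + (Im z)^2) \<le> (Re z + n) / ((Re z + n)^2)"
      using re that by (intro divide_left_mono mult_pos_pos add_pos_nonneg zero_less_power) auto
    also have "\<dots> = 1 / (Re z + n)" by (simp add: power2_eq_square)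
    also have "\<dots> \<le> 1 / n" using re that by (intro divide_left_mono) auto
    finally have "t n \<le> 1 / n" unfolding t_eq .
    moreover have "ln (1 + (- 1 / n)) \<le> - 1 / n"
      using that by (intro ln_add_one_self_le_self2) (auto simp: field_simps)
    moreover have "1 + (- 1 / real n) = (real n - 1) / n" using that by (simp add: field_simps)
    ultimately show ?thesis using that by (simp add: ln_div)
  qed
  have sum_le: "(\<Sum>n<m. t n) \<le> 3 / 32 + (ln (real m - 1) - ln 2)" if "m \<ge> 3" for m
    using that
  proof (induction m rule: dec_induct)
    case base
    have "(\<Sum>n<3. t n) \<le> (\<Sum>n<3::nat. 1 / 32)"
      by (rule sum_mono) (use t_small in auto)
    then show ?case by simp
  next
    case (step m)
    then show ?case using t_ln[of m] by simp
  qed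
  have "1/2 \<le> ln (2::real)"
    using ln_add_one_self_le_self2[of "-1/2"] by (simp add: ln_div)
  then have le: "1/4 \<le> Re (of_real (ln (real m)) - (\<Sum>n<m. inverse (z + of_nat n)))" if "m \<ge> 3" for m
  proof -
    have "ln (real m - 1) \<le> ln (real m)" using that by simp
    then show ?thesis using sum_le[OF that] \<open>1/2 \<le> ln 2\<close> by (simp add: t_def)
  qed
  have "z \<noteq> 0" using re by auto
  then have lim: "(\<lambda>m. Re (of_real (ln (real m)) - (\<Sum>n<m. inverse (z + of_nat n)))) \<longlonglongrightarrow> Re (Digamma z)"
    by (intro tendsto_Re Digamma_LIMSEQ)
  have ev: "eventually (\<lambda>m. 1/4 \<le> Re (of_real (ln (real m)) - (\<Sum>n<m. inverse (z + of_nat n)))) sequentially"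
    by (rule eventually_sequentiallyI[of 3]) (rule le)
  have "1/4 \<le> Re (Digamma z)"
    by (rule tendsto_lowerbound[OF lim ev sequentially_bot])
  then show ?thesis by simp
qed

section \<open>Identification of the continued Dirichlet series\<close>

text \<open>The identity theorem is applied to the difference after removing singularities, because
  the difference itself may have the wrong value at a common pole. This gives equality near each
  point z, off z; being nicely meromorphic then fixes the value at z, as 0 at a pole and as the
  limit elsewhere.\<close>

lemma nicely_meromorphic_unique:
  assumes F: "F nicely_meromorphic_on UNIV" and G: "G nicely_meromorphic_on UNIV"
    and eq: "\<And>s. s \<in> U \<Longrightarrow> F s = G s" and U: "open U" "U \<noteq> {}"
  shows "F = G"
proof
  fix z
  have mer: "F meromorphic_on UNIV" "G meromorphic_on UNIV"
    using F G by (auto simp: nicely_meromorphic_on_def)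
  then have dmer: "(\<lambda>s. F s - G s) meromorphic_on UNIV" by (intro meromorphic_intros)
  define d where "d = remove_sings (\<lambda>s. F s - G s)"
  have d_nice: "d nicely_meromorphic_on UNIV"
    unfolding d_def by (rule remove_sings_nicely_meromorphic[OF dmer])
  have d0: "d s = 0" if "s \<in> U" for s
  proof -
    have "eventually (\<lambda>w. w \<in> U) (nhds s)" using U(1) that by (rule eventually_nhds_in_open)
    then have "eventually (\<lambda>w. F w - G w = 0) (nhds s)" by eventually_elim (simp add: eq)
    then have "(\<lambda>s. F s - G s) analytic_on {s}"
      using analytic_at_cong[of "\<lambda>w. F w - G w" "\<lambda>_. 0" s s] by simp
    then show ?thesis unfolding d_def using eq[OF that] by simp
  qed
  have "d constant_on U" unfolding constant_on_def using d0 by blast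
  then have "d constant_on UNIV"
    by (rule constant_on_extend_nicely_meromorphic_on[OF d_nice]) (use U in auto)
  then have d00: "d s = 0" for s using d0 U(2) by (auto simp: constant_on_def)
  have "eventually (\<lambda>w. d w = F w - G w) (at z)"
    unfolding d_def by (rule eventually_remove_sings_eq_at) (use dmer meromorphic_on_isolated_singularity meromorphic_on_subset in blast)
  then have ev: "eventually (\<lambda>w. F w = G w) (at z)" by eventually_elim (use d00 in auto)
  have pole: "is_pole F z \<longleftrightarrow> is_pole G z" by (rule is_pole_cong[OF ev]) simp
  have Fz: "(is_pole F z \<and> F z = 0) \<or> F \<midarrow>z\<rightarrow> F z" and Gz: "(is_pole G z \<and> G z = 0) \<or> G \<midarrow>z\<rightarrow> G z"
    using F G by (auto simp: nicely_meromorphic_on_def)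
  show "F z = G z"
  proof (cases "is_pole F z")
    case True
    then show ?thesis using F G pole is_pole_zero_at_nicely_mero by (metis UNIV_I)
  next
    case False
    then have "F \<midarrow>z\<rightarrow> F z" "G \<midarrow>z\<rightarrow> G z" using Fz Gz pole by auto
    moreover from this(1) have "G \<midarrow>z\<rightarrow> F z" using tendsto_cong[OF ev] by blast
    ultimately show ?thesis using tendsto_unique trivial_limit_at by blast
  qed
qed

text \<open>Any meromorphic candidate \<open>G\<close> will do: \<open>remove_sings G\<close> is the
  unique function described, and it agrees with \<open>G\<close> wherever \<open>G\<close> is
  analytic.\<close>

lemma continued_dirichlet_series_eq:
  assumes mer: "G meromorphic_on UNIV"
    and an: "\<And>s. Re s > 1 \<Longrightarrow> G analytic_on {s}"
    and sums: "\<And>s. Re s > 1 \<Longrightarrow> (\<lambda>n. a (Suc n) / of_nat (Suc n) powr s) sums G s"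
    and s: "G analytic_on {s}"
  shows "continued_dirichlet_series a s = G s"
proof -
  let ?F = "remove_sings G"
  let ?P = "\<lambda>F. F nicely_meromorphic_on UNIV \<and>
        (\<forall>s. Re s > 1 \<longrightarrow> (\<lambda>n. a (Suc n) / of_nat (Suc n) powr s) sums F s)"
  have P: "?P ?F" using remove_sings_nicely_meromorphic[OF mer] an sums by auto
  have "F = ?F" if "?P F" for F
  proof (rule nicely_meromorphic_unique)
    show "F w = ?F w" if "w \<in> {s. Re s > 1}" for w
      using that P \<open>?P F\<close> sums_unique2 by blast
    show "open {s. Re s > 1}" by (rule open_halfspace_Re_gt)
    have "(2::complex) \<in> {s. Re s > 1}" by simp
    then show "{s::complex. Re s > 1} \<noteq> {}" by blast
  qed (use that P in auto)
  then have "continued_dirichlet_series a = ?F"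
    unfolding continued_dirichlet_series_def using P by (intro the_equality) blast+
  then show ?thesis using s by simp
qed

context selfdual_coefficients
begin

text \<open>At 0 and 1 the formula for \<open>Lam\<close> divides by zero, so its value there need
  not be that of the continuation.\<close>

lemma continued_dirichlet_series_Lam:
  assumes "s \<noteq> 0" "s \<noteq> 1"
  shows "continued_dirichlet_series a s = Lam s * exp (s / 2 * of_real (ln c)) * rGamma (s / 2)"
proof (rule continued_dirichlet_series_eq)
  let ?G = "\<lambda>s. Lam s * exp (s / 2 * of_real (ln c)) * rGamma (s / 2)"
  have half: "half analytic_on A" for A
    using half_entire analytic_on_open[of UNIV half] analytic_on_subset by auto
  have "(half \<circ> (\<lambda>s. 1 - s)) analytic_on A" for A
    by (rule analytic_on_compose) (auto intro!: analytic_intros half)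
  then have half': "(\<lambda>s. half (1 - s)) analytic_on A" for A
    by (simp add: o_def)
  show "?G meromorphic_on UNIV"
    unfolding Lam_def
    by (intro meromorphic_intros analytic_on_imp_meromorphic_on half half' analytic_intros) auto
  have an: "?G analytic_on {s}" if "s \<noteq> 0" "s \<noteq> 1" for s
    unfolding Lam_def using that by (intro analytic_intros half half') auto
  show "?G analytic_on {s}" by (rule an[OF assms])
  show "?G analytic_on {s}" if "Re s > 1" for s by (rule an) (use that in auto)
qed (rule dirichlet_series_continuation)

lemma continued_dirichlet_series_sums:
  assumes "Re s > 1"
  shows "(\<lambda>n. a (Suc n) / of_nat (Suc n) powr s) sums continued_dirichlet_series a s"
  using dirichlet_series_continuation[OF assms] assms
  by (subst continued_dirichlet_series_Lam) auto

text \<open>The terms after the first are dominated by 2^(2-x) times a convergent series. The path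
  Im s = 1 lies in the upper half-plane, where nonvanishing of the family is needed.\<close>

lemma continued_dirichlet_series_at_top:
  "((\<lambda>x. continued_dirichlet_series a (Complex x 1)) \<longlongrightarrow> a 1) at_top"
proof -
  define C where "C = bound * (\<Sum>n. real (n + 2) powr - 2)"
  have sm2: "summable (\<lambda>n. real (n + 2) powr - 2)"
    using summable_iff_shift[of "\<lambda>n. real n powr - 2" 2] summable_real_powr_iff[of "-2"] by simp
  have est: "norm (continued_dirichlet_series a (Complex x 1) - a 1) \<le> C * 2 powr (2 - x)" if x: "x \<ge> 2" for x
  proof -
    let ?s = "Complex x 1"
    have le: "norm (a (Suc (Suc n)) / of_nat (Suc (Suc n)) powr ?s) \<le> bound * 2 powr (2 - x) * real (n + 2) powr - 2" for n
    proof -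
      have "norm (of_nat (Suc (Suc n)) powr ?s) = real (n + 2) powr x"
        using norm_powr_real_powr[of "of_nat (Suc (Suc n))" ?s] by simp
      then have "norm (a (Suc (Suc n)) / of_nat (Suc (Suc n)) powr ?s) = norm (a (Suc (Suc n))) * real (n + 2) powr - x"
        by (simp add: norm_divide norm_mult norm_inverse powr_minus divide_inverse)
      also have "\<dots> \<le> bound * real (n + 2) powr - x" by (intro mult_right_mono norm_a_le) auto
      also have "real (n + 2) powr - x = real (n + 2) powr (2 - x) * real (n + 2) powr - 2"
        by (simp flip: powr_add)
      also have "real (n + 2) powr (2 - x) \<le> 2 powr (2 - x)"
        using x by (intro powr_mono2') auto
      finally show ?thesis using bound_nonneg by (simp add: mult_left_mono mult_right_mono mult.assoc)
    qed
    have "(\<lambda>n. a (Suc (Suc n)) / of_nat (Suc (Suc n)) powr ?s) sums (continued_dirichlet_series a ?s - a 1)"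
      using continued_dirichlet_series_sums[of ?s] x by (subst sums_Suc_iff) simp
    then have "norm (continued_dirichlet_series a ?s - a 1) \<le> (\<Sum>n. bound * 2 powr (2 - x) * real (n + 2) powr - 2)"
      using norm_suminf_le[OF le summable_mult[OF sm2]] by (simp add: sums_iff)
    also have "\<dots> = C * 2 powr (2 - x)" using suminf_mult[OF sm2] by (simp add: C_def)
    finally show ?thesis .
  qed
  have "((\<lambda>x. C * 2 powr (2 - x)) \<longlongrightarrow> 0) at_top" by real_asymp
  then have "((\<lambda>x. continued_dirichlet_series a (Complex x 1) - a 1) \<longlongrightarrow> 0) at_top"
    by (rule Lim_null_comparison[rotated]) (rule eventually_at_top_linorderI[of 2], rule est)
  then show ?thesis by (rule LIM_zero_cancel)
qed

end

section \<open>The two coefficient sequences and the Gauss sum modulo 5\<close>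

lemma selfdual_one: "selfdual_coefficients (\<lambda>_. 1) (Suc 0)"
  by unfold_locales auto

lemma wave_of_nat_mult: "wave (of_nat k * x) = wave x ^ k"
  by (induction k) (auto simp: distrib_right wave_add)

lemma cnj_wave: "cnj (wave x) = wave (- x)"
  by (simp add: wave_def cis_cnj)

text \<open>That the fifth roots of unity add up to 0 gives the square 5 of the Gauss sum. Its sign
  comes from writing it as 2 Re w - 2 Re (w^2), where w lies in the right half-plane and w^2 in the
  left.\<close>

lemma quintic_gauss_sum:
  defines "w \<equiv> wave (1 / 5)"
  shows "w ^ 5 = 1" "w - w ^ 2 - w ^ 3 + w ^ 4 = of_real (sqrt 5)"
proof -
  have "wave (of_nat 5 * (1 / 5)) = wave (of_int 1)" by simp
  then show w5: "w ^ 5 = 1" unfolding w_def wave_of_nat_mult wave_int .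
  have re: "Re w > 0" "Re (w ^ 2) < 0"
  proof -
    show "Re w > 0" unfolding w_def wave_def by (simp, rule cos_gt_zero_pi) (use pi_gt_zero in linarith)+
    have "w ^ 2 = wave (of_nat 2 * (1 / 5))" unfolding wave_of_nat_mult w_def ..
    then have "Re (w ^ 2) = cos (4 * pi / 5)" by (simp add: wave_def)
    also have "\<dots> < cos (pi / 2)" by (rule cos_monotone_0_pi) auto
    finally show "Re (w ^ 2) < 0" by simp
  qed
  have "w \<noteq> 1"
  proof
    assume "w = 1"
    then show False using re by simp
  qed
  moreover have "(w - 1) * (1 + w + w ^ 2 + w ^ 3 + w ^ 4) = w ^ 5 - 1"
    by (simp add: algebra_simps eval_nat_numeral)
  ultimately have sum0: "1 + w + w ^ 2 + w ^ 3 + w ^ 4 = 0" using w5 by simp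
  have "norm w = 1" by (simp add: w_def)
  then have "w * cnj w = 1" by (simp add: complex_norm_square[symmetric])
  then have cw: "cnj w = w ^ 4" "cnj (w ^ 2) = w ^ 3"
  proof -
    assume 1: "w * cnj w = 1"
    have "cnj w = w ^ 5 * cnj w" using w5 by simp
    also have "\<dots> = w ^ 4 * (w * cnj w)" by (simp add: eval_nat_numeral)
    finally show c: "cnj w = w ^ 4" using 1 by simp
    have "cnj (w ^ 2) = w ^ 5 * w ^ 3" unfolding complex_cnj_power c by (simp flip: power_mult power_add)
    then show "cnj (w ^ 2) = w ^ 3" using w5 by simp
  qed
  define g where "g = w - w ^ 2 - w ^ 3 + w ^ 4"
  have "g ^ 2 = w ^ 2 - 2 * w ^ 3 - w ^ 4 + 4 * w ^ 5 - w ^ 5 * w - 2 * (w ^ 5 * w ^ 2) + w ^ 5 * w ^ 3"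
    by (simp add: g_def algebra_simps eval_nat_numeral)
  also have "\<dots> = 5 - (1 + w + w ^ 2 + w ^ 3 + w ^ 4)" unfolding w5 by simp
  finally have g2: "g ^ 2 = 5" using sum0 by simp
  have "g = (w + cnj w) - (w ^ 2 + cnj (w ^ 2))" unfolding cw g_def by simp
  then have g: "g = of_real (2 * Re w - 2 * Re (w ^ 2))" by (simp only: complex_add_cnj of_real_diff)
  define x where "x = 2 * Re w - 2 * Re (w ^ 2)"
  have "x > 0" using re by (simp add: x_def)
  moreover have "complex_of_real (x ^ 2) = of_real 5" using g2 g by (simp add: x_def)
  then have "x ^ 2 = 5" using of_real_eq_iff by blast
  ultimately have "sqrt 5 = x" by (intro real_sqrt_unique) auto
  then show "w - w ^ 2 - w ^ 3 + w ^ 4 = of_real (sqrt 5)" using g by (simp add: g_def x_def)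
qed

context
  fixes \<psi> :: "nat \<Rightarrow> complex"
  assumes char: "dirichlet_character 5 \<psi>" and psi2: "\<psi> 2 = -1"
begin

lemma psi_mult: "\<psi> (m * n) = \<psi> m * \<psi> n" and psi_add: "\<psi> (n + 5) = \<psi> n"
  and psi_nz: "\<psi> n \<noteq> 0 \<longleftrightarrow> coprime n 5"
  using char by (auto simp: dirichlet_character_def)

lemma psi_mod: "\<psi> n = \<psi> (n mod 5)"
proof (induction n rule: less_induct)
  case (less n)
  show ?case
  proof (cases "n < 5")
    case False
    then have "\<psi> n = \<psi> (n - 5)" using psi_add[of "n - 5"] by simp
    also have "\<dots> = \<psi> ((n - 5) mod 5)" by (rule less) (use False in auto)
    also have "(n - 5) mod 5 = n mod 5" using False by (simp add: le_mod_geq)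
    finally show ?thesis .
  qed simp
qed

lemma psi_values: "\<psi> 0 = 0" "\<psi> 1 = 1" "\<psi> (Suc 0) = 1" "\<psi> 3 = -1" "\<psi> 4 = 1"
proof -
  show "\<psi> 0 = 0" using psi_nz[of 0] by auto
  show "\<psi> 1 = 1" using psi_mult[of 1 2] psi2 by simp
  then show "\<psi> (Suc 0) = 1" by simp
  show 4: "\<psi> 4 = 1" using psi_mult[of 2 2] psi2 by simp
  show "\<psi> 3 = -1" using psi_mult[of 2 4] psi_add[of 3] psi2 4 by simp
qed

text \<open>Both sides depend on n modulo 5 only. For n prime to 5, multiplying the exponents by n
  permutes the four powers of w and multiplies the Gauss sum by \<open>\<psi> n\<close>; for n
  divisible by 5 the four signs cancel.\<close>

lemma psi_dft: "(\<Sum>r<5. \<psi> r * wave (of_nat r * of_nat n / 5)) = of_real (sqrt 5) * \<psi> n"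
proof -
  define w where "w = wave (1 / 5)"
  note w = quintic_gauss_sum[folded w_def]
  have pw: "wave (of_nat r * of_nat n / 5) = w ^ ((n mod 5) * r)" for r
  proof -
    have "wave (of_nat r * of_nat n / 5) = w ^ (n * r)"
      using wave_of_nat_mult[of "n * r" "1 / 5"] by (simp add: w_def mult.commute)
    also have "\<dots> = (w ^ n) ^ r" by (rule power_mult)
    also have "w ^ n = w ^ (5 * (n div 5) + n mod 5)" by simp
    also have "\<dots> = w ^ (n mod 5)" by (simp only: power_add power_mult w(1) power_one mult_1_left)
    finally show ?thesis by (simp only: power_mult)
  qed
  have mod_cases: "n mod 5 = 0 \<or> n mod 5 = 1 \<or> n mod 5 = 2 \<or> n mod 5 = 3 \<or> n mod 5 = 4" by linarith
  have red: "w ^ 6 = w" "w ^ 8 = w ^ 3" "w ^ 9 = w ^ 4" "w ^ 12 = w ^ 2" "w ^ 16 = w"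
  proof -
    have "w ^ 6 = w ^ 5 * w" "w ^ 8 = w ^ 5 * w ^ 3" "w ^ 9 = w ^ 5 * w ^ 4" "w ^ 12 = w ^ 5 * w ^ 5 * w ^ 2"
      "w ^ 16 = w ^ 5 * w ^ 5 * w ^ 5 * w"
      by (simp_all add: eval_nat_numeral)
    then show "w ^ 6 = w" "w ^ 8 = w ^ 3" "w ^ 9 = w ^ 4" "w ^ 12 = w ^ 2" "w ^ 16 = w"
      unfolding w(1) by simp_all
  qed
  have sum5: "(\<Sum>r<5. h r) = h 0 + h 1 + h 2 + h 3 + h 4" for h :: "nat \<Rightarrow> complex"
    by (simp add: eval_nat_numeral)
  have "(\<Sum>r<5. \<psi> r * wave (of_nat r * of_nat n / 5)) = w ^ (n mod 5) - w ^ ((n mod 5) * 2) - w ^ ((n mod 5) * 3) + w ^ ((n mod 5) * 4)"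
    unfolding pw sum5 by (simp add: psi_values psi2)
  also have "\<dots> = of_real (sqrt 5) * \<psi> (n mod 5)"
    using mod_cases
  proof (elim disjE)
    assume n: "n mod 5 = 1"
    show ?thesis unfolding n using w(2) by (simp add: psi_values)
  next
    assume n: "n mod 5 = 2"
    show ?thesis unfolding n using arg_cong[OF w(2), of uminus] by (simp add: psi2 red algebra_simps)
  next
    assume n: "n mod 5 = 3"
    show ?thesis unfolding n using arg_cong[OF w(2), of uminus] by (simp add: psi_values red algebra_simps)
  next
    assume n: "n mod 5 = 4"
    show ?thesis unfolding n using w(2) by (simp add: psi_values red algebra_simps)
  qed (simp add: psi_values)
  also have "\<psi> (n mod 5) = \<psi> n" by (rule psi_mod[symmetric])
  finally show ?thesis .
qed

lemma psi_real: "cnj (\<psi> n) = \<psi> n"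
proof -
  have "n mod 5 = 0 \<or> n mod 5 = 1 \<or> n mod 5 = 2 \<or> n mod 5 = 3 \<or> n mod 5 = 4" by linarith
  then show ?thesis
    by (subst (1 2) psi_mod) (auto simp: psi_values psi2)
qed

lemma selfdual_psi: "selfdual_coefficients \<psi> 5"
proof
  show "(\<Sum>r<5. \<psi> r * wave (of_nat r * of_int m / of_nat 5)) = of_real (sqrt (of_nat 5)) * \<psi> (nat \<bar>m\<bar>)" for m :: int
  proof (cases m rule: int_cases2)
    case (nonneg n)
    then show ?thesis using psi_dft[of n] by simp
  next
    case (nonpos n)
    have "cnj (\<Sum>r<5. \<psi> r * wave (of_nat r * of_nat n / 5)) = cnj (of_real (sqrt 5) * \<psi> n)"
      unfolding psi_dft ..
    then show ?thesis using nonpos by (simp add: psi_real cnj_wave)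
  qed
qed (use psi_real in auto)

section \<open>The completed family and its double zeros\<close>

interpretation Z: selfdual_coefficients "\<lambda>_. 1" "Suc 0" by (rule selfdual_one)
interpretation P: selfdual_coefficients \<psi> 5 by (rule selfdual_psi)

definition gamma_factor :: "complex \<Rightarrow> complex" where
  "gamma_factor s = exp (s / 2 * of_real (ln (pi / 5))) * rGamma (s / 2)"

text \<open>The completion of (1 + sqrt 5 * 5^(-s)) zeta(s) with the gamma factor of conductor 5.
  The passage from pi to pi/5 contributes 5^(s/2), which makes the factor in front invariant under s
  -> 1-s.\<close>

definition Lam_A :: "complex \<Rightarrow> complex" where
  "Lam_A s = (exp (s / 2 * of_real (ln 5)) + exp ((1 - s) / 2 * of_real (ln 5))) * Z.Lam s"

lemma upper_half_not_special: "Im s > 0 \<Longrightarrow> s \<noteq> 0 \<and> s \<noteq> 1" for s :: complex by auto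

lemma f_family_eq:
  assumes "Im s > 0"
  shows "f_family \<psi> s \<tau> = gamma_factor s * ((1 - of_real \<tau>) * Lam_A s + of_real \<tau> * P.Lam s)"
proof -
  have s: "s \<noteq> 0" "s \<noteq> 1" using upper_half_not_special[OF assms] by auto
  have z: "riemann_zeta s = Z.Lam s * exp (s / 2 * of_real (ln pi)) * rGamma (s / 2)"
    unfolding riemann_zeta_def using Z.continued_dirichlet_series_Lam[OF s] by (simp add: Z.c_def)
  have l: "dirichlet_L s \<psi> = P.Lam s * exp (s / 2 * of_real (ln (pi / 5))) * rGamma (s / 2)"
    unfolding dirichlet_L_def using P.continued_dirichlet_series_Lam[OF s] by (simp add: P.c_def)
  have s5: "complex_of_real (sqrt 5) = exp (of_real (ln 5) / 2)"
  proof -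
    have "sqrt 5 = exp (ln 5 / 2)"
      by (rule real_sqrt_unique) (simp_all add: power2_eq_square flip: exp_add)
    then show ?thesis by (simp flip: exp_of_real)
  qed
  have p5: "5 powr (- s) = exp (- s * of_real (ln 5))"
    using Ln_of_real[of 5] by (simp add: powr_def)
  have "ln pi = ln (pi / 5) + ln 5" by (simp add: ln_div)
  then have epi: "exp (s / 2 * of_real (ln pi)) = exp (s / 2 * of_real (ln (pi / 5))) * exp (s / 2 * of_real (ln 5))"
    by (simp only: of_real_add distrib_left exp_add)
  have "of_real (sqrt 5) * 5 powr (- s) * exp (s / 2 * of_real (ln 5)) = exp (of_real (ln 5) / 2 + - s * of_real (ln 5) + s / 2 * of_real (ln 5))"
    unfolding s5 p5 by (simp only: exp_add)
  also have "of_real (ln 5) / 2 + - s * of_real (ln 5) + s / 2 * of_real (ln 5) = (1 - s) / 2 * of_real (ln 5)"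
    by (simp add: field_simps)
  finally have e: "(1 + of_real (sqrt 5) * 5 powr (- s)) * exp (s / 2 * of_real (ln 5))
      = exp (s / 2 * of_real (ln 5)) + exp ((1 - s) / 2 * of_real (ln 5))"
    by (simp only: distrib_right mult_1_left)
  have "(1 + of_real (sqrt 5) * 5 powr (- s)) * riemann_zeta s
      = exp (s / 2 * of_real (ln (pi / 5))) * rGamma (s / 2) * ((1 + of_real (sqrt 5) * 5 powr (- s)) * exp (s / 2 * of_real (ln 5))) * Z.Lam s"
    unfolding z epi by (simp only: mult_ac)
  also have "\<dots> = gamma_factor s * Lam_A s" unfolding e by (simp only: gamma_factor_def Lam_A_def mult.assoc)
  finally have A: "(1 + of_real (sqrt 5) * 5 powr (- s)) * riemann_zeta s = gamma_factor s * Lam_A s" .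
  have B: "dirichlet_L s \<psi> = gamma_factor s * P.Lam s" unfolding l gamma_factor_def by (simp only: mult_ac)
  show ?thesis unfolding f_family_def B mult.assoc A by (simp add: algebra_simps)
qed

lemma upper_half_holomorphic:
  "gamma_factor holomorphic_on {s. Im s > 0}" "Lam_A holomorphic_on {s. Im s > 0}" "P.Lam holomorphic_on {s. Im s > 0}"
proof -
  have sub: "{s. Im s > 0} \<subseteq> - {0, 1}" by auto
  show "gamma_factor holomorphic_on {s. Im s > 0}" unfolding gamma_factor_def by (intro holomorphic_intros) auto
  show "P.Lam holomorphic_on {s. Im s > 0}" by (rule holomorphic_on_subset[OF P.Lam_holomorphic sub])
  show "Lam_A holomorphic_on {s. Im s > 0}"
    unfolding Lam_A_def by (intro holomorphic_intros holomorphic_on_subset[OF Z.Lam_holomorphic sub]) auto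
qed

lemma Lam_P_reflect: "P.Lam (1 - cnj s) = cnj (P.Lam s)"
  by (simp add: P.Lam_reflect P.cnj_Lam)

lemma Lam_A_reflect: "Lam_A (1 - cnj s) = cnj (Lam_A s)"
  by (simp add: Lam_A_def Z.Lam_reflect Z.cnj_Lam exp_cnj add.commute)

lemma half_not_nonpos_Int: "Im s > 0 \<Longrightarrow> s / 2 \<notin> \<int>\<^sub>\<le>\<^sub>0" for s :: complex
  by (auto elim!: nonpos_Ints_cases simp: complex_eq_iff)

lemma gamma_factor_nz: "Im s > 0 \<Longrightarrow> gamma_factor s \<noteq> 0"
  using half_not_nonpos_Int[of s] by (simp add: gamma_factor_def rGamma_eq_zero_iff)

text \<open>The logarithmic derivative is (ln (pi/5) - Digamma (s/2)) / 2. The first part is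
  negative since pi < 5, and Im s > 20 puts s/2 above height 10, where Re Digamma is
  positive.\<close>

lemma Re_gamma_factor_log_deriv:
  assumes "Re s = 1/2" "Im s > 20"
  shows "Re (deriv gamma_factor s / gamma_factor s) < 0"
proof -
  have im: "Im s > 0" using assms by simp
  have "((\<lambda>s. rGamma (s / 2)) has_field_derivative (- rGamma (s / 2) * Digamma (s / 2)) * (1 / 2)) (at s)"
    by (rule DERIV_chain2[where f = rGamma and g = "\<lambda>s. s / 2", OF has_field_derivative_rGamma_no_nonpos_int[OF half_not_nonpos_Int[OF im]]])
       (auto intro!: derivative_eq_intros)
  moreover have "((\<lambda>s. exp (s / 2 * of_real (ln (pi / 5)))) has_field_derivative
      exp (s / 2 * of_real (ln (pi / 5))) * (of_real (ln (pi / 5)) / 2)) (at s)"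
    by (auto intro!: derivative_eq_intros)
  ultimately have "(gamma_factor has_field_derivative
     exp (s / 2 * of_real (ln (pi / 5))) * (of_real (ln (pi / 5)) / 2) * rGamma (s / 2)
     + (- rGamma (s / 2) * Digamma (s / 2)) * (1 / 2) * exp (s / 2 * of_real (ln (pi / 5)))) (at s)"
    unfolding gamma_factor_def by (intro DERIV_mult)
  then have "deriv gamma_factor s = gamma_factor s * (of_real (ln (pi / 5)) / 2 - Digamma (s / 2) / 2)"
    by (subst DERIV_imp_deriv) (auto simp: gamma_factor_def algebra_simps)
  then have "deriv gamma_factor s / gamma_factor s = of_real (ln (pi / 5)) / 2 - Digamma (s / 2) / 2"
    using gamma_factor_nz[OF im] by simp
  then have "Re (deriv gamma_factor s / gamma_factor s) = ln (pi / 5) / 2 - Re (Digamma (s / 2)) / 2" by simp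
  moreover have "Re (Digamma (s / 2)) > 0"
    by (rule Re_Digamma_pos) (use assms in auto)
  moreover have "ln (pi / 5) < 0" using pi_less_4 by (intro ln_less_zero) auto
  ultimately show ?thesis by linarith
qed

text \<open>Far to the right both members tend to 1, so their affine combination does too, for every
  real \<tau>. The factorisation at a zero of finite order rests on this.\<close>

lemma f_family_not_identically_zero: "\<exists>s. Im s > 0 \<and> f_family \<psi> s \<tau> \<noteq> 0"
proof -
  have z: "((\<lambda>x. riemann_zeta (Complex x 1)) \<longlongrightarrow> 1) at_top"
    unfolding riemann_zeta_def by (rule Z.continued_dirichlet_series_at_top)
  have l: "((\<lambda>x. dirichlet_L (Complex x 1) \<psi>) \<longlongrightarrow> 1) at_top"
    unfolding dirichlet_L_def using P.continued_dirichlet_series_at_top psi_values(2) by simp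
  have p: "((\<lambda>x. 5 powr (- Complex x 1)) \<longlongrightarrow> 0) at_top"
  proof (rule tendsto_norm_zero_cancel)
    have "((\<lambda>x::real. 5 powr - x) \<longlongrightarrow> 0) at_top" by real_asymp
    moreover have "norm (5 powr (- Complex x 1)) = 5 powr - x" for x
      using norm_powr_real_powr[of 5 "- Complex x 1"] by simp
    ultimately show "((\<lambda>x. norm (5 powr (- Complex x 1))) \<longlongrightarrow> 0) at_top" by simp
  qed
  have "((\<lambda>x. f_family \<psi> (Complex x 1) \<tau>) \<longlongrightarrow> (1 - of_real \<tau>) * (1 + of_real (sqrt 5) * 0) * 1 + of_real \<tau> * 1) at_top"
    unfolding f_family_def by (intro tendsto_intros z l p)
  then have "((\<lambda>x. f_family \<psi> (Complex x 1) \<tau>) \<longlongrightarrow> 1) at_top" by simp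
  then have "eventually (\<lambda>x. f_family \<psi> (Complex x 1) \<tau> \<noteq> 0) at_top"
    by (rule tendsto_imp_eventually_ne) simp
  then obtain x where "f_family \<psi> (Complex x 1) \<tau> \<noteq> 0"
    using eventually_happens' trivial_limit_at_top_linorder by blast
  then show ?thesis by (intro exI[of _ "Complex x 1"]) simp
qed

text \<open>Dividing the nonvanishing cofactor of the double zero by the gamma factor gives
  \<open>a\<close>. Since the completed function is symmetric and
  \<open>(s - \<rho>\<^sub>0)^2\<close> is conjugated by reflection, \<open>a\<close> inherits the
  symmetry, at \<open>\<rho>\<^sub>0\<close> itself by continuity.\<close>

lemma f_family_reflected_double_zero:
  assumes "zorder (\<lambda>s. f_family \<psi> s \<tau>\<^sub>0) \<rho>\<^sub>0 = 2" "Re \<rho>\<^sub>0 = 1/2" "Im \<rho>\<^sub>0 > 20"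
  obtains a R where "reflected_double_zero a (\<lambda>s. P.Lam s - Lam_A s) gamma_factor \<rho>\<^sub>0 R (f_family \<psi>) \<tau>\<^sub>0"
proof -
  let ?S = "{s. Im s > 0}"
  let ?f = "\<lambda>s. f_family \<psi> s \<tau>\<^sub>0"
  define F0 where "F0 = (\<lambda>s. (1 - of_real \<tau>\<^sub>0) * Lam_A s + of_real \<tau>\<^sub>0 * P.Lam s)"
  have F0_reflect: "F0 (1 - cnj s) = cnj (F0 s)" for s
    by (simp add: F0_def Lam_A_reflect Lam_P_reflect)
  have S: "open ?S" "connected ?S"
    using open_halfspace_Im_gt convex_halfspace_Im_gt convex_connected by auto
  have \<rho>: "\<rho>\<^sub>0 \<in> ?S" using assms by simp
  have "(\<lambda>s. gamma_factor s * F0 s) holomorphic_on ?S"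
    unfolding F0_def by (intro holomorphic_intros upper_half_holomorphic)
  then have f_holo: "?f holomorphic_on ?S"
    by (rule holomorphic_transform) (simp add: f_family_eq F0_def)
  obtain r where r: "r > 0" "cball \<rho>\<^sub>0 r \<subseteq> ?S" "zor_poly ?f \<rho>\<^sub>0 holomorphic_on cball \<rho>\<^sub>0 r"
      "\<forall>w\<in>cball \<rho>\<^sub>0 r. ?f w = zor_poly ?f \<rho>\<^sub>0 w * (w - \<rho>\<^sub>0) ^ nat (zorder ?f \<rho>\<^sub>0) \<and> zor_poly ?f \<rho>\<^sub>0 w \<noteq> 0"
    using zorder_exist_zero[OF f_holo S \<rho>] f_family_not_identically_zero[of \<tau>\<^sub>0] by auto
  define a where "a = (\<lambda>s. zor_poly ?f \<rho>\<^sub>0 s / gamma_factor s)"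
  have sub: "ball \<rho>\<^sub>0 r \<subseteq> ?S" using r(2) ball_subset_cball by blast
  have im: "Im s > 0" if "s \<in> ball \<rho>\<^sub>0 r" for s using that sub by blast
  have F0_eq: "F0 s = (s - \<rho>\<^sub>0)^2 * a s" if "s \<in> ball \<rho>\<^sub>0 r" for s
  proof -
    have "gamma_factor s * F0 s = zor_poly ?f \<rho>\<^sub>0 s * (s - \<rho>\<^sub>0)^2"
      using r(4) that assms(1) f_family_eq[OF im[OF that], of \<tau>\<^sub>0] by (simp add: F0_def)
    then show ?thesis using gamma_factor_nz[OF im[OF that]] by (simp add: a_def field_simps)
  qed
  have a_holo: "a holomorphic_on ball \<rho>\<^sub>0 r"
    unfolding a_def
    by (intro holomorphic_intros holomorphic_on_subset[OF r(3) ball_subset_cball]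
        holomorphic_on_subset[OF upper_half_holomorphic(1) sub] gamma_factor_nz im)
  have refl_diff: "(1 - cnj s) - \<rho>\<^sub>0 = - cnj (s - \<rho>\<^sub>0)" for s
    using assms(2) by (simp add: complex_eq_iff)
  have refl_ball: "1 - cnj s \<in> ball \<rho>\<^sub>0 r" if "s \<in> ball \<rho>\<^sub>0 r" for s
    using that dist_reflect_line[OF assms(2)] by simp
  have a_reflect_ne: "a (1 - cnj s) = cnj (a s)" if s: "s \<in> ball \<rho>\<^sub>0 r" "s \<noteq> \<rho>\<^sub>0" for s
  proof -
    have "(cnj (s - \<rho>\<^sub>0))^2 * a (1 - cnj s) = (cnj (s - \<rho>\<^sub>0))^2 * cnj (a s)"
      using F0_eq[OF refl_ball[OF s(1)]] F0_eq[OF s(1)] F0_reflect[of s] unfolding refl_diff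
      by (simp only: power2_minus complex_cnj_mult complex_cnj_power)
    then show ?thesis using s(2) by simp
  qed
  have ca: "continuous_on (ball \<rho>\<^sub>0 r) a" using a_holo by (rule holomorphic_on_imp_continuous_on)
  have "a (1 - cnj \<rho>\<^sub>0) = cnj (a \<rho>\<^sub>0)"
  proof (rule continuous_on_ball_eq_centre[where f = "\<lambda>s. a (1 - cnj s)" and g = "\<lambda>s. cnj (a s)"])
    show "continuous_on (ball \<rho>\<^sub>0 r) (\<lambda>s. a (1 - cnj s))"
      by (rule continuous_on_compose2[OF ca]) (use refl_ball in \<open>auto intro!: continuous_intros\<close>)
    show "continuous_on (ball \<rho>\<^sub>0 r) (\<lambda>s. cnj (a s))" by (intro continuous_intros ca)
  qed (use r(1) a_reflect_ne in auto)
  then have a_reflect: "a (1 - cnj s) = cnj (a s)" if "s \<in> ball \<rho>\<^sub>0 r" for s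
    using a_reflect_ne[OF that] by (cases "s = \<rho>\<^sub>0") auto
  have "reflected_double_zero a (\<lambda>s. P.Lam s - Lam_A s) gamma_factor \<rho>\<^sub>0 r (f_family \<psi>) \<tau>\<^sub>0"
  proof
    show "(\<lambda>s. P.Lam s - Lam_A s) holomorphic_on ball \<rho>\<^sub>0 r" "gamma_factor holomorphic_on ball \<rho>\<^sub>0 r"
      by (intro holomorphic_intros holomorphic_on_subset[OF upper_half_holomorphic(1) sub]
        holomorphic_on_subset[OF upper_half_holomorphic(2) sub] holomorphic_on_subset[OF upper_half_holomorphic(3) sub])+
    show "a \<rho>\<^sub>0 \<noteq> 0" using r(1,4) gamma_factor_nz[of \<rho>\<^sub>0] \<rho> by (simp add: a_def)
    show "f_family \<psi> s \<tau> = gamma_factor s * ((s - \<rho>\<^sub>0)^2 * a s + of_real (\<tau> - \<tau>\<^sub>0) * (P.Lam s - Lam_A s))" if "s \<in> ball \<rho>\<^sub>0 r" for s \<tau>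
      unfolding f_family_eq[OF im[OF that]] F0_eq[OF that, symmetric] by (simp add: F0_def algebra_simps)
    show "Re (deriv gamma_factor \<rho>\<^sub>0 / gamma_factor \<rho>\<^sub>0) < 0" by (rule Re_gamma_factor_log_deriv[OF assms(2,3)])
  qed (use r(1) assms(2) a_holo a_reflect Lam_A_reflect Lam_P_reflect gamma_factor_nz im in auto)
  then show ?thesis by (rule that)
qed

end

theorem theorem3:
  fixes \<psi> :: "nat \<Rightarrow> complex"
  assumes "dirichlet_character 5 \<psi>" and "\<psi> 2 = -1"
  shows "\<exists>T::real. \<forall>(\<tau>\<^sub>0::real)\<in>{0..1}. \<forall>\<rho>\<^sub>0::complex.
    f_family \<psi> \<rho>\<^sub>0 \<tau>\<^sub>0 = 0 \<and> zorder (\<lambda>s. f_family \<psi> s \<tau>\<^sub>0) \<rho>\<^sub>0 = 2 \<and>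
    Re \<rho>\<^sub>0 = 1/2 \<and> Im \<rho>\<^sub>0 > T \<longrightarrow>
    ((\<exists>\<theta>>0. \<exists>\<rho>. zero_trajectory (f_family \<psi>) \<tau>\<^sub>0 \<theta> \<rho> \<and> \<rho> \<tau>\<^sub>0 = \<rho>\<^sub>0 \<and>
        (\<forall>\<tau>\<in>{\<tau>\<^sub>0 - \<theta><..<\<tau>\<^sub>0}. Re (\<rho> \<tau>) = 1/2) \<and>
        (\<forall>\<tau>\<in>{\<tau>\<^sub>0<..<\<tau>\<^sub>0 + \<theta>}. Re (\<rho> \<tau>) < 1/2))
     \<longleftrightarrow>
     (\<exists>\<eta>>0. \<exists>\<rho>'. zero_trajectory (f_family_deriv \<psi>) \<tau>\<^sub>0 \<eta> \<rho>' \<and> \<rho>' \<tau>\<^sub>0 = \<rho>\<^sub>0 \<and>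
        (\<forall>\<tau>\<in>{\<tau>\<^sub>0 - \<eta><..<\<tau>\<^sub>0}. Re (\<rho>' \<tau>) > 1/2) \<and>
        (\<forall>\<tau>\<in>{\<tau>\<^sub>0<..<\<tau>\<^sub>0 + \<eta>}. Re (\<rho>' \<tau>) < 1/2)))"
proof (intro exI[of _ 20] ballI allI impI, elim conjE)
  fix \<tau>\<^sub>0 :: real and \<rho>\<^sub>0 :: complex
  assume zero: "zorder (\<lambda>s. f_family \<psi> s \<tau>\<^sub>0) \<rho>\<^sub>0 = 2" "Re \<rho>\<^sub>0 = 1/2" "Im \<rho>\<^sub>0 > 20"
  obtain a D \<kappa> R where "reflected_double_zero a D \<kappa> \<rho>\<^sub>0 R (f_family \<psi>) \<tau>\<^sub>0"
    using f_family_reflected_double_zero[OF assms zero] by metis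
  then interpret reflected_double_zero a D \<kappa> \<rho>\<^sub>0 R "f_family \<psi>" \<tau>\<^sub>0 .
  have "f' = f_family_deriv \<psi>"
    by (intro ext) (simp add: f_family_deriv_def)
  then show "(\<exists>\<theta>>0. \<exists>\<rho>. zero_trajectory (f_family \<psi>) \<tau>\<^sub>0 \<theta> \<rho> \<and> \<rho> \<tau>\<^sub>0 = \<rho>\<^sub>0 \<and>
        (\<forall>\<tau>\<in>{\<tau>\<^sub>0 - \<theta><..<\<tau>\<^sub>0}. Re (\<rho> \<tau>) = 1/2) \<and>
        (\<forall>\<tau>\<in>{\<tau>\<^sub>0<..<\<tau>\<^sub>0 + \<theta>}. Re (\<rho> \<tau>) < 1/2))
     \<longleftrightarrow>
     (\<exists>\<eta>>0. \<exists>\<rho>'. zero_trajectory (f_family_deriv \<psi>) \<tau>\<^sub>0 \<eta> \<rho>' \<and> \<rho>' \<tau>\<^sub>0 = \<rho>\<^sub>0 \<and>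
        (\<forall>\<tau>\<in>{\<tau>\<^sub>0 - \<eta><..<\<tau>\<^sub>0}. Re (\<rho>' \<tau>) > 1/2) \<and>
        (\<forall>\<tau>\<in>{\<tau>\<^sub>0<..<\<tau>\<^sub>0 + \<eta>}. Re (\<rho>' \<tau>) < 1/2))"
    using leaves_line_iff_deriv_crosses_line unfolding leaves_line_def deriv_crosses_line_def by simp
qed

end
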